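(* Let $g$ be an integrable function on $\mathbb{R}^d$ such that the kernel $K(x,y)=g(x-y)$ satisfies, for some $\alpha\in(0,1]$, $$\|r_K\|_1+\sup_{0<\delta\le 1}\delta^{-\alpha}\|r_{\omega_\delta(K)}\|_1+\sup_{0<\delta\le 1}\delta^{-\alpha}\|r_K\chi_{|\cdot|\le\delta}\|_1<\infty,$$ and let $Tf(x)=\int_{\mathbb{R}^d}g(x-y)f(y)\,dy$. Then $$s_{p,w}(T)=\{\hat g(\xi):\ \xi\in\mathbb{R}^d\}\cup\{0\}$$ for all $1\le p<\infty$ and all $A_p$-weights $w$.
   Context: $|x|:=\max_i|x_i|$ for $x\in\mathbb{R}^d$; $\|\cdot\|_1$ is the $L^1(\mathbb{R}^d)$ norm; $\chi_{|\cdot|\le\delta}$ is the indicator function of $\{x:|x|\le\delta\}$; $I$ is the identity operator; $\hat g(\xi)=\int_{\mathbb{R}^d}g(x)e^{-ix\xi}dx$. For a kernel $K$ on $\mathbb{R}^d\times\mathbb{R}^d$, $r_K(x):=\sup_{|y-y'|\ge|x|}|K(y,y')|$ for $x\in\mathbb{R}^d$. For $\delta>0$, $\omega_\delta(K)(x,y)=\sup_{|x'-x|,|y'-y|\le\delta}|K(x',y')-K(x,y)|$ if $|x-y|\ge4\delta$, and $\omega_\delta(K)(x,y)=0$ otherwise. A weight is a positive locally integrable function on $\mathbb{R}^d$. For $1<p<\infty$, $w$ is an $A_p$-weight if there is $A<\infty$ with $\big(\frac1{|Q|}\int_Qw\big)\big(\frac1{|Q|}\int_Qw^{-1/(p-1)}\big)^{p-1}\le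 A$ for all cubes $Q$; $w$ is an $A_1$-weight if there is $A<\infty$ with $\frac1{|Q|}\int_Qw\le A\inf_{x\in Q}w(x)$ for all cubes $Q$. $L^p_w$ is the space of measurable $f$ on $\mathbb{R}^d$ with $\|f\|_{p,w}=(\int|f|^pw\,dx)^{1/p}<\infty$; when $\|r_K\|_1<\infty$, $T$ is bounded on $L^p_w$ for all such $p,w$. $s_{p,w}(T)$ is the set of all $z\in\mathbb{C}$ such that $zI-T$ does not have stability on $L^p_w$, where stability means that there is $C>0$ with $\|(zI-T)f\|_{p,w}\ge C\|f\|_{p,w}$ for all $f\in L^p_w$. *)

theory Defs
  imports "HOL-Analysis.Analysis"
begin

text \<open>
  The norm $|x| = \max_i |x_i|$ is \<^const>\<open>infnorm\<close>. Suprema and integrals that may be infinite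
  take values in \<^typ>\<open>ennreal\<close>.
\<close>

type_synonym 'n kernel = "real ^ 'n \<Rightarrow> real ^ 'n \<Rightarrow> complex"

text \<open>
  The operation $K \mapsto r_K$ depends only on $|K|$ and is applied both to a complex kernel and to
  its oscillation, which need not be finite; it is therefore defined on the modulus of a kernel.
\<close>

definition kernel_abs :: "('n::finite) kernel \<Rightarrow> real ^ 'n \<Rightarrow> real ^ 'n \<Rightarrow> ennreal" where
  "kernel_abs K x y = ennreal (norm (K x y))"

definition rad_sup :: "(real ^ 'n \<Rightarrow> real ^ 'n \<Rightarrow> ennreal) \<Rightarrow> real ^ ('n::finite) \<Rightarrow> ennreal" where
  "rad_sup k x = (SUP (y, y') \<in> {(y, y'). infnorm (y - y') \<ge> infnorm x}. k y y')"

definition kernel_osc :: "real \<Rightarrow> ('n::finite) kernel \<Rightarrow> real ^ 'n \<Rightarrow> real ^ 'n \<Rightarrow> ennreal" where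
  "kernel_osc \<delta> K x y =
     (if infnorm (x - y) \<ge> 4 * \<delta>
      then SUP (x', y') \<in> {(x', y'). infnorm (x' - x) \<le> \<delta> \<and> infnorm (y' - y) \<le> \<delta>}.
             ennreal (norm (K x' y' - K x y))
      else 0)"

definition L1_norm :: "(real ^ 'n \<Rightarrow> ennreal) \<Rightarrow> ennreal" where
  "L1_norm h = (\<integral>\<^sup>+ x. h x \<partial>lebesgue)"

definition kernel_size :: "real \<Rightarrow> ('n::finite) kernel \<Rightarrow> ennreal" where
  "kernel_size \<alpha> K =
     L1_norm (rad_sup (kernel_abs K))
     + (SUP \<delta> \<in> {0<..1}. ennreal (\<delta> powr (- \<alpha>)) * L1_norm (rad_sup (kernel_osc \<delta> K)))
     + (SUP \<delta> \<in> {0<..1}. ennreal (\<delta> powr (- \<alpha>)) *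
          L1_norm (\<lambda>x. rad_sup (kernel_abs K) x * indicator {x. infnorm x \<le> \<delta>} x))"

text \<open>Powers of extended nonnegative reals; only meant for positive exponents.\<close>

definition epowr :: "ennreal \<Rightarrow> real \<Rightarrow> ennreal" where
  "epowr t a = (if t = \<infinity> then \<infinity> else ennreal (enn2real t powr a))"

definition cubes :: "(real ^ ('n::finite)) set set" where
  "cubes = {cbox a (a + (\<chi> i. l)) | a l. l > 0}"

definition weight :: "(real ^ ('n::finite) \<Rightarrow> real) \<Rightarrow> bool" where
  "weight w \<longleftrightarrow> (\<forall>x. w x > 0) \<and> (\<forall>S. compact S \<longrightarrow> set_integrable lebesgue S w)"

definition mean :: "(real ^ ('n::finite)) set \<Rightarrow> (real ^ 'n \<Rightarrow> real) \<Rightarrow> ennreal" where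
  "mean Q u = (\<integral>\<^sup>+ x \<in> Q. ennreal (u x) \<partial>lebesgue) / emeasure lebesgue Q"

definition Ap_weight :: "real \<Rightarrow> (real ^ ('n::finite) \<Rightarrow> real) \<Rightarrow> bool" where
  "Ap_weight p w \<longleftrightarrow> weight w \<and>
     (\<exists>A < \<infinity>. \<forall>Q \<in> cubes.
        if p = 1 then mean Q w \<le> A * (INF x \<in> Q. ennreal (w x))
        else mean Q w * epowr (mean Q (\<lambda>x. w x powr (- 1 / (p - 1)))) (p - 1) \<le> A)"

definition wnorm :: "real \<Rightarrow> (real ^ ('n::finite) \<Rightarrow> real) \<Rightarrow> (real ^ 'n \<Rightarrow> complex) \<Rightarrow> ennreal" where
  "wnorm p w f = epowr (\<integral>\<^sup>+ x. ennreal (norm (f x) powr p * w x) \<partial>lebesgue) (1 / p)"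

definition Lpw :: "real \<Rightarrow> (real ^ ('n::finite) \<Rightarrow> real) \<Rightarrow> (real ^ 'n \<Rightarrow> complex) set" where
  "Lpw p w = {f \<in> borel_measurable lebesgue. wnorm p w f < \<infinity>}"

definition stable ::
  "real \<Rightarrow> (real ^ ('n::finite) \<Rightarrow> real) \<Rightarrow> ((real ^ 'n \<Rightarrow> complex) \<Rightarrow> real ^ 'n \<Rightarrow> complex) \<Rightarrow> bool" where
  "stable p w S \<longleftrightarrow> (\<exists>C > 0. \<forall>f \<in> Lpw p w. wnorm p w (S f) \<ge> ennreal C * wnorm p w f)"

definition stability_spectrum ::
  "real \<Rightarrow> (real ^ ('n::finite) \<Rightarrow> real) \<Rightarrow> ((real ^ 'n \<Rightarrow> complex) \<Rightarrow> real ^ 'n \<Rightarrow> complex) \<Rightarrow> complex set"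
  where
  "stability_spectrum p w T = {z. \<not> stable p w (\<lambda>f x. z * f x - T f x)}"

definition conv_op :: "(real ^ ('n::finite) \<Rightarrow> complex) \<Rightarrow> (real ^ 'n \<Rightarrow> complex) \<Rightarrow> real ^ 'n \<Rightarrow> complex" where
  "conv_op g f x = (LINT y|lebesgue. g (x - y) * f y)"

definition fourier :: "(real ^ ('n::finite) \<Rightarrow> complex) \<Rightarrow> real ^ 'n \<Rightarrow> complex" where
  "fourier g \<xi> = (LINT x|lebesgue. g x * exp (- (\<i> * complex_of_real (x \<bullet> \<xi>))))"

end

(* Convolution with a kernel that has an integrable radially decreasing majorant is a superposition of
   averages over cubes, hence bounded on L^p_w.  If z is different from 0 and from all values of the
   Fourier transform, then |z - ghat| >= c > 0 by the Riemann-Lebesgue lemma, which here follows from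
   the oscillation bound.  Localise f by modulated Gaussians G_{s,xi}(x) = G_s(x) exp(i x.xi): for
   wide Gaussians T acts on f * G_{s,xi} almost like ghat(xi), uniformly in xi.  Since G is a
   convolution semigroup, iterating this m times bounds f * G_{ms,xi} by C |(z - T) f| + 2^(-m) |f|.
   A narrow Gaussian is a superposition of the G_{ms,xi}, with total mass only polynomial in m, and T
   almost annihilates the part of f not captured by it; taking m large absorbs the error.  Conversely
   the G_{s,xi} are approximate eigenfunctions for ghat(xi), and 0 is a limit of values of ghat. *)

theory Submission
  imports Defs "HOL-Probability.Probability" "HOL-Real_Asymp.Real_Asymp"
begin

text \<open>Neither Plancherel nor translation invariance survives on a weighted space; what is
  controlled is convolution with a kernel below a radially decreasing majorant, through the integral
  of that majorant. This bound sees only moduli and is the same for Gaussians of all widths, so the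
  estimates are uniform in the frequency. A single localisation is not enough: writing a Gaussian of
  variance \<tau> through Gaussians of variance s costs (s/\<tau>)^(d/2), while the error for wide
  Gaussians tends to 0 with no rate in s. With s and \<tau> fixed first, iteration pits geometric
  decay against this cost. The superposition exists because the quotient of a narrow Gaussian by a
  wide one is again a Gaussian, hence the characteristic function of a normal law, whose samples
  serve as frequencies. Norms enter through their p-th powers, where the triangle inequality costs a
  factor 2^p that is absorbed in the choice of the small parameters.\<close>

section \<open>Powers in the extended half-line and Jensen's inequality\<close>

lemma epowr_ennreal: "x \<ge> 0 \<Longrightarrow> epowr (ennreal x) a = ennreal (x powr a)"
  by (simp add: epowr_def)

lemma epowr_top [simp]: "epowr \<top> a = \<top>"
  by (simp add: epowr_def)

text \<open>True for every exponent because \<open>0 powr a = 0\<close> even when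
  \<open>a = 0\<close>. This also makes \<open>epowr_mult\<close> unconditional, including products
  of 0 and infinity.\<close>

lemma epowr_0 [simp]: "epowr 0 a = 0"
  by (simp add: epowr_def)

lemma epowr_1 [simp]: "epowr t 1 = t"
  by (cases t) (auto simp: epowr_def)

lemma epowr_mono: "a \<ge> 0 \<Longrightarrow> s \<le> t \<Longrightarrow> epowr s a \<le> epowr t a"
  by (cases s; cases t) (auto simp: epowr_def powr_mono2 top_unique)

lemma epowr_eq_0_iff [simp]: "epowr t a = 0 \<longleftrightarrow> t = 0"
  by (cases t) (auto simp: epowr_def)

lemma epowr_less_top_iff [simp]: "epowr t a < \<top> \<longleftrightarrow> t < \<top>"
  by (cases t) (auto simp: epowr_def)

lemma measurable_epowr [measurable]:
  assumes [measurable]: "f \<in> borel_measurable M"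
  shows "(\<lambda>x. epowr (f x) a) \<in> borel_measurable M"
  unfolding epowr_def by measurable

lemma epowr_mult: "epowr (s * t) a = epowr s a * epowr t a"
proof (cases "s = \<top> \<or> t = \<top>")
  case True
  then show ?thesis
    by (auto simp: ennreal_mult_eq_top_iff ennreal_top_mult ennreal_mult_top)
next
  case False
  then obtain x y where "s = ennreal x" "t = ennreal y" "x \<ge> 0" "y \<ge> 0"
    by (cases s; cases t) auto
  then show ?thesis
    by (simp add: epowr_ennreal powr_mult flip: ennreal_mult)
qed

lemma epowr_epowr: "epowr (epowr t a) b = epowr t (a * b)"
  by (cases t) (auto simp: epowr_def powr_powr)

text \<open>The sum is at most twice the larger term. This stands in for Minkowski's inequality, so
  later constants carry factors \<open>2 powr p\<close>.\<close>

lemma epowr_sum_le: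
  assumes "a \<ge> 0"
  shows "epowr (s + t) a \<le> ennreal (2 powr a) * (epowr s a + epowr t a)"
proof -
  have *: "epowr (s + t) a \<le> ennreal (2 powr a) * epowr t a" if "s \<le> t" for s t
  proof -
    have "s + t \<le> ennreal 2 * t"
      using that add_right_mono[OF that, of t] by (simp add: mult_2)
    then have "epowr (s + t) a \<le> epowr (ennreal 2 * t) a"
      using assms by (intro epowr_mono) auto
    then show ?thesis by (simp only: epowr_mult epowr_ennreal[of 2] order.refl zero_le_numeral)
  qed
  show ?thesis
  proof (cases "s \<le> t")
    case True
    then show ?thesis
      by (intro order_trans[OF *[OF True]] mult_left_mono) auto
  next
    case False
    then show ?thesis
      by (subst add.commute) (intro order_trans[OF *] mult_left_mono, auto)
  qed
qed

text \<open>The convex function u^p lies above its tangent at a. For p > 1 this is Young's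
  inequality with the conjugate exponent q = p/(p-1).\<close>

lemma young_tangent:
  fixes a u p :: real
  assumes "p \<ge> 1" "a > 0" "u \<ge> 0"
  shows "p * a powr (p - 1) * u \<le> u powr p + (p - 1) * a powr p"
proof (cases "u = 0 \<or> p = 1")
  case True
  then show ?thesis using assms by auto
next
  case False
  then have u: "u > 0" and p: "p > 1" using assms by auto
  define q where "q = p / (p - 1)"
  have "1/p + 1/q = 1" "p > 0" "q > 0" using p by (auto simp: q_def field_simps)
  moreover have "q > 1" using p by (auto simp: q_def field_simps)
  ultimately have "u * a powr (p - 1) \<le> u powr p / p + (a powr (p - 1)) powr q / q"
    using u assms p by (intro Youngs_inequality) auto
  moreover have "(a powr (p - 1)) powr q = a powr p"
    using p by (simp add: q_def powr_powr)
  ultimately have "p * (u * a powr (p - 1)) \<le> p * (u powr p / p + a powr p / q)"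
    using p by (intro mult_left_mono) auto
  also have "\<dots> = u powr p + (p - 1) * a powr p"
    using p by (simp add: q_def field_simps)
  finally show ?thesis by (simp add: algebra_simps)
qed

text \<open>Jensen's inequality for a measure of total mass m: integrate the tangent inequality,
  then optimise the point of tangency.\<close>

lemma nn_integral_epowr_le:
  fixes u :: "'a \<Rightarrow> ennreal"
  assumes [measurable]: "u \<in> borel_measurable M"
    and m: "emeasure M (space M) = ennreal m" "m \<ge> 0" and p: "p \<ge> 1"
  shows "epowr (\<integral>\<^sup>+x. u x \<partial>M) p \<le> ennreal (m powr (p - 1)) * (\<integral>\<^sup>+x. epowr (u x) p \<partial>M)"
proof (cases "m = 0")
  case True
  then have "AE x in M. False"
    using m by (intro AE_I[of _ _ "space M"]) auto
  then have "(\<integral>\<^sup>+x. u x \<partial>M) = (\<integral>\<^sup>+x. 0 \<partial>M)"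
    by (intro nn_integral_cong_AE) auto
  then show ?thesis by simp
next
  case False
  with m have m0: "m > 0" by simp
  have *: "ennreal (p * a powr (p - 1)) * (\<integral>\<^sup>+x. u x \<partial>M)
       \<le> (\<integral>\<^sup>+x. epowr (u x) p \<partial>M) + ennreal ((p - 1) * a powr p * m)" if a: "a > 0" for a
  proof -
    have pt: "ennreal (p * a powr (p - 1)) * t \<le> epowr t p + ennreal ((p - 1) * a powr p)" for t
    proof (cases t)
      case (real r)
      then show ?thesis
        using young_tangent[OF p a, of r] p
        by (auto simp: epowr_ennreal simp flip: ennreal_mult ennreal_plus intro!: ennreal_leI)
    qed auto
    have "ennreal (p * a powr (p - 1)) * (\<integral>\<^sup>+x. u x \<partial>M) = (\<integral>\<^sup>+x. ennreal (p * a powr (p - 1)) * u x \<partial>M)"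
      by (simp add: nn_integral_cmult)
    also have "\<dots> \<le> (\<integral>\<^sup>+x. epowr (u x) p + ennreal ((p - 1) * a powr p) \<partial>M)"
      by (intro nn_integral_mono pt)
    also have "\<dots> = (\<integral>\<^sup>+x. epowr (u x) p \<partial>M) + ennreal ((p - 1) * a powr p * m)"
      using m p by (simp add: nn_integral_add ennreal_mult)
    finally show ?thesis .
  qed
  show ?thesis
  proof (cases "\<integral>\<^sup>+x. u x \<partial>M")
    \<comment> \<open>If u has infinite integral, any tangent will do: the correction term is
      finite, so the one at 1 already forces the right side to be infinite.\<close>
    case top
    have "(\<integral>\<^sup>+x. epowr (u x) p \<partial>M) + ennreal ((p - 1) * 1 powr p * m) = \<top>"
      using *[of 1] top p by (simp add: ennreal_mult_top top_unique)
    then have "(\<integral>\<^sup>+x. epowr (u x) p \<partial>M) = \<top>" by simp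
    then show ?thesis using m0 by (simp add: ennreal_mult_top)
  next
    case (real U)
    show ?thesis
    proof (cases "U = 0")
      case True then show ?thesis using real by simp
    next
      case False
      with real have U: "U > 0" by simp
      \<comment> \<open>The mean of u is the optimal point of tangency.\<close>
      define a where "a = U / m"
      have a: "a > 0" using U m0 by (simp add: a_def)
      show ?thesis
      proof (cases "\<integral>\<^sup>+x. epowr (u x) p \<partial>M")
        case top
        then show ?thesis using m0 by (simp add: ennreal_mult_top)
      next
        case (real I)
        have "ennreal (p * a powr (p - 1) * U) \<le> ennreal (I + (p - 1) * a powr p * m)"
          using *[OF a] real \<open>(\<integral>\<^sup>+x. u x \<partial>M) = ennreal U\<close> U m0 p
          by (simp add: ennreal_mult ennreal_plus)
        then have 1: "p * a powr (p - 1) * U \<le> I + (p - 1) * a powr p * m"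
          using real p m0 by (subst (asm) ennreal_le_iff) auto
        have 2: "a powr (p - 1) * U = a powr p * m"
          using a m0 U by (simp add: a_def powr_diff)
        have "p * (a powr p * m) \<le> I + (p - 1) * (a powr p * m)"
          using 1 by (simp only: mult.assoc 2)
        then have "a powr p * m \<le> I" by (simp add: algebra_simps)
        moreover have "a powr p * m = U powr p / m powr (p - 1)"
          using m0 U by (simp add: a_def powr_divide powr_diff)
        ultimately have "U powr p / m powr (p - 1) \<le> I" by simp
        then have "U powr p \<le> m powr (p - 1) * I"
          using m0 by (subst (asm) pos_divide_le_eq) (auto simp: mult.commute)
        then show ?thesis
          using real \<open>(\<integral>\<^sup>+x. u x \<partial>M) = ennreal U\<close> U m0
          by (auto simp: epowr_ennreal simp flip: ennreal_mult intro!: ennreal_leI)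
      qed
    qed
  qed
qed

section \<open>Weighted bounds\<close>

text \<open>The p-th power of the weighted norm, without the root, so that Tonelli applies directly.
  The integral is over \<open>lebesgue\<close> because a weight is only Lebesgue measurable.\<close>

definition wint :: "real \<Rightarrow> (real ^ ('n::finite) \<Rightarrow> real) \<Rightarrow> (real ^ 'n \<Rightarrow> ennreal) \<Rightarrow> ennreal" where
  "wint p w F = (\<integral>\<^sup>+ x. epowr (F x) p * ennreal (w x) \<partial>lebesgue)"

definition box0 :: "real \<Rightarrow> (real ^ ('n::finite)) set" where
  "box0 r = {x. infnorm x \<le> r}"

text \<open>Over \<open>lborel\<close> and meant for Borel factors, so that the integrand is jointly
  measurable in a and x and Tonelli applies.\<close>

definition nconv :: "(real ^ ('n::finite) \<Rightarrow> ennreal) \<Rightarrow> (real ^ 'n \<Rightarrow> ennreal) \<Rightarrow> real ^ 'n \<Rightarrow> ennreal" where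
  "nconv U F x = (\<integral>\<^sup>+ a. U a * F (x - a) \<partial>lborel)"

lemma mem_box0 [simp]: "x \<in> box0 r \<longleftrightarrow> infnorm x \<le> r"
  by (simp add: box0_def)

lemma measurable_infnorm [measurable]: "infnorm \<in> borel_measurable borel"
  by (intro borel_measurable_continuous_onI continuous_intros)

lemma sets_box0 [measurable]: "box0 r \<in> sets borel"
  unfolding box0_def by measurable

lemma infnorm_le_cart: "infnorm (x :: real ^ 'n::finite) \<le> r \<longleftrightarrow> (\<forall>i. \<bar>x $ i\<bar> \<le> r)"
proof
  assume "\<forall>i. \<bar>x $ i\<bar> \<le> r"
  then show "infnorm x \<le> r"
    unfolding infnorm_cart by (intro cSup_least) auto
qed (meson component_le_infnorm_cart order_trans)

lemma translated_box0_eq: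
  "{y :: real ^ 'n::finite. infnorm (y - x) \<le> r} = cbox (x - (\<chi> i. r)) (x + (\<chi> i. r))"
  by (auto simp: infnorm_le_cart mem_box_cart abs_le_iff algebra_simps; smt (verit))

lemma translated_box0_cubes:
  "r > 0 \<Longrightarrow> {y :: real ^ 'n::finite. infnorm (y - x) \<le> r} \<in> cubes"
  unfolding cubes_def translated_box0_eq
  by (intro CollectI exI[of _ "x - (\<chi> i. r)"] exI[of _ "2 * r"]) (auto simp: vec_eq_iff intro!: arg_cong2[of _ _ _ _ cbox])

lemma emeasure_translated_box0:
  assumes "r \<ge> 0"
  shows "emeasure lborel {y :: real ^ 'n::finite. infnorm (y - x) \<le> r} = ennreal ((2 * r) ^ CARD('n))"
proof -
  have "(\<Prod>i\<in>UNIV. (x + (\<chi> i. r) - (x - (\<chi> i. r))) $ i) = (2 * r) ^ CARD('n)"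
    by (simp add: algebra_simps)
  then show ?thesis
    unfolding translated_box0_eq emeasure_lborel_cbox_eq using assms
    by (auto simp: Basis_vec_def inner_axis prod.UNION_disjoint axis_eq_axis simp flip: interval_cbox_cart)
qed

lemma lebesgue_ident [measurable]: "(\<lambda>x. x) \<in> borel_measurable lebesgue"
  by (simp add: measurable_completion)

lemma lebesgue_fst [measurable]: "fst \<in> borel_measurable (lebesgue \<Otimes>\<^sub>M lebesgue)"
  by (rule measurable_compose[OF measurable_fst]) (simp add: measurable_completion)

lemma lebesgue_snd [measurable]: "snd \<in> borel_measurable (lebesgue \<Otimes>\<^sub>M lebesgue)"
  by (rule measurable_compose[OF measurable_snd]) (simp add: measurable_completion)

text \<open>Tonelli is used on the completed measure, where the weight lives; the sets of finite
  measure that exhaust \<open>lborel\<close> do the same for its completion.\<close>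

lemma sigma_finite_lebesgue: "sigma_finite_measure (lebesgue :: 'a::euclidean_space measure)"
proof -
  obtain A :: "'a set set" where "countable A" "A \<subseteq> sets lborel" "\<Union>A = space lborel" "\<forall>a\<in>A. emeasure lborel a \<noteq> \<infinity>"
    using sigma_finite_measure.sigma_finite_countable[OF sigma_finite_lborel[where 'a='a]] by (elim exE conjE) (rule that)
  moreover from this have "A \<subseteq> sets lebesgue" by (meson sets_completionI_sets subset_iff)
  moreover have "emeasure lebesgue a \<noteq> \<infinity>" if "a \<in> A" for a
  proof -
    have "a \<in> sets lborel" using that calculation(2) by blast
    then have "emeasure lebesgue a = emeasure lborel a"
      by (metis emeasure_completion main_part sets_completionI_sets)
    then show ?thesis using that calculation(4) by metis
  qed
  ultimately have "countable A \<and> A \<subseteq> sets lebesgue \<and> \<Union>A = space lebesgue \<and> (\<forall>a\<in>A. emeasure lebesgue a \<noteq> \<infinity>)"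
    by (metis space_completion)
  then show ?thesis
    by (intro sigma_finite_measure.intro exI)
qed

interpretation lebesgue_pair: pair_sigma_finite lebesgue lebesgue
  by (simp add: pair_sigma_finite_def sigma_finite_lebesgue)

text \<open>The unnormalised integral over a cube about x. With the cube written as an indicator of
  x - y, the integrand is jointly measurable even for Lebesgue measurable F.\<close>

definition window :: "real \<Rightarrow> (real ^ ('n::finite) \<Rightarrow> ennreal) \<Rightarrow> real ^ 'n \<Rightarrow> ennreal" where
  "window r F x = (\<integral>\<^sup>+ y. indicator (box0 r) (x - y) * F y \<partial>lebesgue)"

lemma window_alt: "window r F x = (\<integral>\<^sup>+ y\<in>{y. infnorm (y - x) \<le> r}. F y \<partial>lebesgue)"
  unfolding window_def
  by (intro nn_integral_cong) (auto simp: indicator_def infnorm_sub)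

lemma measurable_window [measurable]:
  assumes [measurable]: "F \<in> borel_measurable lebesgue"
  shows "window r F \<in> borel_measurable lebesgue"
proof -
  have [measurable]: "(\<lambda>p. F (snd p)) \<in> borel_measurable (lebesgue \<Otimes>\<^sub>M lebesgue)"
    by (rule measurable_compose[OF measurable_snd]) simp
  have "(\<lambda>p. indicator (box0 r) (fst p - snd p) * F (snd p)) \<in> borel_measurable (lebesgue \<Otimes>\<^sub>M lebesgue)"
    by measurable
  then show ?thesis
    unfolding window_def[abs_def]
    by (intro sigma_finite_measure.borel_measurable_nn_integral sigma_finite_lebesgue)
       (simp add: case_prod_beta')
qed

lemma wint_mono: "p \<ge> 0 \<Longrightarrow> (\<And>x. F x \<le> G x) \<Longrightarrow> wint p w F \<le> wint p w G"
  unfolding wint_def by (intro nn_integral_mono mult_right_mono epowr_mono) auto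

lemma wint_mono_AE:
  "p \<ge> 0 \<Longrightarrow> (AE x in lborel. F x \<le> G x) \<Longrightarrow> wint p w F \<le> wint p w G"
  unfolding wint_def
  by (rule nn_integral_mono_AE, drule AE_completion, erule eventually_mono) (intro mult_right_mono epowr_mono, auto)

lemma weight_measurable:
  fixes w :: "real ^ 'n::finite \<Rightarrow> real"
  assumes "weight w"
  shows "w \<in> borel_measurable lebesgue"
proof (rule borel_measurable_LIMSEQ_metric)
  fix i :: nat
  have "set_integrable lebesgue (cball 0 (real i)) w"
    using assms by (simp add: weight_def)
  then show "(\<lambda>x. indicator (cball 0 (real i)) x *\<^sub>R w x) \<in> borel_measurable lebesgue"
    unfolding set_integrable_def by simp
next
  fix x :: "real ^ 'n"
  have "\<forall>\<^sub>F i in sequentially. norm x \<le> real i"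
    using eventually_ge_at_top[of "nat \<lceil>norm x\<rceil>"] by eventually_elim linarith
  then show "(\<lambda>i. indicator (cball 0 (real i)) x *\<^sub>R w x) \<longlonglongrightarrow> w x"
    by (intro tendsto_eventually, elim eventually_mono) simp
qed

text \<open>Jensen's inequality for the dual weight, then the $A_p$ condition on the doubled cube.\<close>

lemma wint_window_le:
  fixes w :: "real ^ 'n::finite \<Rightarrow> real"
  assumes Ap: "Ap_weight p w" and p: "p \<ge> 1"
  shows "\<exists>A\<ge>0. \<forall>r>0. \<forall>F \<in> borel_measurable lebesgue.
    wint p w (window r F) \<le> ennreal (A * ((4 * r) ^ CARD('n)) powr p) * wint p w F"
proof -
  have w: "weight w" and wpos: "\<And>x. w x > 0"
    using Ap by (auto simp: Ap_weight_def weight_def)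
  have [measurable]: "w \<in> borel_measurable lebesgue" by (rule weight_measurable[OF w])
  obtain A where "A < \<infinity>" and A': "\<And>Q. Q \<in> cubes \<Longrightarrow>
    (if p = 1 then mean Q w \<le> A * (INF x \<in> Q. ennreal (w x))
        else mean Q w * epowr (mean Q (\<lambda>x. w x powr (- 1 / (p - 1)))) (p - 1) \<le> A)"
    using Ap unfolding Ap_weight_def by metis
  obtain a where a: "A = ennreal a" "a \<ge> 0" using \<open>A < \<infinity>\<close> by (cases A) auto
  let ?B = "\<lambda>x r. {y. infnorm (y - x) \<le> r}"
  have vol: "emeasure lebesgue (?B x r) = ennreal ((2 * r) ^ CARD('n))" if "r > 0" for x :: "real^'n" and r
    using emeasure_translated_box0[of r x] that by (subst emeasure_completion) (auto simp: translated_box0_eq)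
  have Bsets [measurable]: "?B x r \<in> sets lebesgue" for x :: "real^'n" and r
    by (simp add: translated_box0_eq)
  \<comment> \<open>\<open>4 * r\<close> is the side of the cube of radius \<open>2 * r\<close>. For
    p = 1 the cube of radius r appears instead, and its volume is enlarged to share one
    constant.\<close>
  let ?c = "\<lambda>r. ennreal (a * ((4 * r) ^ CARD('n)) powr p)"
  show ?thesis
  proof (cases "p = 1")
    case True
    have key: "window r (\<lambda>x. ennreal (w x)) y \<le> ?c r * ennreal (w y)"
      if r: "r > 0" for r y
    proof -
      have "mean (?B y r) w \<le> A * (INF x \<in> ?B y r. ennreal (w x))"
        using A'[OF translated_box0_cubes[OF r, of y]] True by simp
      also have "\<dots> \<le> A * ennreal (w y)"
        using r by (intro mult_left_mono INF_lower) (auto simp: infnorm_0)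
      finally have "(window r (\<lambda>x. ennreal (w x)) y) / ennreal ((2 * r) ^ CARD('n)) \<le> A * ennreal (w y)"
        unfolding mean_def vol[OF r] by (simp add: window_alt)
      then have "window r (\<lambda>x. ennreal (w x)) y / ennreal ((2 * r) ^ CARD('n)) * ennreal ((2 * r) ^ CARD('n))
          \<le> A * ennreal (w y) * ennreal ((2 * r) ^ CARD('n))"
        by (rule mult_right_mono) simp
      then have "window r (\<lambda>x. ennreal (w x)) y \<le> A * ennreal (w y) * ennreal ((2 * r) ^ CARD('n))"
        using r by (simp add: ennreal_divide_times)
      also have "\<dots> \<le> A * ennreal (w y) * ennreal ((4 * r) ^ CARD('n))"
        using r by (intro mult_left_mono ennreal_leI power_mono) auto
      finally show ?thesis
        using True a r by (simp add: ennreal_mult ac_simps)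
    qed
    show ?thesis
    proof (intro exI[of _ a] conjI allI impI ballI a)
      fix r :: real and F :: "real ^ 'n \<Rightarrow> ennreal"
      assume r: "r > 0" and [measurable]: "F \<in> borel_measurable lebesgue"
      have [measurable]: "(\<lambda>p. F (snd p)) \<in> borel_measurable (lebesgue \<Otimes>\<^sub>M lebesgue)"
        "(\<lambda>p. w (fst p)) \<in> borel_measurable (lebesgue \<Otimes>\<^sub>M lebesgue)"
        by (auto intro: measurable_compose[OF measurable_snd] measurable_compose[OF measurable_fst])
      \<comment> \<open>Tonelli moves the window from F onto w, where the A_1 condition bounds it
        pointwise.\<close>
      have "wint p w (window r F) = (\<integral>\<^sup>+x. \<integral>\<^sup>+y. indicator (box0 r) (x - y) * F y * ennreal (w x) \<partial>lebesgue \<partial>lebesgue)"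
        using True unfolding wint_def window_def
        by (simp add: nn_integral_multc)
      also have "\<dots> = (\<integral>\<^sup>+y. \<integral>\<^sup>+x. indicator (box0 r) (x - y) * F y * ennreal (w x) \<partial>lebesgue \<partial>lebesgue)"
        by (rule lebesgue_pair.Fubini'[symmetric]) (simp add: case_prod_beta')
      also have "\<dots> = (\<integral>\<^sup>+y. F y * window r (\<lambda>x. ennreal (w x)) y \<partial>lebesgue)"
        by (intro nn_integral_cong)
           (auto simp: window_def indicator_def infnorm_sub mult.assoc simp flip: nn_integral_cmult intro!: nn_integral_cong)
      also have "\<dots> \<le> (\<integral>\<^sup>+y. F y * (?c r * ennreal (w y)) \<partial>lebesgue)"
        by (intro nn_integral_mono mult_left_mono key r) simp
      also have "\<dots> = ?c r * wint p w F"
        unfolding wint_def using True by (subst nn_integral_cmult[symmetric]) (simp_all add: mult.left_commute)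
      finally show "wint p w (window r F) \<le> ?c r * wint p w F" .
    qed
  next
    case False
    with p have p1: "p > 1" by simp
    \<comment> \<open>The dual weight. Below, \<open>key\<close> is the A_p condition cleared of its
      volume factors: v from the first mean and v^(p-1) from the second.\<close>
    define \<sigma> where "\<sigma> = (\<lambda>x. w x powr (- 1 / (p - 1)))"
    have [measurable]: "\<sigma> \<in> borel_measurable lebesgue" unfolding \<sigma>_def by measurable
    have \<sigma>pos: "\<sigma> x > 0" for x using wpos[of x] by (simp add: \<sigma>_def)
    define W where "W r y = window r (\<lambda>x. ennreal (w x)) y" for r y
    define S where "S r y = window r (\<lambda>x. ennreal (\<sigma> x)) y" for r y
    have key: "W r y * epowr (S r y) (p - 1) \<le> ennreal (a * ((2 * r) ^ CARD('n)) powr p)" if r: "r > 0" for r y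
    proof -
      define v where "v = (2 * r) ^ CARD('n)"
      have v: "v > 0" using r by (simp add: v_def)
      have "mean (?B y r) w * epowr (mean (?B y r) \<sigma>) (p - 1) \<le> A"
        using A'[OF translated_box0_cubes[OF r, of y]] False by (simp add: \<sigma>_def)
      then have *: "(W r y * ennreal (1 / v)) * epowr (S r y * ennreal (1 / v)) (p - 1) \<le> A"
        unfolding mean_def vol[OF r] W_def S_def window_alt v_def[symmetric] divide_ennreal_def
        using v by (simp add: inverse_ennreal inverse_eq_divide)
      have "W r y * epowr (S r y) (p - 1) =
         ennreal (v powr p) * ((W r y * ennreal (1 / v)) * epowr (S r y * ennreal (1 / v)) (p - 1))"
      proof -
        have "ennreal (v powr p) * (ennreal (1 / v) * ennreal ((1 / v) powr (p - 1))) = 1"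
          using v by (simp add: powr_divide powr_diff flip: ennreal_mult)
        then have "W r y * epowr (S r y) (p - 1) = W r y * epowr (S r y) (p - 1) *
            (ennreal (v powr p) * (ennreal (1 / v) * ennreal ((1 / v) powr (p - 1))))" by simp
        also have "\<dots> = ennreal (v powr p) * ((W r y * ennreal (1 / v)) * epowr (S r y * ennreal (1 / v)) (p - 1))"
          using v by (simp only: epowr_mult epowr_ennreal zero_le_divide_1_iff less_imp_le ac_simps)
        finally show ?thesis .
      qed
      also have "\<dots> \<le> ennreal (v powr p) * A" by (intro mult_left_mono *) auto
      finally show ?thesis using a v by (simp add: v_def ennreal_mult ac_simps)
    qed
    \<comment> \<open>Positivity of W rules out infinite S, since their product in
      \<open>key\<close> is finite. Finite S is what Jensen needs for the measure with density
      \<sigma>.\<close>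
    have Wpos: "W r y > 0" if r: "r > 0" for r y
    proof (rule ccontr)
      assume "\<not> W r y > 0"
      then have "AE x in lebesgue. ennreal (w x) * indicator (?B y r) x = 0"
        unfolding W_def window_alt by (subst (asm) not_gr_zero, subst (asm) nn_integral_0_iff_AE) auto
      then have "AE x in lebesgue. x \<notin> ?B y r"
        by (rule eventually_mono) (use wpos in \<open>auto simp: indicator_def less_le split: if_splits\<close>)
      then have "emeasure lebesgue (?B y r) = 0"
        using Bsets by (subst (asm) AE_iff_null_sets[symmetric]) (auto simp: null_sets_def)
      then show False using vol[OF r, of y] r by simp
    qed
    have Sfin: "S r y < \<top>" if r: "r > 0" for r y
    proof (rule ccontr)
      assume "\<not> S r y < \<top>"
      then have "S r y = \<top>" using less_top by blast
      then show False using key[OF r, of y] Wpos[OF r, of y] p1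
        by (auto simp: ennreal_mult_top top_unique split: if_splits)
    qed
    \<comment> \<open>Hoelder's inequality as Jensen for the measure \<sigma> dy on the cube: with u
      = F w^(1/(p-1)) one has u \<sigma> = F and u^p \<sigma> = F^p w.\<close>
    have pt: "epowr (window r F x) p \<le> epowr (S r x) (p - 1) * window r (\<lambda>y. epowr (F y) p * ennreal (w y)) x"
      if r: "r > 0" and [measurable]: "F \<in> borel_measurable lebesgue" for r x and F :: "real^'n \<Rightarrow> ennreal"
    proof -
      define M where "M = density lebesgue (\<lambda>y. ennreal (\<sigma> y) * indicator (?B x r) y)"
      obtain s where s: "S r x = ennreal s" "s \<ge> 0" using Sfin[OF r, of x] by (cases "S r x") auto
      have M: "emeasure M (space M) = ennreal s"
        unfolding M_def using s by (subst emeasure_density) (auto simp: S_def window_alt)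
      define u where "u y = F y * ennreal (w y powr (1 / (p - 1)))" for y
      have [measurable]: "u \<in> borel_measurable lebesgue" unfolding u_def by measurable
      then have um: "u \<in> borel_measurable M" by (simp add: M_def)
      have ws: "ennreal (w y powr (1 / (p - 1))) * ennreal (\<sigma> y) = 1" for y
        using wpos[of y] by (simp add: \<sigma>_def powr_minus_divide flip: ennreal_mult powr_add)
      have fw: "ennreal (\<sigma> y) * (F y * ennreal (w y powr (1 / (p - 1)))) = F y" for y
        using arg_cong[OF ws[of y], of "\<lambda>t. F y * t"] by (simp only: mult.left_commute mult.commute mult_1 mult_1_right)
      have 1: "(\<integral>\<^sup>+y. u y \<partial>M) = window r F x"
        unfolding M_def window_alt
        by (subst nn_integral_density)
           (auto intro!: nn_integral_cong simp: u_def indicator_def fw split: if_splits)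
      have ws2: "epowr (ennreal (w y powr (1 / (p - 1)))) p * ennreal (\<sigma> y) = ennreal (w y)" for y
      proof -
        have "p / (p - 1) + (- 1 / (p - 1)) = (p + - 1) / (p - 1)" by (rule add_divide_distrib[symmetric])
        also have "\<dots> = 1" using p1 by simp
        finally have "p / (p - 1) + (- 1 / (p - 1)) = 1" .
        then show ?thesis using wpos[of y]
          by (simp add: epowr_ennreal \<sigma>_def powr_powr flip: ennreal_mult powr_add)
      qed
      have fw2: "ennreal (\<sigma> y) * (epowr (F y) p * epowr (ennreal (w y powr (1 / (p - 1)))) p) = epowr (F y) p * ennreal (w y)" for y
        using arg_cong[OF ws2[of y], of "\<lambda>t. epowr (F y) p * t"] by (simp only: mult.left_commute mult.commute)
      have 2: "(\<integral>\<^sup>+y. epowr (u y) p \<partial>M) = window r (\<lambda>y. epowr (F y) p * ennreal (w y)) x"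
        unfolding M_def window_alt
        by (subst nn_integral_density)
           (auto intro!: nn_integral_cong simp: u_def indicator_def epowr_mult fw2 split: if_splits)
      show ?thesis
        using nn_integral_epowr_le[OF um M s(2) p] unfolding 1 2 using s by (simp add: epowr_ennreal)
    qed
    show ?thesis
    proof (intro exI[of _ a] conjI allI impI ballI a)
      fix r :: real and F :: "real ^ 'n \<Rightarrow> ennreal"
      assume r: "r > 0" and F [measurable]: "F \<in> borel_measurable lebesgue"
      define G where "G y = epowr (F y) p * ennreal (w y)" for y
      have [measurable]: "G \<in> borel_measurable lebesgue" unfolding G_def by measurable
      have [measurable]: "S r \<in> borel_measurable lebesgue" unfolding S_def[abs_def] by measurable
      have [measurable]: "(\<lambda>p. G (snd p)) \<in> borel_measurable (lebesgue \<Otimes>\<^sub>M lebesgue)"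
        "(\<lambda>p. w (fst p)) \<in> borel_measurable (lebesgue \<Otimes>\<^sub>M lebesgue)"
        "(\<lambda>p. S r (fst p)) \<in> borel_measurable (lebesgue \<Otimes>\<^sub>M lebesgue)"
        by (auto intro: measurable_compose[OF measurable_snd] measurable_compose[OF measurable_fst])
      let ?k = "\<lambda>x y. indicator (box0 r) (x - y) * G y * (epowr (S r x) (p - 1) * ennreal (w x))"
      have "wint p w (window r F) \<le> (\<integral>\<^sup>+x. epowr (S r x) (p - 1) * window r G x * ennreal (w x) \<partial>lebesgue)"
        unfolding wint_def G_def by (intro nn_integral_mono mult_right_mono pt r) auto
      also have "\<dots> = (\<integral>\<^sup>+x. \<integral>\<^sup>+y. ?k x y \<partial>lebesgue \<partial>lebesgue)"
        unfolding window_def by (simp add: ac_simps flip: nn_integral_cmult)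
      also have "\<dots> = (\<integral>\<^sup>+y. \<integral>\<^sup>+x. ?k x y \<partial>lebesgue \<partial>lebesgue)"
        by (rule lebesgue_pair.Fubini'[symmetric]) (simp add: case_prod_beta')
      \<comment> \<open>For x within r of y, the cube about x lies in the doubled cube about y. This
        makes the dual factor independent of x, and the remaining integral is that of w over the
        same doubled cube.\<close>
      also have "\<dots> \<le> (\<integral>\<^sup>+y. G y * (W (2 * r) y * epowr (S (2 * r) y) (p - 1)) \<partial>lebesgue)"
      proof (intro nn_integral_mono)
        fix y
        have sub: "S r x \<le> S (2 * r) y" if "infnorm (x - y) \<le> r" for x
          unfolding S_def window_alt
        proof (intro nn_integral_mono mult_left_mono)
          fix z show "indicator (?B x r) z \<le> (indicator (?B y (2 * r)) z :: ennreal)"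
            using infnorm_triangle[of "z - x" "x - y"] that by (auto simp: indicator_def)
        qed auto
        have "(\<integral>\<^sup>+x. ?k x y \<partial>lebesgue)
           \<le> (\<integral>\<^sup>+x. G y * epowr (S (2 * r) y) (p - 1) * (indicator (box0 (2 * r)) (y - x) * ennreal (w x)) \<partial>lebesgue)"
        proof (intro nn_integral_mono)
          fix x
          show "?k x y \<le>
             G y * epowr (S (2 * r) y) (p - 1) * (indicator (box0 (2 * r)) (y - x) * ennreal (w x))"
          proof (cases "infnorm (x - y) \<le> r")
            case True
            then have "epowr (S r x) (p - 1) \<le> epowr (S (2 * r) y) (p - 1)"
              using sub p1 by (intro epowr_mono) auto
            then show ?thesis
              using True r by (auto simp: infnorm_sub mult.assoc intro!: mult_left_mono mult_right_mono)
          qed auto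
        qed
        also have "\<dots> = G y * (W (2 * r) y * epowr (S (2 * r) y) (p - 1))"
          by (subst nn_integral_cmult) (auto simp: W_def window_def ac_simps)
        finally show "(\<integral>\<^sup>+x. ?k x y \<partial>lebesgue)
          \<le> G y * (W (2 * r) y * epowr (S (2 * r) y) (p - 1))" .
      qed
      also have "\<dots> \<le> (\<integral>\<^sup>+y. G y * ?c r \<partial>lebesgue)"
        using key[of "2 * r"] r by (intro nn_integral_mono mult_left_mono) auto
      also have "\<dots> = ?c r * wint p w F"
        unfolding wint_def G_def[symmetric] by (simp add: nn_integral_multc mult.commute)
      finally show "wint p w (window r F) \<le> ?c r * wint p w F" .
    qed
  qed
qed

section \<open>Convolution with radially decreasing kernels\<close>

text \<open>Points of equal infnorm get equal values, so H is a nonincreasing function of infnorm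
  alone.\<close>

definition radial_decr :: "(real ^ ('n::finite) \<Rightarrow> ennreal) \<Rightarrow> bool" where
  "radial_decr H \<longleftrightarrow> (\<forall>x y. infnorm x \<le> infnorm y \<longrightarrow> H y \<le> H x)"

lemma nn_integral_reflect:
  fixes f :: "'a::euclidean_space \<Rightarrow> ennreal"
  assumes [measurable]: "f \<in> borel_measurable borel"
  shows "(\<integral>\<^sup>+ y. f (x - y) \<partial>lborel) = integral\<^sup>N lborel f"
proof -
  have "integral\<^sup>N lborel f = (\<integral>\<^sup>+ y. f y \<partial>density (distr lborel borel (\<lambda>y. x + (-1) *\<^sub>R y)) (\<lambda>_. ennreal (\<bar>-1\<bar> ^ DIM('a))))"
    by (subst lborel_affine[of "-1" x]) (simp_all only: of_nat_0)
  also have "\<dots> = (\<integral>\<^sup>+ y. f (x - y) \<partial>lborel)"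
    by (subst nn_integral_density; simp add: nn_integral_distr)
  finally show ?thesis by simp
qed

lemma window_nconv:
  assumes [measurable]: "F \<in> borel_measurable borel"
  shows "window r F x = (\<integral>\<^sup>+ a. indicator (box0 r) a * F (x - a) \<partial>lborel)"
  unfolding window_def nn_integral_completion
  using nn_integral_reflect[of "\<lambda>a. indicator (box0 r) a * F (x - a)" x] by simp

lemma infnorm_scaled_ones: "infnorm (\<chi> i. t :: real ^ ('n::finite)) = \<bar>t\<bar>"
  by (auto simp: infnorm_cart)

lemma nn_integral_int_swap:
  fixes f :: "int \<Rightarrow> 'a \<Rightarrow> ennreal"
  assumes "sigma_finite_measure M" and [measurable]: "\<And>k. f k \<in> borel_measurable M"
  shows "(\<integral>\<^sup>+ x. \<integral>\<^sup>+ k. f k x \<partial>count_space UNIV \<partial>M) = (\<integral>\<^sup>+ k. \<integral>\<^sup>+ x. f k x \<partial>M \<partial>count_space UNIV)"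
proof -
  interpret pair_sigma_finite "count_space (UNIV :: int set)" M
    using assms by (auto simp: pair_sigma_finite_def intro: sigma_finite_measure_count_space)
  show ?thesis
    by (rule Fubini') (simp add: measurable_pair_measure_countable1)
qed

text \<open>H is below a sum of indicators of dyadic boxes weighted by its own values; Jensen over
  the dyadic index reduces to the window bound. C is chosen before H, so a majorant of small
  integral yields an operator of small norm.\<close>

lemma wint_nconv_le:
  fixes w :: "real ^ 'n::finite \<Rightarrow> real"
  assumes Ap: "Ap_weight p w" and p: "p \<ge> 1"
  shows "\<exists>C\<ge>0. \<forall>H. \<forall>F \<in> borel_measurable borel. radial_decr H \<longrightarrow> integral\<^sup>N lborel H < \<top> \<longrightarrow>
    wint p w (nconv H F) \<le> ennreal C * epowr (integral\<^sup>N lborel H) p * wint p w F"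
proof -
  have [measurable]: "w \<in> borel_measurable lebesgue"
    using Ap by (auto simp: Ap_weight_def intro: weight_measurable)
  obtain A where A: "A \<ge> 0" and win: "\<And>r F. r > 0 \<Longrightarrow> F \<in> borel_measurable lebesgue \<Longrightarrow>
    wint p w (window r F) \<le> ennreal (A * ((4 * r) ^ CARD('n)) powr p) * wint p w F"
    using wint_window_le[OF Ap p] by blast
  show ?thesis
  proof (intro exI[of _ "A * (8 ^ CARD('n)) powr p"] conjI allI impI ballI)
    fix H F :: "real ^ 'n \<Rightarrow> ennreal"
    assume F [measurable]: "F \<in> borel_measurable borel" and H: "radial_decr H"
      and fin: "integral\<^sup>N lborel H < \<top>"
    have [measurable]: "F \<in> borel_measurable lebesgue" by (simp add: measurable_completion)
    define I where "I = integral\<^sup>N lborel H"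
    define h where "h k = H (\<chi> i. 2 powi k)" for k :: int
    define r :: "int \<Rightarrow> real" where "r k = 2 powi (k + 1)" for k :: int
    \<comment> \<open>The volume factor of the window bound at radius \<open>r k\<close>; windows
      divided by \<open>v k\<close> are bounded uniformly in k.\<close>
    define v where "v k = (4 * r k) ^ CARD('n)" for k
    have r: "r k > 0" and v: "v k > 0" for k by (auto simp: r_def v_def)
    have hle: "h k \<le> H x" if "infnorm x \<le> 2 powi k" for k x
      using H that unfolding radial_decr_def h_def by (auto simp: infnorm_scaled_ones)
    have hge: "H x \<le> h k" if "infnorm x \<ge> 2 powi k" for k x
      using H that unfolding radial_decr_def h_def by (auto simp: infnorm_scaled_ones)
    \<comment> \<open>The single term with 2^k \<le> |a| \<le> 2^(k+1) suffices. The origin lies in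
      no such layer but is a null set.\<close>
    have Hle: "H a \<le> (\<integral>\<^sup>+ k. h k * indicator (box0 (r k)) a \<partial>count_space UNIV)" if "a \<noteq> 0" for a
    proof -
      define k where "k = \<lfloor>log 2 (infnorm a)\<rfloor>"
      have pos: "infnorm a > 0" using that by (simp add: infnorm_pos_lt)
      have "2 powr real_of_int k \<le> 2 powr (log 2 (infnorm a))" "2 powr (log 2 (infnorm a)) \<le> 2 powr (real_of_int (k + 1))"
        unfolding k_def by (intro powr_mono; linarith)+
      then have "2 powi k \<le> infnorm a" "infnorm a \<le> r k"
        using pos unfolding r_def by (auto simp flip: powr_real_of_int')
      then have "H a \<le> h k * indicator (box0 (r k)) a"
        using hge by simp
      also have "\<dots> \<le> (\<integral>\<^sup>+ k. h k * indicator (box0 (r k)) a \<partial>count_space UNIV)"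
        by (rule nn_integral_ge_point) simp
      finally show ?thesis .
    qed
    define S where "S = (\<integral>\<^sup>+ k. h k * ennreal (v k) \<partial>count_space UNIV)"
    have S: "S \<le> ennreal (8 ^ CARD('n)) * I"
    proof -
      \<comment> \<open>On each shell H is at least \<open>h k\<close>, and the shells are disjoint,
        so the integral of H dominates the sum. The factor 8 is the ratio of \<open>4 * r k\<close>
        to 2^k.\<close>
      define sh where "sh k = box0 (2 powi k) - (box0 (2 powi (k - 1)) :: (real ^ 'n) set)" for k :: int
      have [measurable]: "sh k \<in> sets borel" for k unfolding sh_def by measurable
      have em: "ennreal ((2 powi k) ^ CARD('n)) \<le> emeasure lborel (sh k)" for k
      proof -
        define t :: real where "t = 2 powi k"
        have t: "t > 0" by (simp add: t_def)
        have vb: "emeasure lborel (box0 r :: (real ^ 'n) set) = ennreal ((2 * r) ^ CARD('n))" if "r \<ge> 0" for r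
          using emeasure_translated_box0[OF that, of "0 :: real ^ 'n"] by (simp add: box0_def)
        have "emeasure lborel (box0 t :: (real ^ 'n) set) \<le> emeasure lborel (sh k \<union> box0 (t / 2))"
          by (intro emeasure_mono) (auto simp: sh_def t_def power_int_diff)
        also have "\<dots> \<le> emeasure lborel (sh k) + emeasure lborel (box0 (t / 2) :: (real ^ 'n) set)"
          by (intro emeasure_subadditive) auto
        finally have *: "ennreal ((2 * t) ^ CARD('n)) \<le> emeasure lborel (sh k) + ennreal (t ^ CARD('n))"
          using t by (simp add: vb)
        have "2 * t ^ CARD('n) \<le> (2 * t) ^ CARD('n)"
          using t self_le_power[of "2 :: real" "CARD('n)"] by (simp add: power_mult_distrib)
        moreover have "t ^ CARD('n) \<le> m" if "(2 * t) ^ CARD('n) \<le> m + t ^ CARD('n)" for m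
          using that calculation by linarith
        ultimately show ?thesis using * t unfolding t_def[symmetric]
          by (cases "emeasure lborel (sh k)") (auto simp del: power_mult_distrib simp flip: ennreal_plus)
      qed
      have "S = (\<integral>\<^sup>+ k. ennreal (8 ^ CARD('n)) * (h k * ennreal ((2 powi k) ^ CARD('n))) \<partial>count_space UNIV)"
        unfolding S_def v_def r_def
      proof (intro nn_integral_cong)
        fix k :: int
        have "4 * 2 powi (k + 1) = 8 * (2 powi k :: real)" by (simp add: power_int_add)
        then have "(4 * 2 powi (k + 1)) ^ CARD('n) = 8 ^ CARD('n) * (2 powi k :: real) ^ CARD('n)"
          by (simp only: power_mult_distrib)
        then show "h k * ennreal ((4 * 2 powi (k + 1)) ^ CARD('n)) = ennreal (8 ^ CARD('n)) * (h k * ennreal ((2 powi k) ^ CARD('n)))"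
          by (simp only: ennreal_mult zero_le_power zero_le_numeral zero_le_power_int mult.left_commute)
      qed
      also have "\<dots> = ennreal (8 ^ CARD('n)) * (\<integral>\<^sup>+ k. h k * ennreal ((2 powi k) ^ CARD('n)) \<partial>count_space UNIV)"
        by (simp add: nn_integral_cmult)
      also have "\<dots> \<le> ennreal (8 ^ CARD('n)) * (\<integral>\<^sup>+ k. \<integral>\<^sup>+ x. h k * indicator (sh k) x \<partial>lborel \<partial>count_space UNIV)"
        by (intro mult_left_mono nn_integral_mono) (auto simp: nn_integral_cmult_indicator intro!: mult_left_mono em)
      also have "(\<integral>\<^sup>+ k. \<integral>\<^sup>+ x. h k * indicator (sh k) x \<partial>lborel \<partial>count_space UNIV)
         = (\<integral>\<^sup>+ x. \<integral>\<^sup>+ k. h k * indicator (sh k) x \<partial>count_space UNIV \<partial>lborel)"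
        by (rule nn_integral_int_swap[symmetric]) (auto intro: sigma_finite_lborel)
      also have "\<dots> \<le> I"
        unfolding I_def
      proof (intro nn_integral_mono)
        fix x :: "real ^ 'n"
        show "(\<integral>\<^sup>+ k. h k * indicator (sh k) x \<partial>count_space UNIV) \<le> H x"
        proof (cases "\<exists>k. x \<in> sh k")
          case True
          then obtain k0 where k0: "x \<in> sh k0" by blast
          have uniq: "k = k0" if "x \<in> sh k" for k
          proof (rule ccontr)
            have *: False if "k < l" "x \<in> sh k" "x \<in> sh l" for k l :: int
            proof -
              have "(2::real) powi k \<le> 2 powi (l - 1)" using that by (intro power_int_increasing) auto
              then show False using that by (auto simp: sh_def)
            qed
            assume "k \<noteq> k0"
            then show False using *[of k k0] *[of k0 k] k0 that by linarith
          qed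
          have "(\<integral>\<^sup>+ k. h k * indicator (sh k) x \<partial>count_space UNIV) \<le> (\<integral>\<^sup>+ k. H x * indicator {k0} k \<partial>count_space UNIV)"
          proof (intro nn_integral_mono)
            fix k
            show "h k * indicator (sh k) x \<le> H x * indicator {k0} k"
            proof (cases "x \<in> sh k")
              case True
              then have "infnorm x \<le> 2 powi k" by (simp add: sh_def)
              then have "h k \<le> H x" by (rule hle)
              moreover have "k = k0" using True by (rule uniq)
              ultimately show ?thesis using True by simp
            qed simp
          qed
          also have "\<dots> = H x" by (subst nn_integral_cmult_indicator) auto
          finally show ?thesis .
        qed auto
      qed
      finally show ?thesis by (simp add: mult_left_mono)
    qed
    then have "S < \<top>" using fin by (auto simp: I_def ennreal_mult_less_top intro: le_less_trans)
    then obtain s where s: "S = ennreal s" "s \<ge> 0" by (cases S) auto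
    \<comment> \<open>Jensen on the integers with masses \<open>h k\<close> times \<open>v k\<close>
      supplies S^(p-1); summing the uniform window bounds supplies one more factor S.\<close>
    define M where "M = density (count_space UNIV) (\<lambda>k. h k * ennreal (v k))"
    have M: "emeasure M (space M) = ennreal s"
      using s by (simp add: M_def emeasure_density S_def)
    let ?Q = "\<lambda>x. (\<integral>\<^sup>+ k. h k * ennreal (v k) * (ennreal (v k powr - p) * epowr (window (r k) F x) p) \<partial>count_space UNIV)"
    let ?T = "\<lambda>k x. ennreal (s powr (p - 1)) *
       (h k * ennreal (v k) * (ennreal (v k powr - p) * (epowr (window (r k) F x) p * ennreal (w x))))"
    have pt: "epowr (nconv H F x) p \<le> ennreal (s powr (p - 1)) *
       ?Q x" for x
    proof -
      have "nconv H F x \<le> (\<integral>\<^sup>+ a. (\<integral>\<^sup>+ k. h k * indicator (box0 (r k)) a \<partial>count_space UNIV) * F (x - a) \<partial>lborel)"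
        unfolding nconv_def
        by (rule nn_integral_mono_AE, rule AE_mp[OF AE_lborel_singleton[of 0]]) (intro AE_I2 impI mult_right_mono Hle; simp)
      also have "\<dots> = (\<integral>\<^sup>+ a. \<integral>\<^sup>+ k. h k * (indicator (box0 (r k)) a * F (x - a)) \<partial>count_space UNIV \<partial>lborel)"
        by (intro nn_integral_cong) (simp add: mult.assoc flip: nn_integral_multc)
      also have "\<dots> = (\<integral>\<^sup>+ k. \<integral>\<^sup>+ a. h k * (indicator (box0 (r k)) a * F (x - a)) \<partial>lborel \<partial>count_space UNIV)"
        by (rule nn_integral_int_swap) (auto intro: sigma_finite_lborel)
      also have "\<dots> = (\<integral>\<^sup>+ k. h k * window (r k) F x \<partial>count_space UNIV)"
        by (intro nn_integral_cong) (simp add: window_nconv nn_integral_cmult)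
      also have "\<dots> = (\<integral>\<^sup>+ k. window (r k) F x * ennreal (1 / v k) \<partial>M)"
      proof -
        have "ennreal (v k) * (t * ennreal (1 / v k)) = t" for k t
          using v[of k] by (subst mult.left_commute) (simp flip: ennreal_mult)
        then show ?thesis
          unfolding M_def by (subst nn_integral_density) (auto intro!: nn_integral_cong simp: mult.assoc)
      qed
      finally have "epowr (nconv H F x) p \<le> epowr (\<integral>\<^sup>+ k. window (r k) F x * ennreal (1 / v k) \<partial>M) p"
        using p by (intro epowr_mono) auto
      also have "\<dots> \<le> ennreal (s powr (p - 1)) * (\<integral>\<^sup>+ k. epowr (window (r k) F x * ennreal (1 / v k)) p \<partial>M)"
        by (rule nn_integral_epowr_le[OF _ M s(2) p]) (simp add: M_def)
      also have "(\<integral>\<^sup>+ k. epowr (window (r k) F x * ennreal (1 / v k)) p \<partial>M) =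
          ?Q x"
        unfolding M_def using v
        by (subst nn_integral_density)
           (auto intro!: nn_integral_cong simp: epowr_mult epowr_ennreal powr_divide powr_minus_divide less_imp_le mult.commute[of "epowr _ _"])
      finally show ?thesis .
    qed
    have "wint p w (nconv H F) \<le> (\<integral>\<^sup>+ x. ennreal (s powr (p - 1)) *
       ?Q x * ennreal (w x) \<partial>lebesgue)"
      unfolding wint_def by (intro nn_integral_mono mult_right_mono pt) auto
    also have "\<dots> = (\<integral>\<^sup>+ x. \<integral>\<^sup>+ k. ?T k x \<partial>count_space UNIV \<partial>lebesgue)"
      by (simp add: mult.assoc flip: nn_integral_multc nn_integral_cmult)
    also have "\<dots> = (\<integral>\<^sup>+ k. \<integral>\<^sup>+ x. ?T k x \<partial>lebesgue \<partial>count_space UNIV)"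
      by (rule nn_integral_int_swap) (auto intro: sigma_finite_lebesgue)
    also have "\<dots> = (\<integral>\<^sup>+ k. ennreal (s powr (p - 1)) *
       (h k * ennreal (v k) * (ennreal (v k powr - p) * wint p w (window (r k) F))) \<partial>count_space UNIV)"
      unfolding wint_def by (simp add: nn_integral_cmult)
    also have "\<dots> \<le> (\<integral>\<^sup>+ k. ennreal (s powr (p - 1)) *
       (h k * ennreal (v k) * (ennreal A * wint p w F)) \<partial>count_space UNIV)"
    proof (intro nn_integral_mono mult_left_mono)
      fix k
      have "ennreal (v k powr - p) * wint p w (window (r k) F) \<le>
          ennreal (v k powr - p) * (ennreal (A * v k powr p) * wint p w F)"
        unfolding v_def by (intro mult_left_mono win r) auto
      also have "\<dots> = ennreal A * wint p w F"
        using v[of k] A by (simp add: mult.assoc[symmetric] powr_minus_divide flip: ennreal_mult)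
      finally show "ennreal (v k powr - p) * wint p w (window (r k) F) \<le> ennreal A * wint p w F" .
    qed auto
    also have "\<dots> = ennreal (s powr (p - 1)) * (S * (ennreal A * wint p w F))"
      unfolding S_def by (simp add: nn_integral_cmult nn_integral_multc)
    also have "\<dots> = ennreal A * epowr S p * wint p w F"
    proof -
      have "s powr (p - 1) * s = s powr p"
        using powr_mult_base[OF s(2), of "p - 1"] by (simp add: mult.commute)
      then have "epowr S p = ennreal (s powr (p - 1)) * S"
        using s by (simp add: epowr_ennreal flip: ennreal_mult)
      then show ?thesis by (simp only: ac_simps)
    qed
    also have "\<dots> \<le> ennreal A * epowr (ennreal (8 ^ CARD('n)) * I) p * wint p w F"
      using p by (intro mult_right_mono mult_left_mono epowr_mono S) auto
    also have "\<dots> = ennreal (A * (8 ^ CARD('n)) powr p) * epowr I p * wint p w F"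
      using A by (simp only: epowr_mult epowr_ennreal zero_le_power zero_le_numeral ennreal_mult powr_ge_zero ac_simps)
    finally show "wint p w (nconv H F) \<le> ennreal (A * (8 ^ CARD('n)) powr p) * epowr (integral\<^sup>N lborel H) p * wint p w F"
      unfolding I_def .
  qed (use A in auto)
qed

declare lebesgue_ident [measurable del] lebesgue_fst [measurable del] lebesgue_snd [measurable del]

section \<open>Convolutions and Gaussians\<close>

lemma lborel_distr_reflect: "distr lborel borel (\<lambda>y. x - y) = (lborel :: 'a::euclidean_space measure)"
proof (rule measure_eqI)
  fix A :: "'a set" assume "A \<in> sets (distr lborel borel (\<lambda>y. x - y))"
  then have [measurable]: "A \<in> sets borel" by simp
  have "emeasure (distr lborel borel (\<lambda>y. x - y)) A = (\<integral>\<^sup>+ y. indicator A y \<partial>distr lborel borel (\<lambda>y. x - y))"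
    by simp
  also have "\<dots> = (\<integral>\<^sup>+ y. indicator A (x - y) \<partial>lborel)"
    by (subst nn_integral_distr) auto
  also have "\<dots> = (\<integral>\<^sup>+ y. indicator A y \<partial>lborel)"
    by (rule nn_integral_reflect) measurable
  finally show "emeasure (distr lborel borel (\<lambda>y. x - y)) A = emeasure lborel A" by simp
qed simp

lemma integrable_reflect:
  fixes f :: "'a::euclidean_space \<Rightarrow> complex"
  assumes "integrable lborel f"
  shows "integrable lborel (\<lambda>a. f (x - a))"
  using assms by (subst (asm) lborel_distr_reflect[of x, symmetric], subst (asm) integrable_distr_eq) auto

lemma integral_reflect:
  fixes f :: "'a::euclidean_space \<Rightarrow> complex"
  assumes "f \<in> borel_measurable borel"
  shows "(LINT a|lborel. f (x - a)) = (LINT a|lborel. f a)"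
  using assms by (subst (2) lborel_distr_reflect[of x, symmetric], subst integral_distr) auto

lemma nn_integral_shift:
  fixes f :: "'a::euclidean_space \<Rightarrow> ennreal"
  assumes [measurable]: "f \<in> borel_measurable borel"
  shows "(\<integral>\<^sup>+ y. f (y - x) \<partial>lborel) = integral\<^sup>N lborel f"
  using nn_integral_reflect[of "\<lambda>y. f (- y)" x] nn_integral_reflect[of f 0] by simp

definition cconv :: "(real ^ ('n::finite) \<Rightarrow> complex) \<Rightarrow> (real ^ 'n \<Rightarrow> complex) \<Rightarrow> real ^ 'n \<Rightarrow> complex" where
  "cconv u f x = (LINT a|lborel. u a * f (x - a))"

text \<open>Bounded everywhere, not just almost everywhere: convolution with an integrable function
  then converges at every point, and the algebraic laws are equalities of functions.\<close>

definition nice :: "(real ^ ('n::finite) \<Rightarrow> complex) \<Rightarrow> bool" where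
  "nice f \<longleftrightarrow> integrable lborel f \<and> (\<exists>B. \<forall>x. norm (f x) \<le> B)"

definition enorm :: "('a \<Rightarrow> complex) \<Rightarrow> 'a \<Rightarrow> ennreal" where
  "enorm f x = ennreal (norm (f x))"

lemma measurable_enorm [measurable]: "f \<in> borel_measurable M \<Longrightarrow> enorm f \<in> borel_measurable M"
  unfolding enorm_def[abs_def] by measurable

lemma nice_integrable [simp]: "nice f \<Longrightarrow> integrable lborel f"
  by (simp add: nice_def)

lemma nice_measurable [measurable_dest]: "nice f \<Longrightarrow> f \<in> borel_measurable borel"
  using borel_measurable_integrable[of lborel f] by (simp add: nice_def)

lemma integrable_lborel_measurable: "integrable lborel f \<Longrightarrow> f \<in> borel_measurable borel"
  using borel_measurable_integrable[of lborel f] by simp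

lemma integrable_conv:
  assumes u: "integrable lborel u" and f: "nice f"
  shows "integrable lborel (\<lambda>a. u a * f (x - a))"
proof -
  obtain B where B: "\<And>x. norm (f x) \<le> B" using f by (auto simp: nice_def)
  have [measurable]: "u \<in> borel_measurable borel" "f \<in> borel_measurable borel"
    using u f by (auto intro: integrable_lborel_measurable)
  show ?thesis
  proof (rule Bochner_Integration.integrable_bound)
    show "integrable lborel (\<lambda>a. B * norm (u a))" using u by simp
    show "AE a in lborel. norm (u a * f (x - a)) \<le> norm (B * norm (u a))"
      using mult_left_mono[OF B norm_ge_zero] order_trans[OF norm_ge_zero B]
      by (auto simp: norm_mult abs_mult mult.commute[of B])
  qed measurable
qed

lemma nn_integral_nconv:
  assumes [measurable]: "U \<in> borel_measurable borel" "F \<in> borel_measurable borel"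
  shows "(\<integral>\<^sup>+ x. nconv U F x \<partial>lborel) = integral\<^sup>N lborel U * integral\<^sup>N lborel F"
proof -
  have "(\<integral>\<^sup>+ x. nconv U F x \<partial>lborel) = (\<integral>\<^sup>+ a. \<integral>\<^sup>+ x. U a * F (x - a) \<partial>lborel \<partial>lborel)"
    unfolding nconv_def by (rule lborel_pair.Fubini') measurable
  also have "\<dots> = (\<integral>\<^sup>+ a. U a * integral\<^sup>N lborel F \<partial>lborel)"
    by (simp add: nn_integral_cmult nn_integral_shift)
  finally show ?thesis by (simp add: nn_integral_multc)
qed

lemma measurable_nconv [measurable]:
  assumes [measurable]: "U \<in> borel_measurable borel" "F \<in> borel_measurable borel"
  shows "nconv U F \<in> borel_measurable borel"
proof -
  have "(\<lambda>x. \<integral>\<^sup>+ a. U a * F (x - a) \<partial>lborel) \<in> borel_measurable borel"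
    by (rule lborel.borel_measurable_nn_integral) measurable
  then show ?thesis by (simp add: nconv_def[abs_def])
qed

lemma nconv_commute:
  assumes [measurable]: "U \<in> borel_measurable borel" "F \<in> borel_measurable borel"
  shows "nconv U F = nconv F U"
proof
  fix x
  show "nconv U F x = nconv F U x"
    using nn_integral_reflect[of "\<lambda>a. U a * F (x - a)" x] by (simp add: nconv_def mult.commute)
qed

lemma nconv_left_commute:
  assumes [measurable]: "U \<in> borel_measurable borel" "V \<in> borel_measurable borel" "F \<in> borel_measurable borel"
  shows "nconv U (nconv V F) = nconv V (nconv U F)"
proof
  fix x
  have "nconv U (nconv V F) x = (\<integral>\<^sup>+ a. \<integral>\<^sup>+ b. U a * (V b * F (x - a - b)) \<partial>lborel \<partial>lborel)"
    by (simp add: nconv_def nn_integral_cmult)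
  also have "\<dots> = (\<integral>\<^sup>+ b. \<integral>\<^sup>+ a. U a * (V b * F (x - a - b)) \<partial>lborel \<partial>lborel)"
    by (rule lborel_pair.Fubini') measurable
  also have "\<dots> = (\<integral>\<^sup>+ b. \<integral>\<^sup>+ a. V b * (U a * F (x - b - a)) \<partial>lborel \<partial>lborel)"
    by (intro nn_integral_cong) (simp add: mult.left_commute diff_diff_eq add.commute)
  also have "\<dots> = nconv V (nconv U F) x"
    by (simp add: nconv_def nn_integral_cmult)
  finally show "nconv U (nconv V F) x = nconv V (nconv U F) x" .
qed

lemma nconv_assoc:
  assumes [measurable]: "U \<in> borel_measurable borel" "V \<in> borel_measurable borel" "F \<in> borel_measurable borel"
  shows "nconv (nconv U V) F = nconv U (nconv V F)"
  by (subst nconv_commute[of "nconv U V"], measurable, subst nconv_left_commute, measurable)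
     (simp add: nconv_commute[of F V])

text \<open>Also true where the convolution integral diverges, because its value is then 0.\<close>

lemma enorm_cconv_le: "enorm (cconv u f) x \<le> nconv (enorm u) (enorm f) x"
proof (cases "integrable lborel (\<lambda>a. u a * f (x - a))")
  case True
  show ?thesis
    using integral_norm_bound_ennreal[OF True]
    by (simp add: enorm_def cconv_def nconv_def norm_mult ennreal_mult)
next
  case False
  then show ?thesis by (simp add: enorm_def cconv_def not_integrable_integral_eq)
qed

lemma nn_integral_enorm_less_top: "integrable lborel f \<Longrightarrow> (\<integral>\<^sup>+ x. enorm f x \<partial>lborel) < \<top>"
  by (simp add: integrable_iff_bounded enorm_def)

lemma measurable_cconv [measurable]:
  assumes [measurable]: "u \<in> borel_measurable borel" "f \<in> borel_measurable borel"
  shows "cconv u f \<in> borel_measurable borel"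
proof -
  have "(\<lambda>x. LINT a|lborel. u a * f (x - a)) \<in> borel_measurable borel"
    by (rule lborel.borel_measurable_lebesgue_integral) measurable
  then show ?thesis by (simp add: cconv_def[abs_def])
qed

lemma nice_cconv:
  assumes u: "integrable lborel u" and f: "nice f"
  shows "nice (cconv u f)"
proof -
  obtain B where B: "\<And>x. norm (f x) \<le> B" using f by (auto simp: nice_def)
  have [measurable]: "u \<in> borel_measurable borel" "f \<in> borel_measurable borel"
    using u f by (auto intro: integrable_lborel_measurable)
  have "(\<integral>\<^sup>+ x. enorm (cconv u f) x \<partial>lborel) \<le> (\<integral>\<^sup>+ x. nconv (enorm u) (enorm f) x \<partial>lborel)"
    by (intro nn_integral_mono enorm_cconv_le)
  also have "\<dots> < \<top>"
    using u f by (simp add: nn_integral_nconv ennreal_mult_less_top nn_integral_enorm_less_top)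
  finally have 1: "integrable lborel (cconv u f)"
    by (intro integrableI_bounded) (auto simp: enorm_def)
  have "norm (cconv u f x) \<le> B * (LINT a|lborel. norm (u a))" for x
  proof -
    have "norm (cconv u f x) \<le> (LINT a|lborel. norm (u a * f (x - a)))"
      unfolding cconv_def by (rule integral_norm_bound)
    also have "\<dots> \<le> (LINT a|lborel. B * norm (u a))"
      using integrable_norm[OF integrable_conv[OF u f, of x]] u B
      by (intro integral_mono) (auto simp: norm_mult mult.commute[of B] intro!: mult_left_mono)
    finally show ?thesis by simp
  qed
  with 1 show ?thesis by (auto simp: nice_def)
qed

lemma cconv_commute:
  assumes [measurable]: "u \<in> borel_measurable borel" "f \<in> borel_measurable borel"
  shows "cconv u f = cconv f u"
proof
  fix x
  show "cconv u f x = cconv f u x"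
    using integral_reflect[of "\<lambda>a. u a * f (x - a)" x] by (simp add: cconv_def mult.commute)
qed

text \<open>Fubini with the integrable majorant B |u a| |v b|. Through this T commutes with Gaussian
  localisation.\<close>

lemma cconv_left_commute:
  assumes u: "integrable lborel u" and v: "integrable lborel v" and f: "nice f"
  shows "cconv u (cconv v f) = cconv v (cconv u f)"
proof
  fix x
  have [measurable]: "u \<in> borel_measurable borel" "v \<in> borel_measurable borel" "f \<in> borel_measurable borel"
    using u v f by (auto intro: integrable_lborel_measurable)
  obtain B where B: "\<And>x. norm (f x) \<le> B" using f by (auto simp: nice_def)
  have B0: "B \<ge> 0" using order_trans[OF norm_ge_zero B] .
  have int: "integrable (lborel \<Otimes>\<^sub>M lborel) (\<lambda>(a, b). u a * (v b * f (x - a - b)))"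
  proof (rule Bochner_Integration.integrable_bound)
    have "integrable (lborel \<Otimes>\<^sub>M lborel) (\<lambda>(a, b). norm (u a) * norm (v b))"
      using u v by (intro lborel_pair.Fubini_integrable) (auto simp: norm_mult)
    then show "integrable (lborel \<Otimes>\<^sub>M lborel) (\<lambda>p. B * (case p of (a, b) \<Rightarrow> norm (u a) * norm (v b)))"
      by simp
    have "norm (u a) * (norm (v b) * norm (f y)) \<le> B * (norm (u a) * norm (v b))" for a b y
    proof -
      have "norm (u a) * (norm (v b) * norm (f y)) \<le> norm (u a) * (norm (v b) * B)"
        by (intro mult_left_mono B) auto
      then show ?thesis by (simp add: ac_simps)
    qed
    then show "AE p in lborel \<Otimes>\<^sub>M lborel. norm (case p of (a, b) \<Rightarrow> u a * (v b * f (x - a - b)))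
       \<le> norm (B * (case p of (a, b) \<Rightarrow> norm (u a) * norm (v b)))"
      using B0 by (auto simp: norm_mult abs_mult split: prod.split)
  qed measurable
  have "cconv u (cconv v f) x = (LINT a|lborel. LINT b|lborel. u a * (v b * f (x - a - b)))"
    by (simp add: cconv_def)
  also have "\<dots> = (LINT b|lborel. LINT a|lborel. u a * (v b * f (x - a - b)))"
    by (rule lborel_pair.Fubini_integral[OF int, symmetric])
  also have "\<dots> = (LINT b|lborel. LINT a|lborel. v b * (u a * f (x - b - a)))"
    by (simp add: mult.left_commute diff_diff_eq add.commute)
  also have "\<dots> = cconv v (cconv u f) x"
    by (simp add: cconv_def)
  finally show "cconv u (cconv v f) x = cconv v (cconv u f) x" .
qed

lemma cconv_assoc:
  assumes u: "integrable lborel u" and v: "nice v" and f: "nice f"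
  shows "cconv (cconv u v) f = cconv u (cconv v f)"
proof -
  have [measurable]: "u \<in> borel_measurable borel" "v \<in> borel_measurable borel" "f \<in> borel_measurable borel"
    using u v f by (auto intro: integrable_lborel_measurable)
  have "cconv (cconv u v) f = cconv f (cconv u v)"
    by (rule cconv_commute) measurable
  also have "\<dots> = cconv u (cconv f v)"
    using u v f by (intro cconv_left_commute) auto
  finally show ?thesis by (simp add: cconv_commute[of f v])
qed

lemma cconv_diff_right:
  assumes "integrable lborel u" "nice f" "nice h"
  shows "cconv u (\<lambda>x. f x - h x) x = cconv u f x - cconv u h x"
  using assms by (simp add: cconv_def right_diff_distrib integrable_conv)

lemma cconv_cmult_right: "cconv u (\<lambda>x. c * f x) x = c * cconv u f x"
  by (simp add: cconv_def mult.left_commute)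

lemma cconv_cmult_left: "cconv (\<lambda>x. c * u x) f x = c * cconv u f x"
  by (simp add: cconv_def mult.assoc)

lemma cconv_diff_left:
  assumes "integrable lborel u" "integrable lborel v" "nice f"
  shows "cconv (\<lambda>x. u x - v x) f x = cconv u f x - cconv v f x"
  using assms by (simp add: cconv_def left_diff_distrib integrable_conv)

lemma nice_diff:
  assumes "nice f" "nice h"
  shows "nice (\<lambda>x. f x - h x)"
proof -
  obtain B C where "\<And>x. norm (f x) \<le> B" "\<And>x. norm (h x) \<le> C" using assms by (auto simp: nice_def)
  then have "norm (f x - h x) \<le> B + C" for x
    by (meson add_mono norm_triangle_ineq4 order_trans)
  then show ?thesis using assms by (auto simp: nice_def)
qed

lemma nice_cmult: "nice f \<Longrightarrow> nice (\<lambda>x. c * f x)"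
  unfolding nice_def by (auto simp: norm_mult) (meson mult_left_mono norm_ge_zero)

section \<open>Gaussians and their modulations\<close>

text \<open>The centred normal density with covariance s times the identity. The parameter is the
  variance, so that convolution adds parameters.\<close>

definition gauss :: "real \<Rightarrow> real ^ ('n::finite) \<Rightarrow> real" where
  "gauss s x = exp (- (norm x)\<^sup>2 / (2 * s)) / (2 * pi * s) powr (real CARD('n) / 2)"

definition cgauss :: "real \<Rightarrow> real ^ ('n::finite) \<Rightarrow> real ^ 'n \<Rightarrow> complex" where
  "cgauss s \<xi> x = of_real (gauss s x) * exp (\<i> * of_real (x \<bullet> \<xi>))"

lemma gauss_pos: "s > 0 \<Longrightarrow> gauss s x > 0"
  by (simp add: gauss_def)

lemma gauss_nonneg [simp]: "gauss s x \<ge> 0"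
  by (simp add: gauss_def)

lemma measurable_gauss [measurable]: "gauss s \<in> borel_measurable borel"
  unfolding gauss_def[abs_def] by measurable

lemma measurable_cgauss [measurable]: "cgauss s \<xi> \<in> borel_measurable borel"
  unfolding cgauss_def[abs_def] by measurable

text \<open>Factoring over the coordinates brings total mass and semigroup law down to the
  one-dimensional normal density.\<close>

lemma gauss_prod:
  fixes x :: "real ^ 'n::finite"
  assumes "s > 0"
  shows "gauss s x = (\<Prod>b\<in>Basis. normal_density 0 (sqrt s) (x \<bullet> b))"
proof -
  have "(\<Prod>b\<in>Basis. normal_density 0 (sqrt s) (x \<bullet> b)) =
    (\<Prod>b\<in>(Basis :: (real ^ 'n) set). 1 / sqrt (2 * pi * s)) * (\<Prod>b\<in>Basis. exp (- (x \<bullet> b)\<^sup>2 / (2 * s)))"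
    unfolding prod.distrib[symmetric] using assms by (intro prod.cong refl) (simp add: normal_density_def)
  also have "(\<Prod>b\<in>Basis. exp (- (x \<bullet> b)\<^sup>2 / (2 * s))) = exp (- (norm x)\<^sup>2 / (2 * s))"
  proof -
    have "(norm x)\<^sup>2 = (\<Sum>b\<in>Basis. (x \<bullet> b)\<^sup>2)"
      unfolding power2_norm_eq_inner euclidean_inner[of x x] by (simp add: power2_eq_square)
    then have "- (norm x)\<^sup>2 / (2 * s) = (\<Sum>b\<in>Basis. - (x \<bullet> b)\<^sup>2 / (2 * s))"
      by (simp add: sum_negf sum_divide_distrib)
    then show ?thesis by (simp only: exp_sum finite_Basis)
  qed
  also have "(\<Prod>b\<in>(Basis :: (real ^ 'n) set). 1 / sqrt (2 * pi * s)) = 1 / (2 * pi * s) powr (real CARD('n) / 2)"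
    using assms by (simp add: power_divide powr_half_sqrt[symmetric] powr_powr flip: powr_realpow)
  finally show ?thesis by (simp add: gauss_def)
qed

lemma nn_integral_gauss:
  assumes s: "s > 0"
  shows "(\<integral>\<^sup>+ x. ennreal (gauss s (x :: real ^ 'n::finite)) \<partial>lborel) = 1"
proof -
  have "(\<integral>\<^sup>+ x. ennreal (gauss s (x :: real ^ 'n)) \<partial>lborel) =
     (\<integral>\<^sup>+ x. (\<Prod>b\<in>Basis. ennreal (normal_density 0 (sqrt s) ((x :: real ^ 'n) \<bullet> b))) \<partial>lborel)"
    by (simp add: gauss_prod[OF s] prod_ennreal)
  also have "\<dots> = (\<Prod>b\<in>(Basis :: (real ^ 'n) set). \<integral>\<^sup>+ t. ennreal (normal_density 0 (sqrt s) t) \<partial>lborel)"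
    by (subst nn_integral_lborel_prod) auto
  also have "\<dots> = 1"
    using s by (subst nn_integral_eq_integral) auto
  finally show ?thesis .
qed

lemma integrable_gauss: "s > 0 \<Longrightarrow> integrable lborel (gauss s)"
  by (rule integrableI_nonneg) (auto simp: nn_integral_gauss less_imp_le gauss_pos)

lemma integral_gauss: "s > 0 \<Longrightarrow> (LINT x|lborel. gauss s x) = 1"
  by (simp add: integral_eq_nn_integral nn_integral_gauss less_imp_le gauss_pos)

lemma norm_cgauss: "s > 0 \<Longrightarrow> norm (cgauss s \<xi> x) = gauss s x"
  using gauss_pos[of s x] by (simp add: cgauss_def norm_mult)

lemma gauss_le: "s > 0 \<Longrightarrow> gauss s (x :: real ^ 'n::finite) \<le> 1 / (2 * pi * s) powr (real CARD('n) / 2)"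
  by (auto simp: gauss_def intro!: divide_right_mono)

lemma nice_cgauss: "s > 0 \<Longrightarrow> nice (cgauss s \<xi>)"
  unfolding nice_def
  using integrable_gauss[of s]
  by (auto intro!: exI gauss_le Bochner_Integration.integrable_bound[of lborel "gauss s" "cgauss s \<xi>"] simp: norm_cgauss)

lemma nconv_gauss:
  assumes s: "s > 0" and t: "t > 0"
  shows "nconv (\<lambda>x. ennreal (gauss s x)) (\<lambda>x. ennreal (gauss t x)) x = ennreal (gauss (s + t) (x :: real ^ 'n::finite))"
proof -
  have "nconv (\<lambda>x. ennreal (gauss t x)) (\<lambda>x. ennreal (gauss s x)) x =
     (\<integral>\<^sup>+ y. (\<Prod>b\<in>Basis. ennreal (normal_density 0 (sqrt s) (x \<bullet> b - y \<bullet> b) * normal_density 0 (sqrt t) (y \<bullet> b))) \<partial>lborel)"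
    using s t by (auto simp: nconv_def gauss_prod prod_ennreal inner_diff_left prod.distrib mult.commute prod_nonneg simp flip: ennreal_mult
      intro!: nn_integral_cong)
  also have "\<dots> = (\<Prod>b\<in>Basis. \<integral>\<^sup>+ y. ennreal (normal_density 0 (sqrt s) (x \<bullet> b - y) * normal_density 0 (sqrt t) y) \<partial>lborel)"
    by (subst nn_integral_lborel_prod[of "\<lambda>b y. ennreal (normal_density 0 (sqrt s) (x \<bullet> b - y) * normal_density 0 (sqrt t) y)", symmetric]) auto
  also have "\<dots> = (\<Prod>b\<in>Basis. ennreal (normal_density 0 (sqrt (s + t)) (x \<bullet> b)))"
    using s t by (intro prod.cong refl) (simp add: fun_cong[OF conv_normal_density_zero_mean])
  also have "\<dots> = ennreal (gauss (s + t) x)"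
    using s t by (simp add: gauss_prod prod_ennreal)
  finally show ?thesis by (subst nconv_commute) auto
qed

text \<open>The character is multiplicative, so it leaves the integral as exp(i x.\<xi>) and the
  semigroup law of \<open>gauss\<close> remains.\<close>

lemma cconv_cgauss:
  assumes s: "s > 0" and t: "t > 0"
  shows "cconv (cgauss s \<xi>) (cgauss t \<xi>) = cgauss (s + t) \<xi>"
proof
  fix x
  have "cconv (cgauss s \<xi>) (cgauss t \<xi>) x =
     (LINT a|lborel. exp (\<i> * of_real (x \<bullet> \<xi>)) * of_real (gauss s a * gauss t (x - a)))"
    unfolding cconv_def
  proof (intro Bochner_Integration.integral_cong refl)
    fix a
    have "exp (\<i> * of_real (a \<bullet> \<xi>)) * exp (\<i> * of_real ((x - a) \<bullet> \<xi>)) = exp (\<i> * of_real (x \<bullet> \<xi>))"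
      by (simp add: inner_diff_left algebra_simps flip: exp_add)
    then show "cgauss s \<xi> a * cgauss t \<xi> (x - a) = exp (\<i> * of_real (x \<bullet> \<xi>)) * of_real (gauss s a * gauss t (x - a))"
      by (simp add: cgauss_def ac_simps)
  qed
  also have "\<dots> = exp (\<i> * of_real (x \<bullet> \<xi>)) * of_real (LINT a|lborel. gauss s a * gauss t (x - a))"
    by (simp flip: integral_complex_of_real)
  also have "(LINT a|lborel. gauss s a * gauss t (x - a)) = gauss (s + t) x"
    using nconv_gauss[OF s t, of x]
    by (subst integral_eq_nn_integral) (auto simp: nconv_def ennreal_mult)
  finally show "cconv (cgauss s \<xi>) (cgauss t \<xi>) x = cgauss (s + t) \<xi> x"
    by (simp only: cgauss_def[of "s + t"] mult.commute)
qed

text \<open>\<open>gauss\<close> depends on the Euclidean norm and need not be monotone in infnorm;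
  putting the smaller infnorm into the exponent gives a majorant that is.\<close>

definition gmaj :: "real \<Rightarrow> real ^ ('n::finite) \<Rightarrow> ennreal" where
  "gmaj s x = ennreal (exp (- (infnorm x)\<^sup>2 / (2 * s)) / (2 * pi * s) powr (real CARD('n) / 2))"

lemma radial_decr_gmaj: "s > 0 \<Longrightarrow> radial_decr (gmaj s)"
  unfolding radial_decr_def gmaj_def
  by (auto intro!: ennreal_leI divide_right_mono power_mono simp: infnorm_pos_le)

lemma gauss_le_gmaj: "s > 0 \<Longrightarrow> ennreal (gauss s x) \<le> gmaj s x"
  unfolding gauss_def gmaj_def
  by (auto intro!: ennreal_leI divide_right_mono power_mono simp: infnorm_pos_le infnorm_le_norm)

text \<open>Since norm x \<le> sqrt n infnorm x in dimension n, \<open>gmaj s\<close> is at most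
  n^(n/2) times the Gaussian of variance n s. The bound is free of s, which makes Gaussian
  convolution bounded uniformly in the width.\<close>

lemma nn_integral_gmaj_le:
  assumes s: "s > 0"
  shows "(\<integral>\<^sup>+ x. gmaj s (x :: real ^ 'n::finite) \<partial>lborel) \<le> ennreal (real CARD('n) powr (real CARD('n) / 2))"
proof -
  let ?d = "real CARD('n)"
  have "gmaj s x \<le> ennreal (?d powr (?d / 2)) * ennreal (gauss (?d * s) x)" for x :: "real ^ 'n"
  proof -
    have "norm x \<le> sqrt ?d * infnorm x" using norm_le_infnorm[of x] by simp
    then have "(norm x)\<^sup>2 \<le> (sqrt ?d * infnorm x)\<^sup>2" by (intro power_mono) auto
    then have "(norm x)\<^sup>2 \<le> ?d * (infnorm x)\<^sup>2" by (simp add: power_mult_distrib)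
    then have "exp (- (infnorm x)\<^sup>2 / (2 * s)) \<le> exp (- (norm x)\<^sup>2 / (2 * (?d * s)))"
      using s by (simp add: field_simps)
    moreover have "(2 * pi * (?d * s)) powr (?d / 2) = ?d powr (?d / 2) * (2 * pi * s) powr (?d / 2)"
      using s by (simp add: powr_mult[symmetric] ac_simps)
    ultimately show ?thesis
      using s by (auto simp: gmaj_def gauss_def intro!: ennreal_leI divide_right_mono simp flip: ennreal_mult)
  qed
  then have "(\<integral>\<^sup>+ x. gmaj s (x :: real ^ 'n) \<partial>lborel) \<le> (\<integral>\<^sup>+ x. ennreal (?d powr (?d / 2)) * ennreal (gauss (?d * s) (x :: real ^ 'n)) \<partial>lborel)"
    by (intro nn_integral_mono)
  also have "\<dots> = ennreal (?d powr (?d / 2))"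
    using s by (simp add: nn_integral_cmult nn_integral_gauss)
  finally show ?thesis .
qed

lemma char_std_normal_LINT:
  "(LINT t|std_normal_distribution. exp (\<i> * of_real (c * t))) = of_real (exp (- c\<^sup>2 / 2))"
  using fun_cong[OF char_std_normal_distribution, of c] by (simp add: char_def)

text \<open>The law of a vector of independent standard normals, later a random frequency. It lives
  on functions rather than vectors because product measures do.\<close>

definition gprob :: "('n::finite \<Rightarrow> real) measure" where
  "gprob = Pi\<^sub>M UNIV (\<lambda>_. std_normal_distribution)"

lemma sets_gprob [measurable_cong]: "sets gprob = sets (Pi\<^sub>M UNIV (\<lambda>_. borel))"
  unfolding gprob_def by (intro sets_PiM_cong) auto

lemma prob_space_std_normal: "prob_space std_normal_distribution"
  by (rule prob_space_normal_density) simp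

lemma prob_space_gprob: "prob_space gprob"
  unfolding gprob_def by (intro prob_space_PiM prob_space_std_normal)

text \<open>The quotient of the Gaussians of variance \<tau> and \<sigma> is (\<sigma>/\<tau>)^(n/2)
  exp(-b^2 |x|^2/2) with b^2 = 1/\<tau> - 1/\<sigma>, and this exponential is the characteristic
  function at x of b times a standard normal vector.\<close>

lemma gauss_eq_superposition:
  fixes x :: "real ^ 'n::finite"
  assumes \<tau>: "0 < \<tau>" and \<sigma>: "\<tau> < \<sigma>"
  shows "of_real (gauss \<tau> x) = of_real ((\<sigma> / \<tau>) powr (real CARD('n) / 2)) *
    (LINT \<omega>|gprob. cgauss \<sigma> (sqrt (1 / \<tau> - 1 / \<sigma>) *\<^sub>R (\<chi> i. \<omega> i)) x)"
proof -
  let ?d = "real CARD('n) / 2"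
  define b where "b = sqrt (1 / \<tau> - 1 / \<sigma>)"
  have b2: "b\<^sup>2 = 1 / \<tau> - 1 / \<sigma>" using \<tau> \<sigma> by (simp add: b_def field_simps)
  let ?e = "\<lambda>\<omega>. exp (\<i> * of_real (x \<bullet> (b *\<^sub>R (\<chi> i. \<omega> i))))"
  interpret N: prob_space std_normal_distribution by (rule prob_space_std_normal)
  interpret product_sigma_finite "\<lambda>_::'n. std_normal_distribution" ..
  have "(LINT \<omega>|gprob. ?e \<omega>) =
     (LINT \<omega>|Pi\<^sub>M UNIV (\<lambda>_. std_normal_distribution). (\<Prod>i\<in>UNIV. exp (\<i> * of_real (b * x $ i * \<omega> i))))"
    unfolding gprob_def
    by (intro Bochner_Integration.integral_cong refl)
       (simp add: inner_vec_def sum_distrib_left ac_simps flip: exp_sum)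
  also have "\<dots> = (\<Prod>i\<in>UNIV. LINT t|std_normal_distribution. exp (\<i> * of_real (b * x $ i * t)))"
  proof (rule product_integral_prod)
    fix i
    show "integrable std_normal_distribution (\<lambda>t. exp (\<i> * of_real (b * x $ i * t)))"
      by (rule N.integrable_const_bound[of _ 1]) auto
  qed simp
  also have "\<dots> = (\<Prod>i\<in>UNIV. of_real (exp (- (b * x $ i)\<^sup>2 / 2)))"
    by (simp only: char_std_normal_LINT)
  also have "\<dots> = of_real (exp (- b\<^sup>2 * (norm x)\<^sup>2 / 2))"
  proof -
    have "(norm x)\<^sup>2 = (\<Sum>i\<in>UNIV. (x $ i)\<^sup>2)"
      unfolding power2_norm_eq_inner inner_vec_def by (simp add: power2_eq_square)
    then have "- b\<^sup>2 * (norm x)\<^sup>2 / 2 = (\<Sum>i\<in>UNIV. - (b * x $ i)\<^sup>2 / 2)"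
      by (simp add: sum_distrib_left sum_negf sum_divide_distrib power_mult_distrib)
    then show ?thesis by (simp only: exp_sum finite of_real_prod)
  qed
  finally have *: "(LINT \<omega>|gprob. ?e \<omega>) = of_real (exp (- b\<^sup>2 * (norm x)\<^sup>2 / 2))" .
  have "gauss \<tau> x = (\<sigma> / \<tau>) powr ?d * (gauss \<sigma> x * exp (- b\<^sup>2 * (norm x)\<^sup>2 / 2))"
  proof -
    have "- (norm x)\<^sup>2 / (2 * \<tau>) = - (norm x)\<^sup>2 / (2 * \<sigma>) + - b\<^sup>2 * (norm x)\<^sup>2 / 2"
      using \<tau> \<sigma> by (simp add: b2 field_simps)
    then have "exp (- (norm x)\<^sup>2 / (2 * \<tau>)) = exp (- (norm x)\<^sup>2 / (2 * \<sigma>)) * exp (- b\<^sup>2 * (norm x)\<^sup>2 / 2)"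
      by (simp only: exp_add)
    moreover have "1 / (2 * pi * \<tau>) powr ?d = (\<sigma> / \<tau>) powr ?d / (2 * pi * \<sigma>) powr ?d"
      using \<tau> \<sigma> by (simp add: powr_divide powr_mult)
    ultimately have "exp (- (norm x)\<^sup>2 / (2 * \<tau>)) * (1 / (2 * pi * \<tau>) powr ?d) =
      (exp (- (norm x)\<^sup>2 / (2 * \<sigma>)) * exp (- b\<^sup>2 * (norm x)\<^sup>2 / 2)) * ((\<sigma> / \<tau>) powr ?d / (2 * pi * \<sigma>) powr ?d)"
      by (simp only:)
    then show ?thesis unfolding gauss_def
      by (simp only: times_divide_eq_right times_divide_eq_left mult_1_right ac_simps)
  qed
  moreover have "(LINT \<omega>|gprob. cgauss \<sigma> (b *\<^sub>R (\<chi> i. \<omega> i)) x) =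
     of_real (gauss \<sigma> x) * (LINT \<omega>|gprob. ?e \<omega>)"
    unfolding cgauss_def by (rule integral_mult_right_zero)
  ultimately show ?thesis unfolding b_def[symmetric] * by simp
qed

section \<open>Kernels with a radial majorant\<close>

text \<open>Upper level sets are preimages of intervals under infnorm. Majorants built from suprema,
  such as \<open>rad_sup\<close>, are therefore automatically Borel.\<close>

lemma radial_decr_measurable:
  fixes H :: "real ^ 'n::finite \<Rightarrow> ennreal"
  assumes H: "radial_decr H"
  shows "H \<in> borel_measurable borel"
proof (rule borel_measurableI_greater)
  fix a
  define Z where "Z = {t :: real. t \<ge> 0 \<and> a < H (\<chi> i. t)}"
  have mono: "H (\<chi> i. u) \<le> H (\<chi> i. t)" if "0 \<le> t" "t \<le> u" for t u :: real
    using H that unfolding radial_decr_def by (simp add: infnorm_scaled_ones)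
  have "is_interval Z"
    unfolding is_interval_1 Z_def using mono by (auto intro: less_le_trans)
  then have [measurable]: "Z \<in> sets borel" by (rule real_interval_borel_measurable)
  have eq: "H x = H (\<chi> i. infnorm x)" for x
    using H unfolding radial_decr_def by (intro antisym) (simp_all add: infnorm_scaled_ones real_abs_infnorm)
  have "{x \<in> space borel. a < H x} = {x. infnorm x \<in> Z}"
    unfolding Z_def by (subst eq) (auto simp: infnorm_pos_le)
  also have "\<dots> \<in> sets borel" by measurable
  finally show "{x \<in> space borel. a < H x} \<in> sets borel" .
qed

lemma AE_lborel_reflect:
  assumes "AE y in lborel. P (y :: 'a::euclidean_space)"
  shows "AE v in lborel. P (x - v)"
  using assms by (subst (asm) lborel_distr_reflect[of x, symmetric]) (rule AE_distrD[of _ lborel borel], auto)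

lemma AE_lborel_shift:
  assumes "AE y in lborel. P (y :: 'a::euclidean_space)"
  shows "AE x in lborel. P (x - v)"
proof -
  have "AE u in lborel. P (0 - u)" by (rule AE_lborel_reflect[OF assms])
  then have "AE x in lborel. P (0 - (v - x))" by (rule AE_lborel_reflect)
  then show ?thesis by simp
qed

text \<open>c bounds the integral of the majorant rather than that of U, since the majorant is what
  controls the operator on the weighted space.\<close>

definition dominated :: "(real ^ 'n::finite \<Rightarrow> ennreal) \<Rightarrow> real \<Rightarrow> bool" where
  "dominated U c \<longleftrightarrow> U \<in> borel_measurable borel \<and>
     (\<exists>H. radial_decr H \<and> integral\<^sup>N lborel H \<le> ennreal c \<and> (\<forall>x. U x \<le> H x))"

lemma dominated_measurable [measurable_dest]: "dominated U c \<Longrightarrow> U \<in> borel_measurable borel"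
  by (simp add: dominated_def)

lemma dominated_nn_integral_le: "dominated U c \<Longrightarrow> integral\<^sup>N lborel U \<le> ennreal c"
  unfolding dominated_def by (metis nn_integral_mono order_trans)

text \<open>Setting H to 0 inside a box would destroy monotonicity; capping it by its value at
  radius k preserves it and changes nothing outside. The caps tend to 0, and dominated convergence
  makes the integral small.\<close>

lemma radial_tail:
  fixes H :: "real ^ 'n::finite \<Rightarrow> ennreal"
  assumes H: "radial_decr H" and fin: "integral\<^sup>N lborel H < \<top>" and \<epsilon>: "\<epsilon> > 0"
  shows "\<exists>\<rho>>0. \<exists>H'. radial_decr H' \<and> integral\<^sup>N lborel H' \<le> ennreal \<epsilon> \<and> (\<forall>x. infnorm x > \<rho> \<longrightarrow> H x \<le> H' x)"
proof -
  have [measurable]: "H \<in> borel_measurable borel" by (rule radial_decr_measurable[OF H])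
  define T where "T k x = min (H x) (H (\<chi> i. real k))" for k :: nat and x
  have rad: "radial_decr (T k)" for k
    using H unfolding radial_decr_def T_def by (auto intro: min.coboundedI1)
  \<comment> \<open>By monotonicity, the value at radius k times the volume of the box of that
    radius is at most the integral of H.\<close>
  have lim: "(\<lambda>k. H (\<chi> i. real k)) \<longlonglongrightarrow> 0"
  proof -
    obtain I where I: "integral\<^sup>N lborel H = ennreal I" "I \<ge> 0"
      using fin by (cases "\<integral>\<^sup>+ x. H x \<partial>lborel") auto
    have bd: "H (\<chi> i. real k) \<le> ennreal (I / real k)" if "k > 0" for k
    proof -
      have "H (\<chi> i. real k) * ennreal ((2 * real k) ^ CARD('n)) = (\<integral>\<^sup>+ x. H (\<chi> i. real k) * indicator (box0 (real k)) (x :: real ^ 'n) \<partial>lborel)"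
        using emeasure_translated_box0[of "real k" "0 :: real ^ 'n"]
        by (subst nn_integral_cmult_indicator) (simp_all add: box0_def)
      also have "\<dots> \<le> integral\<^sup>N lborel H"
        using H unfolding radial_decr_def
        by (intro nn_integral_mono) (auto simp: indicator_def infnorm_scaled_ones)
      finally have *: "H (\<chi> i. real k) * ennreal ((2 * real k) ^ CARD('n)) \<le> ennreal I" using I by simp
      have "real k \<le> (2 * real k) ^ CARD('n)"
        using that self_le_power[of "2 * real k" "CARD('n)"] by simp
      then have "H (\<chi> i. real k) * ennreal (real k) \<le> ennreal I"
        using * by (meson ennreal_leI mult_left_mono order_trans zero_le)
      then show ?thesis
        using that I by (cases "H (\<chi> i. real k)") (auto simp: ennreal_top_mult field_simps top_unique simp flip: ennreal_mult)
    qed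
    have "(\<lambda>k. ennreal (I / real k)) \<longlonglongrightarrow> ennreal 0"
      by (intro tendsto_ennrealI lim_const_over_n)
    then have 0: "(\<lambda>k. ennreal (I / real k)) \<longlonglongrightarrow> 0" by simp
    show ?thesis
      by (rule tendsto_sandwich[OF _ _ tendsto_const 0]) (use bd in \<open>auto intro!: eventually_sequentiallyI[of 1]\<close>)
  qed
  have "(\<lambda>k. \<integral>\<^sup>+ x. T k x \<partial>lborel) \<longlonglongrightarrow> (\<integral>\<^sup>+ x. 0 \<partial>(lborel :: (real ^ 'n) measure))"
  proof (rule nn_integral_dominated_convergence[where w = H])
    show "AE x in lborel. (\<lambda>k. T k x) \<longlonglongrightarrow> 0"
      by (rule AE_I2, rule tendsto_sandwich[OF _ _ tendsto_const lim]) (auto simp: T_def)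
  qed (use fin in \<open>auto simp: T_def[abs_def]\<close>)
  then have "\<forall>\<^sub>F k in sequentially. (\<integral>\<^sup>+ x. T k x \<partial>lborel) < ennreal \<epsilon>"
    using \<epsilon> by (intro order_tendstoD) auto
  then obtain k where k: "(\<integral>\<^sup>+ x. T k x \<partial>lborel) < ennreal \<epsilon>" "k > 0"
    using eventually_conj[OF _ eventually_gt_at_top[of 0]] eventually_happens'[OF sequentially_bot] by (metis (no_types, lifting))
  have "\<forall>x. infnorm x > real k \<longrightarrow> H x \<le> T k x"
    using H unfolding radial_decr_def T_def by (auto simp: infnorm_scaled_ones)
  then show ?thesis
    using k rad by (intro exI[of _ "real k"] conjI exI[of _ "T k"]) (auto intro: less_imp_le)
qed

text \<open>Dominated convergence; the origin, where H may be infinite, is a null set.\<close>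

lemma radial_near_zero:
  fixes H :: "real ^ 'n::finite \<Rightarrow> ennreal"
  assumes H: "radial_decr H" and fin: "integral\<^sup>N lborel H < \<top>" and \<epsilon>: "\<epsilon> > 0"
  shows "\<exists>\<delta>>0. (\<integral>\<^sup>+ x. H x * indicator (box0 \<delta>) x \<partial>lborel) \<le> ennreal \<epsilon>"
proof -
  have [measurable]: "H \<in> borel_measurable borel" by (rule radial_decr_measurable[OF H])
  have "(\<lambda>k. \<integral>\<^sup>+ x. H x * indicator (box0 (1 / real (Suc k))) x \<partial>lborel) \<longlonglongrightarrow> (\<integral>\<^sup>+ x. 0 \<partial>(lborel :: (real ^ 'n) measure))"
  proof (rule nn_integral_dominated_convergence[where w = H])
    show "AE x in lborel. (\<lambda>k. H x * indicator (box0 (1 / real (Suc k))) x) \<longlonglongrightarrow> 0"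
    proof (rule AE_mp[OF AE_lborel_singleton[of 0]], intro AE_I2 impI)
      fix x :: "real ^ 'n" assume "x \<noteq> 0"
      then have "infnorm x > 0" by (simp add: infnorm_pos_lt)
      then have "\<forall>\<^sub>F k in sequentially. 1 / real (Suc k) < infnorm x"
        using LIMSEQ_inverse_real_of_nat by (intro order_tendstoD[of "\<lambda>k. 1 / real (Suc k)" 0]) (auto simp: inverse_eq_divide)
      then show "(\<lambda>k. H x * indicator (box0 (1 / real (Suc k))) x) \<longlonglongrightarrow> 0"
        by (intro tendsto_eventually, elim eventually_mono) (simp add: not_le)
    qed
  qed (use fin in \<open>auto simp: indicator_def\<close>)
  then have "\<forall>\<^sub>F k in sequentially. (\<integral>\<^sup>+ x. H x * indicator (box0 (1 / real (Suc k))) x \<partial>lborel) < ennreal \<epsilon>"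
    using \<epsilon> by (intro order_tendstoD) auto
  then obtain k where k: "(\<integral>\<^sup>+ x. H x * indicator (box0 (1 / real (Suc k))) x \<partial>lborel) < ennreal \<epsilon>"
    using eventually_happens'[OF sequentially_bot] by blast
  then show ?thesis
    by (intro exI[of _ "1 / real (Suc k)"]) (auto intro: less_imp_le)
qed

lemma radial_decr_indicator:
  "radial_decr H \<Longrightarrow> radial_decr (\<lambda>x. H x * indicator (box0 \<delta>) x)"
  unfolding radial_decr_def by (auto simp: indicator_def)

lemma powr_two_pi_double: "s > 0 \<Longrightarrow> (2 * pi * (2 * s)) powr q = 2 powr q * (2 * pi * s) powr q"
  by (simp add: powr_mult[symmetric] ac_simps)

text \<open>Half of the exponent yields the small factor exp(-\<delta>^2/(4\<tau>)); the other half
  keeps an integrable radial majorant, of variance 2\<tau>.\<close>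

lemma gauss_tail:
  assumes \<delta>: "\<delta> > 0" and \<epsilon>: "\<epsilon> > 0"
  shows "\<exists>\<tau>>0. \<exists>\<Gamma>. radial_decr \<Gamma> \<and> integral\<^sup>N lborel \<Gamma> \<le> ennreal \<epsilon> \<and>
     (\<forall>x :: real ^ 'n::finite. infnorm x > \<delta> \<longrightarrow> ennreal (gauss \<tau> x) \<le> \<Gamma> x)"
proof -
  let ?d = "real CARD('n)"
  define c where "c = 2 powr (?d / 2) * ?d powr (?d / 2)"
  have c: "c > 0" by (simp add: c_def)
  \<comment> \<open>Chosen so that \<delta>^2/(4\<tau>) = c/\<epsilon>, and exp(-c/\<epsilon>) \<le>
    \<epsilon>/c. Here c collects the normalisation for the doubled variance and the mass of
    \<open>gmaj\<close>.\<close>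
  define \<tau> where "\<tau> = \<delta>\<^sup>2 * \<epsilon> / (4 * c)"
  have \<tau>: "\<tau> > 0" using \<delta> \<epsilon> c by (simp add: \<tau>_def)
  define q where "q = exp (- \<delta>\<^sup>2 / (4 * \<tau>)) * 2 powr (?d / 2)"
  have q: "q \<ge> 0" by (simp add: q_def)
  define \<Gamma> where "\<Gamma> x = ennreal q * gmaj (2 * \<tau>) x" for x :: "real ^ 'n"
  have 1: "radial_decr \<Gamma>"
    using radial_decr_gmaj[of "2 * \<tau>"] \<tau> unfolding radial_decr_def \<Gamma>_def by (blast intro: mult_left_mono zero_le mult_pos_pos zero_less_numeral)
  have [measurable]: "gmaj (2 * \<tau>) \<in> borel_measurable (borel :: (real ^ 'n) measure)"
    using \<tau> by (intro radial_decr_measurable radial_decr_gmaj) auto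
  have 2: "integral\<^sup>N lborel \<Gamma> \<le> ennreal \<epsilon>"
  proof -
    have "exp (- \<delta>\<^sup>2 / (4 * \<tau>)) = 1 / exp (c / \<epsilon>)"
      using \<delta> \<epsilon> c by (simp add: \<tau>_def exp_minus inverse_eq_divide)
    also have "\<dots> \<le> 1 / (c / \<epsilon>)"
    proof (rule divide_left_mono)
      show "c / \<epsilon> \<le> exp (c / \<epsilon>)" using exp_ge_add_one_self[of "c / \<epsilon>"] by linarith
    qed (use c \<epsilon> in auto)
    finally have "exp (- \<delta>\<^sup>2 / (4 * \<tau>)) * c \<le> \<epsilon>" using c \<epsilon> by (simp add: field_simps)
    then have "q * ?d powr (?d / 2) \<le> \<epsilon>" by (simp add: q_def c_def mult.assoc)
    moreover have "integral\<^sup>N lborel \<Gamma> \<le> ennreal q * ennreal (?d powr (?d / 2))"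
      unfolding \<Gamma>_def using \<tau> by (simp add: nn_integral_cmult) (intro mult_left_mono nn_integral_gmaj_le, auto)
    ultimately show ?thesis using q
      by (metis ennreal_leI ennreal_mult' order_trans)
  qed
  have 3: "ennreal (gauss \<tau> x) \<le> \<Gamma> x" if "infnorm x > \<delta>" for x :: "real ^ 'n"
  proof -
    have "\<delta>\<^sup>2 \<le> (infnorm x)\<^sup>2" using that \<delta> by (intro power_mono) auto
    moreover have "(infnorm x)\<^sup>2 \<le> (norm x)\<^sup>2" by (intro power_mono infnorm_le_norm infnorm_pos_le)
    ultimately have "\<delta>\<^sup>2 + (infnorm x)\<^sup>2 \<le> 2 * (norm x)\<^sup>2" by linarith
    then have "- (norm x)\<^sup>2 / (2 * \<tau>) \<le> - \<delta>\<^sup>2 / (4 * \<tau>) + - (infnorm x)\<^sup>2 / (2 * (2 * \<tau>))"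
      using \<tau> by (simp add: field_simps)
    then have "exp (- (norm x)\<^sup>2 / (2 * \<tau>)) \<le> exp (- \<delta>\<^sup>2 / (4 * \<tau>)) * exp (- (infnorm x)\<^sup>2 / (2 * (2 * \<tau>)))"
      by (simp only: exp_add[symmetric] exp_le_cancel_iff)
    moreover note powr_two_pi_double[OF \<tau>, of "?d / 2"]
    ultimately show ?thesis
      using \<tau> q by (auto simp: \<Gamma>_def gmaj_def gauss_def q_def intro!: ennreal_leI divide_right_mono simp flip: ennreal_mult)
  qed
  show ?thesis
    using \<tau> 1 2 3 by blast
qed

lemma exp_diff_le:
  fixes a b m :: real
  assumes "m \<le> a" "m \<le> b"
  shows "\<bar>exp (- a) - exp (- b)\<bar> \<le> \<bar>a - b\<bar> * exp (- m)"
proof -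
  have *: "\<bar>exp (- a) - exp (- b)\<bar> \<le> \<bar>a - b\<bar> * exp (- m)" if "m \<le> a" "a \<le> b" for a b
  proof -
    have "exp (- a) - exp (- b) = exp (- a) * (1 - exp (- (b - a)))"
      by (simp add: right_diff_distrib flip: exp_add)
    also have "1 - exp (- (b - a)) \<le> b - a"
      using exp_ge_add_one_self[of "- (b - a)"] by linarith
    then have "exp (- a) * (1 - exp (- (b - a))) \<le> exp (- m) * (b - a)"
      using that by (intro mult_mono) auto
    finally show ?thesis using that by (simp add: mult.commute abs_if)
  qed
  show ?thesis
    using *[of a b] *[of b a] assms by (cases "a \<le> b") (auto simp: abs_minus_commute)
qed

text \<open>The mean value estimate gives a factor of order (\<rho>/sqrt s)(1 + |x|/sqrt s);
  widening from s to 4s absorbs the growth in |x|. The gain \<rho>/sqrt s makes wide Gaussians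
  nearly invariant under bounded translations.\<close>

lemma gauss_diff_le:
  fixes x y :: "real ^ 'n::finite"
  assumes y: "norm y \<le> \<rho>" and s: "\<rho>\<^sup>2 \<le> s" "s > 0"
  shows "\<bar>gauss s (x - y) - gauss s x\<bar> \<le> 5 * 2 ^ CARD('n) * \<rho> / sqrt s * gauss (4 * s) x"
proof -
  have \<rho>: "\<rho> \<ge> 0" using y norm_ge_zero order_trans by blast
  have \<rho>s: "\<rho> \<le> sqrt s" using s by (simp add: real_le_rsqrt)
  define u where "u = norm x / sqrt s"
  have u2: "u\<^sup>2 = (norm x)\<^sup>2 / s" using s by (simp add: u_def power_divide)
  have u0: "u \<ge> 0" using s by (simp add: u_def)
  define a where "a = (norm (x - y))\<^sup>2 / (2 * s)"
  define b where "b = (norm x)\<^sup>2 / (2 * s)"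
  have tri: "norm x \<le> norm (x - y) + norm y" "norm (x - y) \<le> norm x + norm y"
    using norm_triangle_ineq[of "x - y" y] norm_triangle_ineq4[of x y] by auto
  have "(norm x)\<^sup>2 \<le> (norm (x - y) + norm y)\<^sup>2" using tri by (intro power_mono) auto
  also have "\<dots> \<le> 2 * (norm (x - y))\<^sup>2 + 2 * (norm y)\<^sup>2"
    using sum_squares_bound[of "norm (x - y)" "norm y"] by (simp add: power2_sum)
  also have "(norm y)\<^sup>2 \<le> s" using y s power_mono[OF y, of 2] by simp
  finally have "(norm x)\<^sup>2 \<le> 2 * (norm (x - y))\<^sup>2 + 2 * s" by simp
  then have "(norm x)\<^sup>2 / (4 * s) \<le> (2 * (norm (x - y))\<^sup>2 + 2 * s) / (4 * s)"
    using s by (intro divide_right_mono) auto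
  \<comment> \<open>With \<open>mb\<close>, a common lower bound for both exponents, as
    \<open>exp_diff_le\<close> requires.\<close>
  then have ma: "u\<^sup>2 / 4 - 1/2 \<le> a" using s by (simp add: u2 a_def add_divide_distrib)
  have mb: "u\<^sup>2 / 4 - 1/2 \<le> b" using s by (simp add: u2 b_def field_simps)
  have ab: "\<bar>a - b\<bar> \<le> \<rho> / sqrt s * (u + 1/2)"
  proof -
    have "\<bar>(norm (x - y))\<^sup>2 - (norm x)\<^sup>2\<bar> = \<bar>norm (x - y) - norm x\<bar> * (norm (x - y) + norm x)"
      by (simp add: power2_eq_square square_diff_square_factored abs_mult mult.commute)
    also have "\<dots> \<le> \<rho> * (2 * norm x + sqrt s)"
      using tri y \<rho>s \<rho> by (intro mult_mono) auto
    finally have "\<bar>a - b\<bar> \<le> \<rho> * (2 * norm x + sqrt s) / (2 * s)"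
      using s by (simp add: a_def b_def divide_right_mono flip: diff_divide_distrib)
    also have "\<dots> = \<rho> * (2 * norm x + sqrt s) / (2 * (sqrt s * sqrt s))" using s by simp
    also have "\<dots> = \<rho> / sqrt s * (u + 1/2)"
      using s unfolding u_def by (simp add: field_simps del: real_sqrt_mult_self)
    finally show ?thesis .
  qed
  \<comment> \<open>Half of the exponent u^2/4 pays for the linear factor; the remaining u^2/8 is
    exactly the exponent of \<open>gauss (4 * s)\<close>.\<close>
  have "u + 1/2 \<le> 5/2 * exp (u\<^sup>2 / 8)"
  proof -
    have "u \<le> 2 * (1 + u\<^sup>2 / 8)" using zero_le_power2[of "u - 2"] by (simp add: power2_diff)
    moreover have "1 + u\<^sup>2 / 8 \<le> exp (u\<^sup>2 / 8)" by (rule exp_ge_add_one_self)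
    moreover have "1 \<le> exp (u\<^sup>2 / 8)" by simp
    moreover have "u + 1/2 \<le> 5/2 * E" if "u \<le> 2 * (1 + u\<^sup>2 / 8)" "1 + u\<^sup>2 / 8 \<le> E" "1 \<le> E" for E :: real
    proof -
      have "u \<le> 2 * E" using that by simp
      then show ?thesis using that(3) by simp
    qed
    ultimately show ?thesis by blast
  qed
  then have "\<rho> / sqrt s * (u + 1/2) \<le> \<rho> / sqrt s * (5/2 * exp (u\<^sup>2 / 8))"
    using \<rho> s by (intro mult_left_mono) auto
  with ab have "\<bar>a - b\<bar> * exp (- (u\<^sup>2 / 4 - 1/2)) \<le> \<rho> / sqrt s * (5/2 * exp (u\<^sup>2 / 8)) * exp (- (u\<^sup>2 / 4 - 1/2))"
    by (intro mult_right_mono) auto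
  also have "\<dots> = \<rho> / sqrt s * (5/2) * exp (1/2) * exp (- (u\<^sup>2 / 8))"
    by (simp add: mult.assoc flip: exp_add)
  also have "\<dots> \<le> \<rho> / sqrt s * (5/2) * 2 * exp (- (u\<^sup>2 / 8))"
    using exp_bound_half[of "1/2 :: real"] \<rho> s by (intro mult_right_mono mult_left_mono) auto
  finally have e: "\<bar>exp (- a) - exp (- b)\<bar> \<le> 5 * (\<rho> / sqrt s) * exp (- (u\<^sup>2 / 8))"
    using exp_diff_le[OF ma mb] by simp
  have pw: "(2 * pi * (4 * s)) powr (real CARD('n) / 2) = 2 ^ CARD('n) * (2 * pi * s) powr (real CARD('n) / 2)"
  proof -
    have "(4 :: real) powr (real CARD('n) / 2) = (2 powr 2) powr (real CARD('n) / 2)" by simp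
    also have "\<dots> = 2 ^ CARD('n)" by (subst powr_powr) (simp add: powr_realpow)
    finally show ?thesis using s powr_mult[of 4 "2 * pi * s" "real CARD('n) / 2"] by (simp add: ac_simps)
  qed
  have "\<bar>gauss s (x - y) - gauss s x\<bar> = \<bar>exp (- a) - exp (- b)\<bar> / (2 * pi * s) powr (real CARD('n) / 2)"
    by (simp add: gauss_def a_def b_def flip: diff_divide_distrib)
  also have "\<dots> \<le> 5 * (\<rho> / sqrt s) * exp (- (u\<^sup>2 / 8)) / (2 * pi * s) powr (real CARD('n) / 2)"
    by (intro divide_right_mono e) auto
  also have "\<dots> = 5 * 2 ^ CARD('n) * \<rho> / sqrt s * gauss (4 * s) x"
    unfolding gauss_def pw u2 using s by (simp add: field_simps)
  finally show ?thesis .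
qed

section \<open>The weighted estimates\<close>

lemma wint_cmult: "w \<in> borel_measurable lebesgue \<Longrightarrow> F \<in> borel_measurable borel \<Longrightarrow>
   wint p w (\<lambda>x. ennreal c * F x) = epowr (ennreal c) p * wint p w F"
proof -
  assume [measurable]: "w \<in> borel_measurable lebesgue" "F \<in> borel_measurable borel"
  have [measurable]: "F \<in> borel_measurable lebesgue" by (simp add: measurable_completion)
  show ?thesis unfolding wint_def by (simp add: epowr_mult mult.assoc nn_integral_cmult)
qed

lemma wint_add_le:
  assumes [measurable]: "w \<in> borel_measurable lebesgue" "F \<in> borel_measurable borel" "G \<in> borel_measurable borel"
    and p: "p \<ge> 1"
  shows "wint p w (\<lambda>x. F x + G x) \<le> ennreal (2 powr p) * (wint p w F + wint p w G)"
proof -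
  have [measurable]: "F \<in> borel_measurable lebesgue" "G \<in> borel_measurable lebesgue"
    by (simp_all add: measurable_completion)
  have "wint p w (\<lambda>x. F x + G x) \<le> (\<integral>\<^sup>+ x. ennreal (2 powr p) * (epowr (F x) p * ennreal (w x) + epowr (G x) p * ennreal (w x)) \<partial>lebesgue)"
    unfolding wint_def distrib_right[symmetric] mult.assoc[symmetric] using p
    by (intro nn_integral_mono mult_right_mono epowr_sum_le) auto
  also have "\<dots> = ennreal (2 powr p) * (wint p w F + wint p w G)"
    unfolding wint_def by (simp add: nn_integral_cmult nn_integral_add)
  finally show ?thesis .
qed

section \<open>Convolution kernels of small oscillation and their Fourier transform\<close>

text \<open>The oscillation condition at the pair (x, 0), with the second argument moved to v. The
  null set N is where a Borel version may differ from the given kernel.\<close>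

definition osc_le :: "(real ^ 'n::finite \<Rightarrow> complex) \<Rightarrow> real \<Rightarrow> real \<Rightarrow> bool" where
  "osc_le g \<delta> \<epsilon> \<longleftrightarrow> (\<exists>\<Omega> N. radial_decr \<Omega> \<and> integral\<^sup>N lborel \<Omega> \<le> ennreal \<epsilon> \<and> (AE x in lborel. x \<notin> N) \<and>
     (\<forall>x v. x \<notin> N \<longrightarrow> x - v \<notin> N \<longrightarrow> 4 * \<delta> \<le> infnorm x \<longrightarrow> infnorm v \<le> \<delta> \<longrightarrow>
       ennreal (norm (g x - g (x - v))) \<le> \<Omega> x))"

locale conv_kernel =
  fixes g :: "real ^ 'n::finite \<Rightarrow> complex" and H :: "real ^ 'n \<Rightarrow> ennreal"
  assumes g_int: "integrable lborel g"
    and H_radial: "radial_decr H"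
    and H_fin: "integral\<^sup>N lborel H < \<top>"
    and g_le_H: "\<And>x. enorm g x \<le> H x"
    and osc: "\<And>\<epsilon>. \<epsilon> > 0 \<Longrightarrow> \<exists>\<delta>0>0. \<forall>\<delta>. 0 < \<delta> \<and> \<delta> \<le> \<delta>0 \<longrightarrow> osc_le g \<delta> \<epsilon>"
begin

lemma g_measurable [measurable]: "g \<in> borel_measurable borel"
  using g_int by (rule integrable_lborel_measurable)

lemma H_measurable [measurable]: "H \<in> borel_measurable borel"
  by (rule radial_decr_measurable[OF H_radial])

definition ghat :: "real ^ 'n \<Rightarrow> complex" where
  "ghat \<xi> = (LINT a|lborel. g a * exp (- (\<i> * of_real (a \<bullet> \<xi>))))"

lemma integrable_g_exp: "integrable lborel (\<lambda>a. g a * exp (- (\<i> * of_real (a \<bullet> \<xi>))))"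
proof (rule Bochner_Integration.integrable_bound[OF g_int])
  show "AE x in lborel. norm (g x * exp (- (\<i> * of_real (x \<bullet> \<xi>)))) \<le> norm (g x)"
    by (auto simp: norm_mult)
qed measurable

text \<open>Measures how far the modulated Gaussian is from being an eigenfunction of T for the
  value \<open>ghat \<xi>\<close>.\<close>

definition defect :: "real \<Rightarrow> real ^ 'n \<Rightarrow> real ^ 'n \<Rightarrow> complex" where
  "defect s \<xi> x = cconv g (cgauss s \<xi>) x - ghat \<xi> * cgauss s \<xi> x"

lemma measurable_defect [measurable]: "defect s \<xi> \<in> borel_measurable borel"
  unfolding defect_def[abs_def] by measurable

text \<open>Both terms carry the same character exp(i (x - a).\<xi>) of modulus 1, so \<xi>
  disappears from the bound. This is the source of the uniformity in the frequency.\<close>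

lemma enorm_defect_le:
  assumes "s > 0"
  shows "enorm (defect s \<xi>) x \<le> (\<integral>\<^sup>+ a. enorm g a * ennreal \<bar>gauss s (x - a) - gauss s x\<bar> \<partial>lborel)"
proof -
  let ?f = "\<lambda>a. g a * cgauss s \<xi> (x - a) - cgauss s \<xi> x * (g a * exp (- (\<i> * of_real (a \<bullet> \<xi>))))"
  have int: "integrable lborel ?f"
    using assms by (intro Bochner_Integration.integrable_diff integrable_mult_right integrable_g_exp integrable_conv g_int nice_cgauss)
  have "defect s \<xi> x = (LINT a|lborel. ?f a)"
    unfolding defect_def cconv_def ghat_def using assms
    by (subst Bochner_Integration.integral_diff)
       (auto intro!: integrable_mult_right integrable_g_exp integrable_conv g_int nice_cgauss simp: mult.commute)
  then have "enorm (defect s \<xi>) x \<le> (\<integral>\<^sup>+ a. ennreal (norm (?f a)) \<partial>lborel)"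
    unfolding enorm_def using integral_norm_bound_ennreal[OF int] by simp
  also have "\<dots> = (\<integral>\<^sup>+ a. enorm g a * ennreal \<bar>gauss s (x - a) - gauss s x\<bar> \<partial>lborel)"
  proof (intro nn_integral_cong)
    fix a
    have "exp (\<i> * of_real ((x - a) \<bullet> \<xi>)) = exp (\<i> * of_real (x \<bullet> \<xi>)) * exp (- (\<i> * of_real (a \<bullet> \<xi>)))"
      by (simp add: inner_diff_left algebra_simps flip: exp_add)
    then have "?f a = g a * of_real (gauss s (x - a) - gauss s x) * (exp (\<i> * of_real (x \<bullet> \<xi>)) * exp (- (\<i> * of_real (a \<bullet> \<xi>))))"
      by (simp add: cgauss_def algebra_simps)
    then have "norm (?f a) = norm (g a) * \<bar>gauss s (x - a) - gauss s x\<bar>"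
      by (simp only: norm_mult norm_of_real norm_exp_i_times norm_exp_eq_Re) simp
    then show "ennreal (norm (?f a)) = enorm g a * ennreal \<bar>gauss s (x - a) - gauss s x\<bar>"
      by (simp add: enorm_def ennreal_mult)
  qed
  finally show ?thesis .
qed

text \<open>For a in a bounded box, translating a wide Gaussian by a hardly changes it; outside the
  box g has a radial majorant of small integral. The choice of s does not involve \<xi>.\<close>

lemma enorm_defect_small:
  assumes \<eta>: "\<eta> > 0"
  shows "\<exists>s>0. \<exists>G2. dominated G2 \<eta> \<and>
    (\<forall>\<xi> x. enorm (defect s \<xi>) x \<le> ennreal \<eta> * ennreal (gauss (4 * s) x)
       + (nconv G2 (\<lambda>y. ennreal (gauss s y)) x + ennreal \<eta> * ennreal (gauss s x)))"
proof -
  obtain \<rho> H' where \<rho>: "\<rho> > 0" and H': "radial_decr H'" "integral\<^sup>N lborel H' \<le> ennreal \<eta>"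
    "\<And>x. infnorm x > \<rho> \<Longrightarrow> H x \<le> H' x"
    using radial_tail[OF H_radial H_fin \<eta>] by blast
  define G2 where "G2 x = enorm g x * indicator {x. infnorm x > \<rho>} x" for x
  have [measurable]: "G2 \<in> borel_measurable borel" unfolding G2_def[abs_def] by measurable
  have "G2 x \<le> H' x" for x
    using order_trans[OF g_le_H H'(3)] by (auto simp: G2_def indicator_def)
  then have G2: "dominated G2 \<eta>" using H' by (auto simp: dominated_def)
  obtain L where L: "(\<integral>\<^sup>+ x. enorm g x \<partial>lborel) = ennreal L" "L \<ge> 0"
    using nn_integral_enorm_less_top[OF g_int] by (cases "\<integral>\<^sup>+ x. enorm g x \<partial>lborel") auto
  define r where "r = sqrt (real CARD('n)) * \<rho>"
  have r: "r > 0" using \<rho> by (simp add: r_def)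
  \<comment> \<open>The first entry makes \<open>gauss_diff_le\<close> applicable, the second makes
    L times its factor at most \<eta>. The Euclidean ball of radius r contains the box of radius
    \<rho>.\<close>
  define s where "s = max (r\<^sup>2) ((L * (5 * 2 ^ CARD('n) * r) / \<eta>)\<^sup>2)"
  have rs: "r\<^sup>2 \<le> s" by (simp add: s_def)
  have s: "s > 0" using r rs by (smt (verit) zero_less_power)
  have Ls: "L * (5 * 2 ^ CARD('n) * r / sqrt s) \<le> \<eta>"
  proof -
    have "L * (5 * 2 ^ CARD('n) * r) / \<eta> \<le> sqrt s"
      by (rule real_le_rsqrt) (simp add: s_def)
    then show ?thesis using \<eta> s by (simp add: field_simps)
  qed
  have "enorm (defect s \<xi>) x \<le> ennreal \<eta> * ennreal (gauss (4 * s) x)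
       + (nconv G2 (\<lambda>y. ennreal (gauss s y)) x + ennreal \<eta> * ennreal (gauss s x))" for \<xi> x
  proof -
    have pt: "enorm g a * ennreal \<bar>gauss s (x - a) - gauss s x\<bar> \<le>
       enorm g a * ennreal (5 * 2 ^ CARD('n) * r / sqrt s * gauss (4 * s) x)
       + (G2 a * ennreal (gauss s (x - a)) + G2 a * ennreal (gauss s x))" for a
    proof (cases "infnorm a > \<rho>")
      case True
      have "ennreal \<bar>gauss s (x - a) - gauss s x\<bar> \<le> ennreal (gauss s (x - a)) + ennreal (gauss s x)"
        by (simp add: abs_le_iff algebra_simps flip: ennreal_plus)
      then have "G2 a * ennreal \<bar>gauss s (x - a) - gauss s x\<bar> \<le> G2 a * ennreal (gauss s (x - a)) + G2 a * ennreal (gauss s x)"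
        by (simp add: mult_left_mono flip: distrib_left)
      then show ?thesis using True by (simp add: G2_def add_increasing)
    next
      case False
      have "norm a \<le> sqrt (real CARD('n)) * infnorm a" using norm_le_infnorm[of a] by simp
      also have "\<dots> \<le> r" unfolding r_def using False by (intro mult_left_mono) auto
      finally have "\<bar>gauss s (x - a) - gauss s x\<bar> \<le> 5 * 2 ^ CARD('n) * r / sqrt s * gauss (4 * s) x"
        by (rule gauss_diff_le) (use s rs in auto)
      then have "enorm g a * ennreal \<bar>gauss s (x - a) - gauss s x\<bar> \<le> enorm g a * ennreal (5 * 2 ^ CARD('n) * r / sqrt s * gauss (4 * s) x)"
        by (intro mult_left_mono ennreal_leI) auto
      then show ?thesis by (rule order_trans) (rule add_increasing2, auto)
    qed
    have "enorm (defect s \<xi>) x \<le> (\<integral>\<^sup>+ a. enorm g a * ennreal (5 * 2 ^ CARD('n) * r / sqrt s * gauss (4 * s) x)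
       + (G2 a * ennreal (gauss s (x - a)) + G2 a * ennreal (gauss s x)) \<partial>lborel)"
      by (rule order_trans[OF enorm_defect_le[OF s]]) (intro nn_integral_mono pt)
    also have "\<dots> = ennreal L * ennreal (5 * 2 ^ CARD('n) * r / sqrt s * gauss (4 * s) x)
       + (nconv G2 (\<lambda>y. ennreal (gauss s y)) x + integral\<^sup>N lborel G2 * ennreal (gauss s x))"
      by (simp add: nn_integral_add nn_integral_multc nconv_def L)
    also have "\<dots> \<le> ennreal \<eta> * ennreal (gauss (4 * s) x)
       + (nconv G2 (\<lambda>y. ennreal (gauss s y)) x + ennreal \<eta> * ennreal (gauss s x))"
    proof (intro add_mono mult_right_mono order.refl)
      show "integral\<^sup>N lborel G2 \<le> ennreal \<eta>" by (rule dominated_nn_integral_le[OF G2])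
      have "L * (5 * 2 ^ CARD('n) * r / sqrt s * gauss (4 * s) x) \<le> \<eta> * gauss (4 * s) x"
        using mult_right_mono[OF Ls gauss_nonneg] by (simp add: mult.assoc)
      then show "ennreal L * ennreal (5 * 2 ^ CARD('n) * r / sqrt s * gauss (4 * s) x) \<le> ennreal \<eta> * ennreal (gauss (4 * s) x)"
        using L r \<eta> s by (simp add: ennreal_leI flip: ennreal_mult)
    qed auto
    finally show ?thesis .
  qed
  then show ?thesis using s G2 by blast
qed

text \<open>The kernel of the part of T that is lost when its argument is smoothed at scale
  \<tau>.\<close>

definition residual :: "real \<Rightarrow> real ^ 'n \<Rightarrow> complex" where
  "residual \<tau> x = g x - cconv g (cgauss \<tau> 0) x"

lemma measurable_residual [measurable]: "residual \<tau> \<in> borel_measurable borel"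
  unfolding residual_def[abs_def] by measurable

lemma enorm_residual_le:
  assumes \<tau>: "\<tau> > 0"
  shows "enorm (residual \<tau>) x \<le> (\<integral>\<^sup>+ a. ennreal (gauss \<tau> a) * ennreal (norm (g x - g (x - a))) \<partial>lborel)"
proof -
  let ?f = "\<lambda>a. of_real (gauss \<tau> a) * (g x - g (x - a))"
  have eq: "cgauss \<tau> 0 = (\<lambda>a. of_real (gauss \<tau> a))"
    by (auto simp: cgauss_def)
  have i1: "integrable lborel (\<lambda>a. of_real (gauss \<tau> a) * g x)"
    using integrable_gauss[OF \<tau>] by (intro integrable_mult_left) auto
  have i2: "integrable lborel (\<lambda>a. of_real (gauss \<tau> a) * g (x - a))"
  proof -
    have "integrable lborel (\<lambda>a. g a * cgauss \<tau> 0 (x - a))"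
      by (rule integrable_conv[OF g_int nice_cgauss[OF \<tau>]])
    then have "integrable lborel (\<lambda>a. g (x - a) * cgauss \<tau> 0 (x - (x - a)))"
      by (rule integrable_reflect)
    then show ?thesis by (simp add: eq mult.commute)
  qed
  have "cconv g (cgauss \<tau> 0) x = (LINT a|lborel. of_real (gauss \<tau> a) * g (x - a))"
    by (subst cconv_commute) (simp_all add: cconv_def eq)
  \<comment> \<open>The Gaussian has mass 1, so g x is its own average against it.\<close>
  moreover have "g x = (LINT (a :: real ^ 'n)|lborel. of_real (gauss \<tau> a) * g x)"
  proof -
    have "(LINT a|lborel. gauss \<tau> (a :: real ^ 'n)) = 1" by (rule integral_gauss[OF \<tau>])
    then show ?thesis by simp
  qed
  ultimately have "residual \<tau> x = (LINT a|lborel. ?f a)"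
    unfolding residual_def right_diff_distrib using i1 i2
    by (subst Bochner_Integration.integral_diff) auto
  moreover have "integrable lborel ?f"
    unfolding right_diff_distrib using i1 i2 by (rule Bochner_Integration.integrable_diff)
  ultimately have "enorm (residual \<tau>) x \<le> (\<integral>\<^sup>+ a. ennreal (norm (?f a)) \<partial>lborel)"
    unfolding enorm_def using integral_norm_bound_ennreal by metis
  then show ?thesis by (simp add: norm_mult ennreal_mult)
qed

text \<open>Shifts longer than \<delta> fall under the Gaussian tail. For short shifts the
  oscillation bound serves |x| \<ge> 4\<delta>, while closer to the origin, where oscillation is not
  controlled, g has small mass.\<close>

lemma enorm_residual_small:
  assumes \<eta>: "\<eta> > 0"
  shows "\<exists>\<tau>>0. \<exists>\<Omega> Ga Gg. dominated \<Omega> \<eta> \<and> dominated Ga \<eta> \<and> dominated Gg \<eta>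
    \<and> (AE x in lborel. enorm (residual \<tau>) x \<le> \<Omega> x + (Ga x + (nconv (\<lambda>a. ennreal (gauss \<tau> a)) Ga x
         + (ennreal \<eta> * enorm g x + nconv Gg (enorm g) x))))"
proof -
  obtain \<delta>1 where \<delta>1: "\<delta>1 > 0" and os: "\<And>\<delta>. 0 < \<delta> \<Longrightarrow> \<delta> \<le> \<delta>1 \<Longrightarrow> osc_le g \<delta> \<eta>"
    using osc[OF \<eta>] by blast
  obtain \<delta>2 where \<delta>2: "\<delta>2 > 0" "(\<integral>\<^sup>+ x. H x * indicator (box0 \<delta>2) x \<partial>lborel) \<le> ennreal \<eta>"
    using radial_near_zero[OF H_radial H_fin \<eta>] by blast
  \<comment> \<open>If |x| < 4\<delta> and |a| \<le> \<delta>, then x and x - a both lie within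
    5\<delta> \<le> \<delta>2, the region of small mass.\<close>
  define \<delta> where "\<delta> = min \<delta>1 (\<delta>2 / 5)"
  have \<delta>: "\<delta> > 0" "\<delta> \<le> \<delta>1" "5 * \<delta> \<le> \<delta>2" using \<delta>1 \<delta>2 by (auto simp: \<delta>_def)
  obtain \<Omega> N where \<Omega>: "radial_decr \<Omega>" "integral\<^sup>N lborel \<Omega> \<le> ennreal \<eta>" and N: "AE x in lborel. x \<notin> N"
    and gN: "\<And>x v. x \<notin> N \<Longrightarrow> x - v \<notin> N \<Longrightarrow> 4 * \<delta> \<le> infnorm x \<Longrightarrow> infnorm v \<le> \<delta> \<Longrightarrow> ennreal (norm (g x - g (x - v))) \<le> \<Omega> x"
    using os[OF \<delta>(1,2)] unfolding osc_le_def by blast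
  obtain \<tau> \<Gamma> where \<tau>: "\<tau> > 0" and \<Gamma>: "radial_decr \<Gamma>" "integral\<^sup>N lborel \<Gamma> \<le> ennreal \<eta>"
    "\<And>x :: real ^ 'n. infnorm x > \<delta> \<Longrightarrow> ennreal (gauss \<tau> x) \<le> \<Gamma> x"
    using gauss_tail[OF \<delta>(1) \<eta>] by blast
  define Ga where "Ga x = enorm g x * indicator (box0 \<delta>2) x" for x
  define Gg where "Gg x = ennreal (gauss \<tau> x) * indicator {x. infnorm x > \<delta>} x" for x :: "real ^ 'n"
  have [measurable]: "Ga \<in> borel_measurable borel" "Gg \<in> borel_measurable borel"
    unfolding Ga_def[abs_def] Gg_def[abs_def] by measurable
  have [measurable]: "\<Omega> \<in> borel_measurable borel" by (rule radial_decr_measurable[OF \<Omega>(1)])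
  let ?g = "\<lambda>a. ennreal (gauss \<tau> a)"
  let ?R = "\<lambda>x. \<Omega> x + (Ga x + (nconv ?g Ga x + (ennreal \<eta> * enorm g x + nconv Gg (enorm g) x)))"
  let ?P = "\<lambda>x a. ?g a * \<Omega> x + (?g a * Ga x + (?g a * Ga (x - a) + (Gg a * enorm g x + Gg a * enorm g (x - a))))"
  have "Ga x \<le> H x * indicator (box0 \<delta>2) x" for x unfolding Ga_def by (intro mult_right_mono g_le_H) auto
  then have Ga: "dominated Ga \<eta>"
    unfolding dominated_def using radial_decr_indicator[OF H_radial] \<delta>2
    by (intro conjI exI[of _ "\<lambda>x. H x * indicator (box0 \<delta>2) x"]) auto
  have "Gg x \<le> \<Gamma> x" for x unfolding Gg_def using \<Gamma>(3)[of x] by (auto simp: indicator_def)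
  then have Gg: "dominated Gg \<eta>" using \<Gamma> by (auto simp: dominated_def)
  have \<Omega>d: "dominated \<Omega> \<eta>" using \<Omega> by (auto simp: dominated_def)
  have "AE x in lborel. enorm (residual \<tau>) x \<le> ?R x"
    using N
  proof eventually_elim
    case (elim x)
    have tri: "ennreal (norm (g x - g (x - a))) \<le> enorm g x + enorm g (x - a)" for a
      unfolding enorm_def by (simp add: norm_triangle_ineq4 ennreal_leI flip: ennreal_plus)
    have pt: "?g a * ennreal (norm (g x - g (x - a))) \<le>
      ?P x a" if "x - a \<notin> N" for a
    proof (cases "infnorm a > \<delta>")
      case True
      then have "?g a * ennreal (norm (g x - g (x - a))) \<le> Gg a * enorm g x + Gg a * enorm g (x - a)"
        unfolding Gg_def by (simp add: mult_left_mono tri flip: distrib_left)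
      then show ?thesis by (simp add: add_increasing)
    next
      case small: False
      show ?thesis
      proof (cases "infnorm x \<ge> 4 * \<delta>")
        case True
        then have "?g a * ennreal (norm (g x - g (x - a))) \<le> ennreal (gauss \<tau> a) * \<Omega> x"
          using small that elim by (intro mult_left_mono gN) auto
        then show ?thesis by (simp add: add_increasing2)
      next
        case False
        have "infnorm (x - a) \<le> infnorm x + infnorm a"
          using infnorm_triangle[of x "- a"] by (simp add: infnorm_neg)
        then have "Ga x = enorm g x" "Ga (x - a) = enorm g (x - a)"
          using False small \<delta> unfolding Ga_def by auto
        then have "?g a * ennreal (norm (g x - g (x - a))) \<le> ennreal (gauss \<tau> a) * Ga x + ennreal (gauss \<tau> a) * Ga (x - a)"
          by (simp add: mult_left_mono tri flip: distrib_left)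
        also have "\<dots> \<le> ?P x a"
          by (intro add_increasing add_left_mono add_increasing2) auto
        finally show ?thesis .
      qed
    qed
    have "enorm (residual \<tau>) x \<le> (\<integral>\<^sup>+ a. ?P x a \<partial>lborel)"
      by (rule order_trans[OF enorm_residual_le[OF \<tau>]], rule nn_integral_mono_AE,
          rule AE_mp[OF AE_lborel_reflect[OF N, of x]]) (intro AE_I2 impI pt)
    also have "\<dots> = \<Omega> x + (Ga x + (nconv (\<lambda>a. ennreal (gauss \<tau> a)) Ga x
         + (integral\<^sup>N lborel Gg * enorm g x + nconv Gg (enorm g) x)))"
      by (simp add: nn_integral_add nn_integral_multc nconv_def nn_integral_gauss[OF \<tau>])
    also have "\<dots> \<le> ?R x"
      using dominated_nn_integral_le[OF Gg] by (intro add_mono mult_right_mono order.refl) auto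
    finally show ?case .
  qed
  then show ?thesis using \<tau> \<Omega>d Ga Gg by blast
qed

text \<open>Shifting by \<open>v = (pi / (norm \<xi>)\<^sup>2) *\<^sub>R \<xi>\<close> changes the sign of the exponential, so \<open>2 * ghat \<xi>\<close> is a Fourier integral of \<open>g a - g (a - v)\<close>.\<close>

lemma ghat_tendsto_0:
  assumes \<epsilon>: "\<epsilon> > 0"
  shows "\<exists>R>0. \<forall>\<xi>. norm \<xi> \<ge> R \<longrightarrow> norm (ghat \<xi>) \<le> \<epsilon>"
proof -
  \<comment> \<open>Three errors of size \<eta> bound 2 |ghat|, and 3\<eta>/2 < \<epsilon>.\<close>
  define \<eta> where "\<eta> = \<epsilon> / 2"
  have \<eta>: "\<eta> > 0" using \<epsilon> by (simp add: \<eta>_def)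
  obtain \<delta>1 where \<delta>1: "\<delta>1 > 0" and os: "\<And>\<delta>. 0 < \<delta> \<Longrightarrow> \<delta> \<le> \<delta>1 \<Longrightarrow> osc_le g \<delta> \<eta>"
    using osc[OF \<eta>] by blast
  obtain \<delta>2 where \<delta>2: "\<delta>2 > 0" "(\<integral>\<^sup>+ x. H x * indicator (box0 \<delta>2) x \<partial>lborel) \<le> ennreal \<eta>"
    using radial_near_zero[OF H_radial H_fin \<eta>] by blast
  define \<delta> where "\<delta> = min \<delta>1 (\<delta>2 / 5)"
  have \<delta>: "\<delta> > 0" "\<delta> \<le> \<delta>1" "5 * \<delta> \<le> \<delta>2" using \<delta>1 \<delta>2 by (auto simp: \<delta>_def)
  obtain \<Omega> N where \<Omega>: "radial_decr \<Omega>" "integral\<^sup>N lborel \<Omega> \<le> ennreal \<eta>" and N: "AE x in lborel. x \<notin> N"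
    and gN: "\<And>x v. x \<notin> N \<Longrightarrow> x - v \<notin> N \<Longrightarrow> 4 * \<delta> \<le> infnorm x \<Longrightarrow> infnorm v \<le> \<delta> \<Longrightarrow> ennreal (norm (g x - g (x - v))) \<le> \<Omega> x"
    using os[OF \<delta>(1,2)] unfolding osc_le_def by blast
  define Ga where "Ga x = H x * indicator (box0 \<delta>2) x" for x
  have [measurable]: "Ga \<in> borel_measurable borel" unfolding Ga_def[abs_def] by measurable
  have [measurable]: "\<Omega> \<in> borel_measurable borel" by (rule radial_decr_measurable[OF \<Omega>(1)])
  show ?thesis
  \<comment> \<open>The shift v has length pi/|\<xi>|, which is at most \<delta> from this radius
    on.\<close>
  proof (intro exI[of _ "pi / \<delta>"] conjI allI impI)
    fix \<xi> :: "real ^ 'n" assume \<xi>: "norm \<xi> \<ge> pi / \<delta>"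
    then have \<xi>0: "norm \<xi> > 0" using \<delta> by (smt (verit) divide_pos_pos pi_gt_zero)
    define v where "v = (pi / (norm \<xi>)\<^sup>2) *\<^sub>R \<xi>"
    have v\<xi>: "v \<bullet> \<xi> = pi" using \<xi>0 by (simp add: v_def power2_norm_eq_inner[symmetric])
    have "norm v = pi / norm \<xi>" using \<xi>0 by (simp add: v_def power2_eq_square)
    also have "\<dots> \<le> \<delta>" using \<xi> \<xi>0 \<delta> by (simp add: field_simps)
    finally have v: "infnorm v \<le> \<delta>" using infnorm_le_norm[of v] by linarith
    define e where "e a = exp (- (\<i> * of_real (a \<bullet> \<xi>)))" for a
    have e: "norm (e a) = 1" for a by (simp add: e_def)
    have [measurable]: "e \<in> borel_measurable borel" unfolding e_def[abs_def] by measurable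
    have int: "integrable lborel (\<lambda>a. g a * e a)" unfolding e_def by (rule integrable_g_exp)
    have ev: "e (a - v) = - e a" for a
    proof -
      have "- (\<i> * of_real ((a - v) \<bullet> \<xi>)) = - (\<i> * of_real (a \<bullet> \<xi>)) + \<i> * complex_of_real pi"
        by (simp add: inner_diff_left v\<xi> algebra_simps)
      then have "e (a - v) = e a * exp (\<i> * complex_of_real pi)"
        by (simp only: e_def exp_add)
      then show ?thesis by (simp only: exp_pi_i' mult_minus_right mult_1_right)
    qed
    have sh: "integrable lborel (\<lambda>a. g (a - v) * e (a - v))" "(LINT a|lborel. g (a - v) * e (a - v)) = ghat \<xi>"
    proof -
      have 1: "integrable lborel (\<lambda>a. g (0 - a) * e (0 - a))" by (rule integrable_reflect[OF int])
      from integrable_reflect[OF 1, of v] show "integrable lborel (\<lambda>a. g (a - v) * e (a - v))" by simp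
      have "(LINT a|lborel. g (a - v) * e (a - v)) = (LINT a|lborel. g (0 - a) * e (0 - a))"
        using integral_reflect[of "\<lambda>a. g (0 - a) * e (0 - a)" v] by simp
      also have "\<dots> = ghat \<xi>"
        using integral_reflect[of "\<lambda>a. g a * e a" 0] by (simp add: ghat_def e_def)
      finally show "(LINT a|lborel. g (a - v) * e (a - v)) = ghat \<xi>" .
    qed
    have sum: "2 * ghat \<xi> = (LINT a|lborel. (g a - g (a - v)) * e a)" "integrable lborel (\<lambda>a. (g a - g (a - v)) * e a)"
    proof -
      have "(\<lambda>a. (g a - g (a - v)) * e a) = (\<lambda>a. g a * e a + g (a - v) * e (a - v))"
        by (simp add: ev algebra_simps)
      then show "2 * ghat \<xi> = (LINT a|lborel. (g a - g (a - v)) * e a)" "integrable lborel (\<lambda>a. (g a - g (a - v)) * e a)"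
        using int sh by (simp_all add: ghat_def e_def)
    qed
    have "ennreal (norm (2 * ghat \<xi>)) \<le> (\<integral>\<^sup>+ a. ennreal (norm ((g a - g (a - v)) * e a)) \<partial>lborel)"
      unfolding sum(1) by (rule integral_norm_bound_ennreal[OF sum(2)])
    also have "\<dots> \<le> (\<integral>\<^sup>+ a. \<Omega> a + (Ga a + Ga (a - v)) \<partial>lborel)"
    proof (rule nn_integral_mono_AE, use N AE_lborel_shift[OF N, of v] in eventually_elim)
      fix a assume a: "a \<notin> N" "a - v \<notin> N"
      show "ennreal (norm ((g a - g (a - v)) * e a)) \<le> \<Omega> a + (Ga a + Ga (a - v))"
      proof (cases "infnorm a \<ge> 4 * \<delta>")
        case True
        then show ?thesis using gN[OF a True v] by (simp add: norm_mult e add_increasing2)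
      next
        case False
        have "infnorm (a - v) \<le> infnorm a + infnorm v"
          using infnorm_triangle[of a "- v"] by (simp add: infnorm_neg)
        then have *: "Ga a = H a" "Ga (a - v) = H (a - v)" using False v \<delta> by (auto simp: Ga_def)
        have "ennreal (norm (g a - g (a - v))) \<le> enorm g a + enorm g (a - v)"
          unfolding enorm_def by (simp add: norm_triangle_ineq4 ennreal_leI flip: ennreal_plus)
        also have "\<dots> \<le> Ga a + Ga (a - v)" unfolding * by (intro add_mono g_le_H)
        finally show ?thesis by (simp add: norm_mult e add_increasing)
      qed
    qed
    also have "\<dots> = integral\<^sup>N lborel \<Omega> + (integral\<^sup>N lborel Ga + integral\<^sup>N lborel Ga)"
      by (simp add: nn_integral_add nn_integral_shift)
    also have "\<dots> \<le> ennreal \<eta> + (ennreal \<eta> + ennreal \<eta>)"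
      using \<Omega>(2) \<delta>2(2) by (intro add_mono) (simp_all add: Ga_def[abs_def])
    finally have "norm (2 * ghat \<xi>) \<le> 3 * \<eta>" using \<eta> by (simp flip: ennreal_plus)
    then show "norm (ghat \<xi>) \<le> \<epsilon>" using \<epsilon> by (simp add: norm_mult \<eta>_def)
  qed (use \<delta> in auto)
qed

lemma continuous_ghat: "continuous_on UNIV ghat"
  unfolding continuous_on_def
proof (intro ballI, unfold tendsto_at_iff_sequentially comp_def, intro allI impI)
  fix \<xi> and X :: "nat \<Rightarrow> real ^ 'n"
  assume X: "X \<longlonglongrightarrow> \<xi>"
  show "(\<lambda>i. ghat (X i)) \<longlonglongrightarrow> ghat \<xi>"
    unfolding ghat_def
  proof (rule integral_dominated_convergence[where w = "\<lambda>a. norm (g a)"])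
    show "AE a in lborel. (\<lambda>i. g a * exp (- (\<i> * of_real (a \<bullet> X i)))) \<longlonglongrightarrow> g a * exp (- (\<i> * of_real (a \<bullet> \<xi>)))"
      by (intro AE_I2 tendsto_intros X)
  qed (use g_int in \<open>auto simp: norm_mult\<close>)
qed

text \<open>Compactness on a ball where the distance is positive; outside it |ghat| \<le> |z|/2, and
  the distance is at least |z|/2 > 0.\<close>

lemma ghat_away:
  assumes z: "z \<noteq> 0" "\<And>\<xi>. z \<noteq> ghat \<xi>"
  shows "\<exists>c>0. \<forall>\<xi>. c \<le> norm (z - ghat \<xi>)"
proof -
  obtain R where R: "R > 0" "\<And>\<xi>. norm \<xi> \<ge> R \<Longrightarrow> norm (ghat \<xi>) \<le> norm z / 2"
    using ghat_tendsto_0[of "norm z / 2"] z by auto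
  have "continuous_on (cball 0 R) (\<lambda>\<xi>. norm (z - ghat \<xi>))"
    by (intro continuous_intros continuous_on_subset[OF continuous_ghat]) auto
  then obtain \<xi>0 where \<xi>0: "\<And>\<xi>. norm \<xi> \<le> R \<Longrightarrow> norm (z - ghat \<xi>0) \<le> norm (z - ghat \<xi>)"
    using continuous_attains_inf[of "cball 0 R" "\<lambda>\<xi>. norm (z - ghat \<xi>)"] R
    by (metis compact_cball centre_in_cball empty_iff less_imp_le mem_cball_0)
  define c where "c = min (norm (z - ghat \<xi>0)) (norm z / 2)"
  have "c \<le> norm (z - ghat \<xi>)" for \<xi>
  proof (cases "norm \<xi> \<le> R")
    case False
    then have "norm z / 2 \<le> norm (z - ghat \<xi>)"
      using R(2)[of \<xi>] norm_triangle_ineq2[of z "ghat \<xi>"] by simp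
    then show ?thesis by (simp add: c_def)
  next
    case True
    then show ?thesis using \<xi>0[of \<xi>] by (simp add: c_def min.coboundedI1)
  qed
  moreover have "c > 0" using z by (simp add: c_def)
  ultimately show ?thesis by blast
qed

end

lemma ennreal_mult_mult: "0 \<le> a \<Longrightarrow> 0 \<le> b \<Longrightarrow> ennreal a * (ennreal b * X) = ennreal (a * b) * X"
  by (simp add: ennreal_mult mult.assoc)

section \<open>Operator bounds on the weighted space\<close>

text \<open>K is one constant for all majorants, as \<open>wint_nconv_le\<close> supplies. Local
  integrability \<open>w_loc\<close> will give Gaussians finite norm.\<close>

locale weighted_kernel = conv_kernel g H for g :: "real ^ 'n::finite \<Rightarrow> complex" and H +
  fixes p K :: real and w :: "real ^ 'n \<Rightarrow> real"
  assumes p: "p \<ge> 1" and w_measurable [measurable]: "w \<in> borel_measurable lebesgue" and w_pos: "\<And>x. w x > 0"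
    and w_loc: "(\<integral>\<^sup>+ x. indicator (box0 1) x * ennreal (w x) \<partial>lebesgue) < \<top>"
    and K: "K \<ge> 0"
    and bound: "\<And>H' F. F \<in> borel_measurable borel \<Longrightarrow> radial_decr H' \<Longrightarrow> integral\<^sup>N lborel H' < \<top> \<Longrightarrow>
      wint p w (nconv H' F) \<le> ennreal K * epowr (integral\<^sup>N lborel H') p * wint p w F"
begin

text \<open>The base of the power is the bound for the mass of \<open>gmaj\<close>, so one constant
  serves Gaussians of every variance.\<close>

definition Dg :: real where "Dg = K * (real CARD('n) powr (real CARD('n) / 2)) powr p"

definition Nt :: real where "Nt = K * enn2real (integral\<^sup>N lborel H) powr p"

abbreviation Wn :: "(real ^ 'n \<Rightarrow> complex) \<Rightarrow> ennreal" where
  "Wn f \<equiv> wint p w (enorm f)"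

lemma Dg_nonneg: "Dg \<ge> 0" and Nt_nonneg: "Nt \<ge> 0"
  using K by (auto simp: Dg_def Nt_def)

lemma op_bound:
  assumes F: "F \<in> borel_measurable borel" and U: "dominated U c" and c: "c \<ge> 0"
  shows "wint p w (nconv U F) \<le> ennreal (K * c powr p) * wint p w F"
proof -
  obtain H' where H': "radial_decr H'" "integral\<^sup>N lborel H' \<le> ennreal c" "\<And>x. U x \<le> H' x"
    using U by (auto simp: dominated_def)
  have "wint p w (nconv U F) \<le> wint p w (nconv H' F)"
    using p H'(3) by (intro wint_mono) (auto simp: nconv_def intro!: nn_integral_mono mult_right_mono)
  also have "\<dots> \<le> ennreal K * epowr (integral\<^sup>N lborel H') p * wint p w F"
    using H' by (intro bound F) (auto intro: le_less_trans)
  also have "\<dots> \<le> ennreal K * epowr (ennreal c) p * wint p w F"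
    using p H' by (intro mult_right_mono mult_left_mono epowr_mono) auto
  also have "\<dots> = ennreal (K * c powr p) * wint p w F"
    using c K by (simp add: epowr_ennreal ennreal_mult)
  finally show ?thesis .
qed

lemma gauss_bound:
  assumes "F \<in> borel_measurable borel" "s > 0"
  shows "wint p w (nconv (\<lambda>x. ennreal (gauss s x)) F) \<le> ennreal Dg * wint p w F"
  unfolding Dg_def using assms
  by (intro op_bound) (auto simp: dominated_def intro!: exI[of _ "gmaj s"] radial_decr_gmaj nn_integral_gmaj_le gauss_le_gmaj)

lemma g_bound:
  assumes "F \<in> borel_measurable borel"
  shows "wint p w (nconv (enorm g) F) \<le> ennreal Nt * wint p w F"
  unfolding Nt_def using assms H_fin
  by (intro op_bound) (auto simp: dominated_def intro!: exI[of _ H] H_radial g_le_H)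

lemma wint_add_bound:
  assumes "F \<in> borel_measurable borel" "G \<in> borel_measurable borel" "a \<ge> 0" "b \<ge> 0"
    and "wint p w F \<le> ennreal a * J" "wint p w G \<le> ennreal b * J"
  shows "wint p w (\<lambda>x. F x + G x) \<le> ennreal (2 powr p * (a + b)) * J"
proof -
  have "wint p w (\<lambda>x. F x + G x) \<le> ennreal (2 powr p) * (wint p w F + wint p w G)"
    using assms p by (intro wint_add_le) auto
  also have "\<dots> \<le> ennreal (2 powr p) * (ennreal a * J + ennreal b * J)"
    using assms by (intro mult_left_mono add_mono) auto
  also have "\<dots> = ennreal (2 powr p * (a + b)) * J"
    using assms by (simp add: ennreal_mult ennreal_plus distrib_right distrib_left mult.assoc)
  finally show ?thesis .
qed

lemma wint_cmult_bound:
  assumes "F \<in> borel_measurable borel" "c \<ge> 0" "a \<ge> 0" "wint p w F \<le> ennreal a * J"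
  shows "wint p w (\<lambda>x. ennreal c * F x) \<le> ennreal (c powr p * a) * J"
  using assms by (simp add: wint_cmult epowr_ennreal ennreal_mult mult.assoc mult_left_mono)

lemma wint_trans:
  assumes "wint p w F \<le> ennreal a * wint p w G" "wint p w G \<le> ennreal b * J" "a \<ge> 0" "b \<ge> 0"
  shows "wint p w F \<le> ennreal (a * b) * J"
  using order_trans[OF assms(1) mult_left_mono[OF assms(2)]] assms by (simp add: ennreal_mult mult.assoc)

text \<open>Small kernels enter the estimates as \<eta>^p, with Q collecting all other constants; Q
  + 1 in the witness covers Q = 0.\<close>

lemma small_power:
  assumes "\<theta> > 0" "Q \<ge> 0"
  obtains \<eta> :: real where "\<eta> > 0" "Q * \<eta> powr p \<le> \<theta>"
proof
  show "(\<theta> / (Q + 1)) powr (1 / p) > 0" using assms by simp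
  show "Q * ((\<theta> / (Q + 1)) powr (1 / p)) powr p \<le> \<theta>"
    using assms p by (simp add: powr_powr field_simps)
qed

lemma nconv_add_left:
  assumes [measurable]: "A \<in> borel_measurable borel" "B \<in> borel_measurable borel" "F \<in> borel_measurable borel"
  shows "nconv (\<lambda>x. A x + B x) F = (\<lambda>x. nconv A F x + nconv B F x)"
  by (simp add: nconv_def distrib_right nn_integral_add fun_eq_iff)

lemma nconv_cmult_left:
  assumes [measurable]: "A \<in> borel_measurable borel" "F \<in> borel_measurable borel"
  shows "nconv (\<lambda>x. c * A x) F = (\<lambda>x. c * nconv A F x)"
  by (simp add: nconv_def mult.assoc nn_integral_cmult fun_eq_iff)

text \<open>Each term of the pointwise majorant is a convolution already bounded; s serves all \<xi>
  because that majorant is free of \<xi>.\<close>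

lemma defect_bound:
  assumes \<theta>: "\<theta> > 0"
  shows "\<exists>s>0. \<forall>\<xi>. \<forall>F \<in> borel_measurable borel. wint p w (nconv (enorm (defect s \<xi>)) F) \<le> ennreal \<theta> * wint p w F"
proof -
  define Q where "Q = 2 powr p * (Dg + 2 powr p * (K * Dg + Dg))"
  have Q: "Q \<ge> 0" using Dg_nonneg K by (simp add: Q_def)
  obtain \<eta> where \<eta>: "\<eta> > 0" "Q * \<eta> powr p \<le> \<theta>" using small_power[OF \<theta> Q] by blast
  obtain s G2 where s: "s > 0" and G2: "dominated G2 \<eta>"
    and le: "\<And>\<xi> x. enorm (defect s \<xi>) x \<le> ennreal \<eta> * ennreal (gauss (4 * s) x)
       + (nconv G2 (\<lambda>y. ennreal (gauss s y)) x + ennreal \<eta> * ennreal (gauss s x))"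
    using enorm_defect_small[OF \<eta>(1)] by blast
  have [measurable]: "G2 \<in> borel_measurable borel" using G2 by measurable
  show ?thesis
  proof (intro exI[of _ s] conjI allI ballI s)
    fix \<xi> and F :: "real ^ 'n \<Rightarrow> ennreal" assume F [measurable]: "F \<in> borel_measurable borel"
    let ?g = "\<lambda>s x. ennreal (gauss s x)"
    have "wint p w (nconv (enorm (defect s \<xi>)) F) \<le> wint p w (nconv (\<lambda>x. ennreal \<eta> * ?g (4 * s) x
       + (nconv G2 (?g s) x + ennreal \<eta> * ?g s x)) F)"
      using p by (intro wint_mono) (auto simp: nconv_def[of _ F] intro!: nn_integral_mono mult_right_mono le)
    also have "\<dots> = wint p w (\<lambda>x. ennreal \<eta> * nconv (?g (4 * s)) F x
        + (nconv G2 (nconv (?g s) F) x + ennreal \<eta> * nconv (?g s) F x))"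
      by (simp add: nconv_add_left nconv_cmult_left nconv_assoc)
    also have "\<dots> \<le> ennreal (2 powr p * (\<eta> powr p * Dg + 2 powr p * ((K * \<eta> powr p) * Dg + \<eta> powr p * Dg))) * wint p w F"
      using \<eta> s K Dg_nonneg G2
      by (intro wint_add_bound wint_cmult_bound gauss_bound wint_trans[OF op_bound]) auto
    also have "2 powr p * (\<eta> powr p * Dg + 2 powr p * ((K * \<eta> powr p) * Dg + \<eta> powr p * Dg)) = Q * \<eta> powr p"
      by (simp add: Q_def algebra_simps)
    also have "ennreal (Q * \<eta> powr p) * wint p w F \<le> ennreal \<theta> * wint p w F"
      using \<eta> by (intro mult_right_mono ennreal_leI) auto
    finally show "wint p w (nconv (enorm (defect s \<xi>)) F) \<le> ennreal \<theta> * wint p w F" .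
  qed
qed

text \<open>Every term of the pointwise majorant contains \<eta>, as a scalar or as the mass of a
  radial majorant, hence contributes a factor \<eta>^p.\<close>

lemma residual_bound:
  assumes \<theta>: "\<theta> > 0"
  shows "\<exists>\<tau>>0. \<forall>F \<in> borel_measurable borel. wint p w (nconv (enorm (residual \<tau>)) F) \<le> ennreal \<theta> * wint p w F"
proof -
  define Q where "Q = 2 powr p * (K + 2 powr p * (K + 2 powr p * (Dg * K + 2 powr p * (Nt + K * Nt))))"
  have Q: "Q \<ge> 0" using Dg_nonneg Nt_nonneg K by (simp add: Q_def)
  obtain \<eta> where \<eta>: "\<eta> > 0" "Q * \<eta> powr p \<le> \<theta>" using small_power[OF \<theta> Q] by blast
  obtain \<tau> \<Omega> Ga Gg where \<tau>: "\<tau> > 0" and \<Omega>: "dominated \<Omega> \<eta>" and Ga: "dominated Ga \<eta>" and Gg: "dominated Gg \<eta>"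
    and le: "AE x in lborel. enorm (residual \<tau>) x \<le> \<Omega> x + (Ga x + (nconv (\<lambda>a. ennreal (gauss \<tau> a)) Ga x
         + (ennreal \<eta> * enorm g x + nconv Gg (enorm g) x)))"
    using enorm_residual_small[OF \<eta>(1)] by blast
  have [measurable]: "\<Omega> \<in> borel_measurable borel" "Ga \<in> borel_measurable borel" "Gg \<in> borel_measurable borel"
    using \<Omega> Ga Gg by measurable
  show ?thesis
  proof (intro exI[of _ \<tau>] conjI ballI \<tau>)
    fix F :: "real ^ 'n \<Rightarrow> ennreal" assume F [measurable]: "F \<in> borel_measurable borel"
    let ?g = "\<lambda>a. ennreal (gauss \<tau> a)"
    let ?R = "\<lambda>x. \<Omega> x + (Ga x + (nconv ?g Ga x + (ennreal \<eta> * enorm g x + nconv Gg (enorm g) x)))"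
    have "nconv (enorm (residual \<tau>)) F x \<le> nconv ?R F x" for x
      unfolding nconv_def[of _ F] by (intro nn_integral_mono_AE, rule eventually_mono[OF le]) (intro mult_right_mono, auto)
    then have "wint p w (nconv (enorm (residual \<tau>)) F) \<le> wint p w (nconv ?R F)"
      using p by (intro wint_mono) auto
    also have "\<dots> = wint p w (\<lambda>x. nconv \<Omega> F x + (nconv Ga F x + (nconv ?g (nconv Ga F) x
         + (ennreal \<eta> * nconv (enorm g) F x + nconv Gg (nconv (enorm g) F) x))))"
      by (simp add: nconv_add_left nconv_cmult_left nconv_assoc)
    also have "\<dots> \<le> ennreal (2 powr p * (K * \<eta> powr p + 2 powr p * (K * \<eta> powr p + 2 powr p * (Dg * (K * \<eta> powr p)
         + 2 powr p * (\<eta> powr p * Nt + (K * \<eta> powr p) * Nt))))) * wint p w F"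
    proof (intro wint_add_bound wint_cmult_bound)
      show "wint p w (nconv \<Omega> F) \<le> ennreal (K * \<eta> powr p) * wint p w F"
        using \<eta> by (intro op_bound[OF F \<Omega>]) auto
      show Ga': "wint p w (nconv Ga F) \<le> ennreal (K * \<eta> powr p) * wint p w F"
        using \<eta> by (intro op_bound[OF F Ga]) auto
      show "wint p w (nconv ?g (nconv Ga F)) \<le> ennreal (Dg * (K * \<eta> powr p)) * wint p w F"
        using \<eta> K Dg_nonneg \<tau> by (intro wint_trans[OF gauss_bound Ga']) auto
      show "wint p w (nconv (enorm g) F) \<le> ennreal Nt * wint p w F" by (rule g_bound[OF F])
      show "wint p w (nconv Gg (nconv (enorm g) F)) \<le> ennreal (K * \<eta> powr p * Nt) * wint p w F"
        using \<eta> K Nt_nonneg by (intro wint_trans[OF op_bound[OF _ Gg] g_bound[OF F]]) auto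
    qed (use K \<eta> Nt_nonneg Dg_nonneg in auto)
    also have "2 powr p * (K * \<eta> powr p + 2 powr p * (K * \<eta> powr p + 2 powr p * (Dg * (K * \<eta> powr p)
         + 2 powr p * (\<eta> powr p * Nt + (K * \<eta> powr p) * Nt)))) = Q * \<eta> powr p"
      by (simp add: Q_def algebra_simps)
    also have "ennreal (Q * \<eta> powr p) * wint p w F \<le> ennreal \<theta> * wint p w F"
      using \<eta> by (intro mult_right_mono ennreal_leI) auto
    finally show "wint p w (nconv (enorm (residual \<tau>)) F) \<le> ennreal \<theta> * wint p w F" .
  qed
qed

lemma wint_cconv_le: "Wn (cconv u f) \<le> wint p w (nconv (enorm u) (enorm f))"
  using p by (intro wint_mono enorm_cconv_le) auto

lemma enorm_cgauss: "s > 0 \<Longrightarrow> enorm (cgauss s \<xi>) = (\<lambda>x. ennreal (gauss s x))"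
  by (simp add: enorm_def norm_cgauss fun_eq_iff)

lemma wint_cconv_cgauss:
  "nice f \<Longrightarrow> s > 0 \<Longrightarrow> Wn (cconv (cgauss s \<xi>) f) \<le> ennreal Dg * Wn f"
  by (rule order_trans[OF wint_cconv_le]) (auto simp: enorm_cgauss intro!: gauss_bound)

lemma wint_enorm_cmult:
  assumes "f \<in> borel_measurable borel"
  shows "Wn (\<lambda>x. c * f x) = ennreal (norm c powr p) * Wn f"
proof -
  have "enorm (\<lambda>x. c * f x) = (\<lambda>x. ennreal (norm c) * enorm f x)"
    by (simp add: enorm_def norm_mult ennreal_mult fun_eq_iff)
  then show ?thesis using assms by (simp add: wint_cmult epowr_ennreal)
qed

lemma wint_enorm_add:
  assumes [measurable]: "f \<in> borel_measurable borel" "h \<in> borel_measurable borel"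
  shows "Wn (\<lambda>x. f x + h x) \<le> ennreal (2 powr p) * (Wn f + Wn h)"
proof -
  have "Wn (\<lambda>x. f x + h x) \<le> wint p w (\<lambda>x. enorm f x + enorm h x)"
    using p by (intro wint_mono) (auto simp: enorm_def norm_triangle_ineq ennreal_leI simp flip: ennreal_plus)
  also have "\<dots> \<le> ennreal (2 powr p) * (Wn f + Wn h)"
    using p by (intro wint_add_le) auto
  finally show ?thesis .
qed

section \<open>Iterating the Gaussian localisation\<close>

lemma cconv_defect:
  assumes "s > 0" and f: "nice f"
  shows "cconv (defect s \<xi>) f x = cconv g (cconv (cgauss s \<xi>) f) x - ghat \<xi> * cconv (cgauss s \<xi>) f x"
proof -
  have "cconv (defect s \<xi>) f x = cconv (cconv g (cgauss s \<xi>)) f x - cconv (\<lambda>x. ghat \<xi> * cgauss s \<xi> x) f x"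
    unfolding defect_def[abs_def] using assms
    by (intro cconv_diff_left) (auto intro!: nice_integrable nice_cconv g_int nice_cgauss nice_cmult)
  then show ?thesis
    using assms by (simp add: cconv_assoc g_int nice_cgauss cconv_cmult_left)
qed

definition Tz :: "complex \<Rightarrow> (real ^ 'n \<Rightarrow> complex) \<Rightarrow> real ^ 'n \<Rightarrow> complex" where
  "Tz z f x = z * f x - cconv g f x"

lemma nice_Tz: "nice f \<Longrightarrow> nice (Tz z f)"
  unfolding Tz_def[abs_def] by (intro nice_diff nice_cmult nice_cconv g_int)

lemma measurable_Tz [measurable]:
  assumes [measurable]: "f \<in> borel_measurable borel"
  shows "Tz z f \<in> borel_measurable borel"
  unfolding Tz_def[abs_def] by measurable

lemma cconv_Tz:
  assumes u: "integrable lborel u" and f: "nice f"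
  shows "cconv u (Tz z f) x = z * cconv u f x - cconv g (cconv u f) x"
proof -
  have "cconv u (Tz z f) x = cconv u (\<lambda>x. z * f x) x - cconv u (cconv g f) x"
    unfolding Tz_def[abs_def] using u f by (intro cconv_diff_right nice_cmult nice_cconv g_int)
  then show ?thesis
    using u f by (simp add: cconv_cmult_right cconv_left_commute[OF u g_int f])
qed

text \<open>With h the convolution of f by the Gaussian of variance t, z - ghat times the
  localisation at variance s + t equals the localisation of (z - T) f plus the defect applied to h.
  One factor of variance s is thus traded for \<theta>, and h is ready for the next step.\<close>

lemma frequency_step:
  assumes st: "s > 0" "t > 0" and f: "nice f" and c: "c \<ge> 0" "c \<le> norm (z - ghat \<xi>)"
    and \<theta>: "\<And>F. F \<in> borel_measurable borel \<Longrightarrow> wint p w (nconv (enorm (defect s \<xi>)) F) \<le> ennreal \<theta> * wint p w F"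
  shows "ennreal (c powr p) * Wn (cconv (cgauss (s + t) \<xi>) f) \<le>
    ennreal (2 powr p) * (ennreal Dg * Wn (Tz z f) + ennreal \<theta> * Wn (cconv (cgauss t \<xi>) f))"
proof -
  have [measurable]: "f \<in> borel_measurable borel" using f by (rule nice_measurable)
  define h where "h = cconv (cgauss t \<xi>) f"
  have h: "nice h" unfolding h_def using st f by (intro nice_cconv nice_integrable nice_cgauss)
  have [measurable]: "h \<in> borel_measurable borel" using h by (rule nice_measurable)
  have h': "cconv (cgauss s \<xi>) h = cconv (cgauss (s + t) \<xi>) f"
    unfolding h_def using st f by (simp flip: cconv_assoc add: nice_cgauss cconv_cgauss)
  have st': "s + t > 0" using st by simp
  have eq: "(z - ghat \<xi>) * cconv (cgauss (s + t) \<xi>) f x = cconv (cgauss (s + t) \<xi>) (Tz z f) x + cconv (defect s \<xi>) h x" for x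
    unfolding cconv_defect[OF st(1) h, of \<xi> x] cconv_Tz[OF nice_integrable[OF nice_cgauss[OF st']] f, of \<xi> z x] h'
    by (simp add: left_diff_distrib)
  have "ennreal (c powr p) * Wn (cconv (cgauss (s + t) \<xi>) f) \<le>
     ennreal (norm (z - ghat \<xi>) powr p) * Wn (cconv (cgauss (s + t) \<xi>) f)"
    using c p by (intro mult_right_mono ennreal_leI powr_mono2) auto
  also have "\<dots> = Wn (\<lambda>x. (z - ghat \<xi>) * cconv (cgauss (s + t) \<xi>) f x)"
    by (simp add: wint_enorm_cmult)
  also have "\<dots> = Wn (\<lambda>x. cconv (cgauss (s + t) \<xi>) (Tz z f) x + cconv (defect s \<xi>) h x)"
    by (simp only: eq)
  also have "\<dots> \<le> ennreal (2 powr p) * (Wn (cconv (cgauss (s + t) \<xi>) (Tz z f)) + Wn (cconv (defect s \<xi>) h))"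
    by (rule wint_enorm_add) measurable
  also have "\<dots> \<le> ennreal (2 powr p) * (ennreal Dg * Wn (Tz z f) + ennreal \<theta> * Wn h)"
    by (intro mult_left_mono add_mono wint_cconv_cgauss nice_Tz f st' order_trans[OF wint_cconv_le \<theta>]) auto
  finally show ?thesis unfolding h_def .
qed

text \<open>The smallness of \<theta> gives contraction factor 1/2 per step. The coefficient 2M is
  the fixed point of B = M + B/2, hence stable under the induction. The base case already has one
  Gaussian factor, so m + 1 factors yield m contractions.\<close>

lemma frequency_decay:
  assumes s: "s > 0" and f: "nice f" and c: "c > 0" "c \<le> norm (z - ghat \<xi>)"
    and \<theta>: "\<And>F. F \<in> borel_measurable borel \<Longrightarrow> wint p w (nconv (enorm (defect s \<xi>)) F) \<le> ennreal \<theta> * wint p w F"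
    "\<theta> \<ge> 0" "2 powr p * \<theta> \<le> c powr p / 2"
  shows "Wn (cconv (cgauss (real (Suc m) * s) \<xi>) f) \<le>
     ennreal (2 * (2 powr p * Dg / c powr p)) * Wn (Tz z f) + ennreal (Dg * (1 / 2) ^ m) * Wn f"
proof (induction m)
  case 0
  show ?case using wint_cconv_cgauss[OF f s, of \<xi>] by (simp add: add_increasing)
next
  case (Suc m)
  define M where "M = 2 powr p * Dg / c powr p"
  define t where "t = real (Suc m) * s"
  have t: "t > 0" using s by (simp add: t_def)
  have M: "M \<ge> 0" using Dg_nonneg by (simp add: M_def)
  have cp: "c powr p > 0" using c by simp
  let ?E = "Wn (Tz z f)" and ?X = "Wn f"
  let ?A = "Wn (cconv (cgauss t \<xi>) f)" and ?B = "Wn (cconv (cgauss (s + t) \<xi>) f)"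
  have step: "ennreal (c powr p) * ?B \<le> ennreal (2 powr p) * (ennreal Dg * ?E + ennreal \<theta> * ?A)"
    using c by (intro frequency_step s t f \<theta>(1)) auto
  have "?B = ennreal (1 / c powr p) * (ennreal (c powr p) * ?B)"
    using c by (simp add: mult.assoc[symmetric] flip: ennreal_mult)
  also have "\<dots> \<le> ennreal (1 / c powr p) * (ennreal (2 powr p) * (ennreal Dg * ?E + ennreal \<theta> * ?A))"
    by (intro mult_left_mono step) auto
  also have "\<dots> = ennreal M * ?E + ennreal (2 powr p * \<theta> / c powr p) * ?A"
    using Dg_nonneg \<theta>(2) by (simp add: M_def distrib_left mult.assoc[symmetric] flip: ennreal_mult)
  also have "\<dots> \<le> ennreal M * ?E + ennreal (1/2) * ?A"
    using \<theta>(3) cp by (intro add_left_mono mult_right_mono ennreal_leI) (auto simp: field_simps)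
  also have "\<dots> \<le> ennreal M * ?E + ennreal (1/2) * (ennreal (2 * M) * ?E + ennreal (Dg * (1 / 2) ^ m) * ?X)"
    using Suc.IH unfolding t_def M_def by (intro add_left_mono mult_left_mono) auto
  also have "\<dots> = (ennreal M * ?E + ennreal (1/2 * (2 * M)) * ?E) + ennreal (1/2 * (Dg * (1 / 2) ^ m)) * ?X"
  proof -
    have 1: "ennreal (1/2) * (ennreal (2 * M) * ?E) = ennreal (1/2 * (2 * M)) * ?E"
      by (rule ennreal_mult_mult) (use M in auto)
    have 2: "ennreal (1/2) * (ennreal (Dg * (1 / 2) ^ m) * ?X) = ennreal (1/2 * (Dg * (1 / 2) ^ m)) * ?X"
      by (rule ennreal_mult_mult) (use Dg_nonneg in auto)
    show ?thesis by (simp only: distrib_left 1 2 add.assoc)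
  qed
  also have "ennreal M * ?E + ennreal (1/2 * (2 * M)) * ?E = ennreal (2 * M) * ?E"
  proof -
    have "ennreal M + ennreal (1/2 * (2 * M)) = ennreal (2 * M)"
      using M by (subst ennreal_plus[symmetric]) auto
    then show ?thesis by (simp only: distrib_right[symmetric])
  qed
  finally have "?B \<le> ennreal (2 * M) * ?E + ennreal (1/2 * (Dg * (1 / 2) ^ m)) * ?X" .
  moreover have "real (Suc (Suc m)) * s = s + t" by (simp add: t_def algebra_simps)
  moreover have "Dg * (1 / 2) ^ Suc m = 1/2 * (Dg * (1 / 2) ^ m)" by simp
  ultimately show ?case unfolding M_def by (simp only:)
qed

end

section \<open>Superposition over frequencies and the stability estimate\<close>

lemma enorm_integral_le: "enorm (\<lambda>x. LINT y|M. f x y) x \<le> (\<integral>\<^sup>+ y. enorm (f x) y \<partial>M)"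
proof (cases "integrable M (f x)")
  case True
  show ?thesis using integral_norm_bound_ennreal[OF True] by (simp add: enorm_def)
next
  case False
  then show ?thesis by (simp add: enorm_def not_integrable_integral_eq)
qed

lemma measurable_inner_random:
  "(\<lambda>q. fst q \<bullet> (b *\<^sub>R (\<chi> i. snd q i))) \<in> borel_measurable (lborel \<Otimes>\<^sub>M (gprob :: ('n::finite \<Rightarrow> real) measure))"
proof -
  have [measurable]: "(\<lambda>q. snd q i) \<in> borel_measurable (lborel \<Otimes>\<^sub>M (gprob :: ('n \<Rightarrow> real) measure))" for i
    by (rule measurable_compose[OF measurable_snd]) (simp add: gprob_def)
  have [measurable]: "(\<lambda>x :: real ^ 'n. x $ i) \<in> borel_measurable borel" for i
    by (intro borel_measurable_continuous_onI continuous_intros)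
  show ?thesis unfolding inner_vec_def by simp
qed

context weighted_kernel
begin

text \<open>The narrow Gaussian is \<kappa> times an average of modulated wide ones. Jensen for the
  probability measure of frequencies and Tonelli then reduce to B, which is uniform in
  \<xi>.\<close>

lemma superposition_bound:
  assumes \<tau>: "0 < \<tau>" and \<sigma>: "\<tau> < \<sigma>" and f: "nice f"
    and B: "\<And>\<xi>. Wn (cconv (cgauss \<sigma> \<xi>) f) \<le> B"
  shows "Wn (cconv (cgauss \<tau> 0) f) \<le> ennreal (((\<sigma> / \<tau>) powr (real CARD('n) / 2)) powr p) * B"
proof -
  define b where "b = sqrt (1 / \<tau> - 1 / \<sigma>)"
  define \<kappa> where "\<kappa> = (\<sigma> / \<tau>) powr (real CARD('n) / 2)"
  have \<kappa>: "\<kappa> \<ge> 0" by (simp add: \<kappa>_def)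
  have \<sigma>0: "\<sigma> > 0" using \<tau> \<sigma> by simp
  let ?P = "gprob :: ('n \<Rightarrow> real) measure"
  let ?L = "lborel \<Otimes>\<^sub>M ?P"
  define X where "X \<omega> = b *\<^sub>R (\<chi> i. \<omega> i)" for \<omega> :: "'n \<Rightarrow> real"
  let ?c = "\<lambda>\<omega>. cconv (cgauss \<sigma> (X \<omega>)) f"
  let ?e = "\<lambda>\<omega> x. epowr (enorm (?c \<omega>) x) p"
  interpret P: prob_space ?P by (rule prob_space_gprob)
  interpret LP: pair_sigma_finite "lborel :: (real ^ 'n) measure" ?P ..
  interpret LeP: pair_sigma_finite "lebesgue :: (real ^ 'n) measure" ?P
    by (simp add: pair_sigma_finite_def sigma_finite_lebesgue P.sigma_finite_measure_axioms)
  have [measurable]: "f \<in> borel_measurable borel" using f by (rule nice_measurable)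
  have X [measurable]: "(\<lambda>q. fst q \<bullet> X (snd q)) \<in> borel_measurable ?L"
    unfolding X_def by (rule measurable_inner_random)
  have cgm [measurable]: "(\<lambda>q. cgauss \<sigma> (X (snd q)) (fst q)) \<in> borel_measurable ?L"
    unfolding cgauss_def by measurable
  have sup: "cgauss \<tau> 0 a = complex_of_real \<kappa> * (LINT \<omega>|?P. cgauss \<sigma> (X \<omega>) a)" for a
    using gauss_eq_superposition[OF \<tau> \<sigma>, of a] by (simp add: cgauss_def[of \<tau>] \<kappa>_def X_def b_def)
  have eq: "cconv (cgauss \<tau> 0) f x = complex_of_real \<kappa> * (LINT \<omega>|?P. ?c \<omega> x)" for x
  proof -
    have int: "integrable ?L (\<lambda>(a, \<omega>). cgauss \<sigma> (X \<omega>) a * f (x - a))"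
    proof (rule LP.Fubini_integrable)
      show "(\<lambda>(a, \<omega>). cgauss \<sigma> (X \<omega>) a * f (x - a)) \<in> borel_measurable ?L"
        by (simp add: case_prod_beta')
      show "integrable lborel (\<lambda>a. LINT \<omega>|?P. norm (case (a, \<omega>) of (a, \<omega>) \<Rightarrow> cgauss \<sigma> (X \<omega>) a * f (x - a)))"
        using integrable_norm[OF integrable_conv[OF nice_integrable[OF nice_cgauss[OF \<sigma>0, of 0]] f, of x]] \<sigma>0
        by (simp add: norm_mult norm_cgauss P.prob_space)
      show "AE a in lborel. integrable ?P (\<lambda>\<omega>. case (a, \<omega>) of (a, \<omega>) \<Rightarrow> cgauss \<sigma> (X \<omega>) a * f (x - a))"
      proof (intro AE_I2)
        fix a
        have "(\<lambda>\<omega>. cgauss \<sigma> (X \<omega>) a * f (x - a)) \<in> borel_measurable ?P"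
          using measurable_compose[OF measurable_Pair1' cgm, of a] by simp
        then show "integrable ?P (\<lambda>\<omega>. case (a, \<omega>) of (a, \<omega>) \<Rightarrow> cgauss \<sigma> (X \<omega>) a * f (x - a))"
          using \<sigma>0 by (intro P.integrable_const_bound[of _ "gauss \<sigma> a * norm (f (x - a))"]) (auto simp: norm_mult norm_cgauss)
      qed
    qed
    have "cconv (cgauss \<tau> 0) f x = complex_of_real \<kappa> * (LINT a|lborel. LINT \<omega>|?P. cgauss \<sigma> (X \<omega>) a * f (x - a))"
      by (simp add: cconv_def sup mult.assoc)
    also have "(LINT a|lborel. LINT \<omega>|?P. cgauss \<sigma> (X \<omega>) a * f (x - a)) = (LINT \<omega>|?P. LINT a|lborel. cgauss \<sigma> (X \<omega>) a * f (x - a))"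
      by (rule LP.Fubini_integral[OF int, symmetric])
    finally show ?thesis by (simp add: cconv_def)
  qed
  have cm: "(\<lambda>q. enorm (?c (snd q)) (fst q)) \<in> borel_measurable ?L"
  proof -
    have "(\<lambda>r. cgauss \<sigma> (X (snd (fst r))) (snd r)) \<in> borel_measurable (?L \<Otimes>\<^sub>M (lborel :: (real ^ 'n) measure))"
    proof -
      have "(\<lambda>r. (snd r, snd (fst r))) \<in> measurable (?L \<Otimes>\<^sub>M (lborel :: (real ^ 'n) measure)) ?L"
        by (intro measurable_Pair measurable_snd measurable_compose[OF measurable_fst measurable_snd])
      from measurable_compose[OF this cgm] show ?thesis by simp
    qed
    then have [measurable]: "(\<lambda>(q, a). cgauss \<sigma> (X (snd q)) a) \<in> borel_measurable (?L \<Otimes>\<^sub>M (lborel :: (real ^ 'n) measure))"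
      by (simp add: case_prod_beta')
    have "(\<lambda>q. LINT a|lborel. cgauss \<sigma> (X (snd q)) a * f (fst q - a)) \<in> borel_measurable ?L"
      by (rule lborel.borel_measurable_lebesgue_integral) (simp add: case_prod_beta')
    then show ?thesis unfolding enorm_def cconv_def by measurable
  qed
  \<comment> \<open>Joint measurability is proved over \<open>lborel\<close> and transported along
    the identity from \<open>lebesgue\<close>, so that Tonelli can include the Lebesgue measurable
    weight.\<close>
  have cm' [measurable]: "(\<lambda>q. enorm (?c (snd q)) (fst q)) \<in> borel_measurable (lebesgue \<Otimes>\<^sub>M ?P)"
  proof -
    have "(\<lambda>q. (fst q, snd q)) \<in> measurable (lebesgue \<Otimes>\<^sub>M ?P) ?L"
      by (intro measurable_Pair measurable_snd measurable_compose[OF measurable_fst]) (simp add: measurable_completion)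
    from measurable_compose[OF this cm] show ?thesis by simp
  qed
  have cm1 [measurable]: "(\<lambda>\<omega>. enorm (?c \<omega>) x) \<in> borel_measurable ?P" for x
    using measurable_compose[OF measurable_Pair1' cm, of x] by simp
  have [measurable]: "(\<lambda>q. w (fst q)) \<in> borel_measurable (lebesgue \<Otimes>\<^sub>M ?P)"
    by (rule measurable_compose[OF measurable_fst]) simp
  have pt: "epowr (enorm (cconv (cgauss \<tau> 0) f) x) p \<le> ennreal (\<kappa> powr p) * (\<integral>\<^sup>+ \<omega>. ?e \<omega> x \<partial>?P)" for x
  proof -
    have "enorm (cconv (cgauss \<tau> 0) f) x = ennreal \<kappa> * enorm (\<lambda>x. LINT \<omega>|?P. ?c \<omega> x) x"
      using \<kappa> by (simp add: enorm_def eq norm_mult ennreal_mult)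
    also have "\<dots> \<le> ennreal \<kappa> * (\<integral>\<^sup>+ \<omega>. enorm (?c \<omega>) x \<partial>?P)"
      using enorm_integral_le[where M = ?P and f = "\<lambda>x \<omega>. ?c \<omega> x" and x = x]
      by (intro mult_left_mono) (auto simp: enorm_def)
    finally have "epowr (enorm (cconv (cgauss \<tau> 0) f) x) p \<le> epowr (ennreal \<kappa> * (\<integral>\<^sup>+ \<omega>. enorm (?c \<omega>) x \<partial>?P)) p"
      using p by (intro epowr_mono) auto
    also have "\<dots> = ennreal (\<kappa> powr p) * epowr (\<integral>\<^sup>+ \<omega>. enorm (?c \<omega>) x \<partial>?P) p"
      using \<kappa> by (simp add: epowr_mult epowr_ennreal)
    also have "\<dots> \<le> ennreal (\<kappa> powr p) * (\<integral>\<^sup>+ \<omega>. ?e \<omega> x \<partial>?P)"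
      using nn_integral_epowr_le[OF cm1[of x], of 1 p] p by (intro mult_left_mono) (auto simp: P.emeasure_space_1)
    finally show ?thesis .
  qed
  have "Wn (cconv (cgauss \<tau> 0) f) \<le> (\<integral>\<^sup>+ x. ennreal (\<kappa> powr p) * (\<integral>\<^sup>+ \<omega>. ?e \<omega> x \<partial>?P) * ennreal (w x) \<partial>lebesgue)"
    unfolding wint_def by (intro nn_integral_mono mult_right_mono pt) auto
  also have "\<dots> = (\<integral>\<^sup>+ x. \<integral>\<^sup>+ \<omega>. ennreal (\<kappa> powr p) * (?e \<omega> x * ennreal (w x)) \<partial>?P \<partial>lebesgue)"
    by (intro nn_integral_cong) (simp add: nn_integral_cmult nn_integral_multc mult.assoc)
  also have "\<dots> = (\<integral>\<^sup>+ \<omega>. \<integral>\<^sup>+ x. ennreal (\<kappa> powr p) * (?e \<omega> x * ennreal (w x)) \<partial>lebesgue \<partial>?P)"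
    by (rule LeP.Fubini'[symmetric]) (simp add: case_prod_beta')
  also have "\<dots> \<le> (\<integral>\<^sup>+ \<omega>. ennreal (\<kappa> powr p) * B \<partial>?P)"
  proof (intro nn_integral_mono)
    fix \<omega>
    have [measurable]: "enorm (?c \<omega>) \<in> borel_measurable lebesgue"
      by (simp add: measurable_completion)
    have "(\<integral>\<^sup>+ x. ennreal (\<kappa> powr p) * (?e \<omega> x * ennreal (w x)) \<partial>lebesgue)
      = ennreal (\<kappa> powr p) * Wn (?c \<omega>)"
      unfolding wint_def by (rule nn_integral_cmult) measurable
    also have "\<dots> \<le> ennreal (\<kappa> powr p) * B" by (intro mult_left_mono B) auto
    finally show "(\<integral>\<^sup>+ x. ennreal (\<kappa> powr p) * (?e \<omega> x * ennreal (w x)) \<partial>lebesgue) \<le> ennreal (\<kappa> powr p) * B" .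
  qed
  also have "\<dots> = ennreal (\<kappa> powr p) * B"
    by (simp add: P.emeasure_space_1)
  finally show ?thesis unfolding \<kappa>_def .
qed

lemma cconv_residual:
  assumes "\<tau> > 0" "nice f"
  shows "cconv (residual \<tau>) f x = cconv g f x - cconv g (cconv (cgauss \<tau> 0) f) x"
  unfolding residual_def[abs_def] using assms
  by (subst cconv_diff_left) (auto intro!: g_int nice_integrable nice_cconv nice_cgauss simp: cconv_assoc g_int nice_cgauss)

text \<open>z f is the sum of (z - T) f, the residual applied to f, and T applied to the smoothed f.
  The last two cost at most \<zeta>/4 of the norm of f each, up to multiples of the norm of (z - T)
  f; finiteness of the norm allows absorption.\<close>

lemma stable_nice:
  assumes z: "z \<noteq> 0" "\<And>\<xi>. z \<noteq> ghat \<xi>"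
  shows "\<exists>C\<ge>0. \<forall>f. nice f \<longrightarrow> Wn f < \<top> \<longrightarrow> Wn f \<le> ennreal C * Wn (Tz z f)"
proof -
  define a where "a = 2 powr p"
  have a: "a \<ge> 1" using p by (simp add: a_def ge_one_powr_ge_zero)
  define \<zeta> where "\<zeta> = norm z powr p"
  have \<zeta>: "\<zeta> > 0" using z by (simp add: \<zeta>_def)
  obtain c where c: "c > 0" "\<And>\<xi>. c \<le> norm (z - ghat \<xi>)" using ghat_away[OF z] by blast
  define \<theta> where "\<theta> = c powr p / (2 * a)"
  have \<theta>: "\<theta> > 0" "2 powr p * \<theta> \<le> c powr p / 2" using c a by (auto simp: \<theta>_def a_def[symmetric])
  obtain s where s: "s > 0" and sb: "\<And>\<xi> F. F \<in> borel_measurable borel \<Longrightarrow> wint p w (nconv (enorm (defect s \<xi>)) F) \<le> ennreal \<theta> * wint p w F"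
    using defect_bound[OF \<theta>(1)] by blast
  \<comment> \<open>Two triangle inequalities multiply the residual term by a^2, which leaves
    \<zeta>/4.\<close>
  define \<eta> where "\<eta> = \<zeta> / (4 * a * a)"
  have \<eta>: "\<eta> > 0" using \<zeta> a by (simp add: \<eta>_def)
  obtain \<tau> where \<tau>: "\<tau> > 0" and tb: "\<And>F. F \<in> borel_measurable borel \<Longrightarrow> wint p w (nconv (enorm (residual \<tau>)) F) \<le> ennreal \<eta> * wint p w F"
    using residual_bound[OF \<eta>] by blast
  define q where "q = real CARD('n) / 2 * p"
  define \<kappa> where "\<kappa> m = (real (Suc m) * s / \<tau>) powr q" for m
  define M where "M = 2 * (2 powr p * Dg / c powr p)"
  have M: "M \<ge> 0" using Dg_nonneg by (simp add: M_def)
  \<comment> \<open>s and \<tau> are fixed by now, so the cost of the superposition grows only like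
    (m + 1)^q.\<close>
  have "(\<lambda>m. ((s / \<tau>) * real (Suc m)) powr q * (1/2) ^ m) \<longlonglongrightarrow> 0"
  proof -
    have "s / \<tau> > 0" using s \<tau> by simp
    then show ?thesis by real_asymp
  qed
  then have "(\<lambda>m. a * a * Nt * Dg * (((s / \<tau>) * real (Suc m)) powr q * (1/2) ^ m)) \<longlonglongrightarrow> a * a * Nt * Dg * 0"
    by (rule tendsto_mult_left)
  then have "\<forall>\<^sub>F m in sequentially. a * a * Nt * Dg * (((s / \<tau>) * real (Suc m)) powr q * (1/2) ^ m) < \<zeta> / 4"
    using \<zeta> by (intro order_tendstoD) auto
  moreover have "\<forall>\<^sub>F m in sequentially. \<tau> / s < real m"
    using filterlim_real_sequentially by (auto simp: filterlim_at_top_dense)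
  ultimately obtain m where m: "a * a * Nt * Dg * (((s / \<tau>) * real (Suc m)) powr q * (1/2) ^ m) < \<zeta> / 4" "\<tau> / s < real m"
    using eventually_happens'[OF sequentially_bot eventually_conj] by blast
  have m': "a * a * Nt * \<kappa> m * (Dg * (1/2) ^ m) \<le> \<zeta> / 4"
  proof -
    have "(s / \<tau>) * real (Suc m) = real (Suc m) * s / \<tau>" by simp
    then have "a * a * Nt * \<kappa> m * (Dg * (1/2) ^ m) = a * a * Nt * Dg * (((s / \<tau>) * real (Suc m)) powr q * (1/2) ^ m)"
      unfolding \<kappa>_def by (simp only: ac_simps)
    then show ?thesis using m(1) by linarith
  qed
  have \<kappa>: "\<kappa> m \<ge> 0" by (simp add: \<kappa>_def)
  \<comment> \<open>The condition m > \<tau>/s puts this variance above \<tau>, as the superposition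
    requires.\<close>
  define \<sigma> where "\<sigma> = real (Suc m) * s"
  have "\<tau> < real m * s" using m(2) s by (simp add: field_simps)
  then have \<sigma>: "\<tau> < \<sigma>" using s by (simp add: \<sigma>_def algebra_simps)
  \<comment> \<open>\<zeta>/2 is what remains of \<zeta> after the two absorbed quarters.\<close>
  define C where "C = (a + a * a * Nt * \<kappa> m * M) / (\<zeta> / 2)"
  have C: "C \<ge> 0" using a Nt_nonneg \<kappa> M \<zeta> by (auto simp: C_def intro!: divide_nonneg_pos add_nonneg_nonneg mult_nonneg_nonneg)
  show ?thesis
  proof (intro exI[of _ C] conjI allI impI C)
    fix f assume f: "nice f" and fin: "Wn f < \<top>"
    have [measurable]: "f \<in> borel_measurable borel" using f by (rule nice_measurable)
    define P where "P = cconv (cgauss \<tau> 0) f"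
    have Pn: "nice P" unfolding P_def using \<tau> f by (intro nice_cconv nice_integrable nice_cgauss)
    have [measurable]: "P \<in> borel_measurable borel" using Pn by (rule nice_measurable)
    let ?E = "Wn (Tz z f)" and ?X = "Wn f"
    have Pb: "Wn P \<le> ennreal (\<kappa> m) * (ennreal M * ?E + ennreal (Dg * (1/2) ^ m) * ?X)"
    proof -
      have "Wn (cconv (cgauss \<sigma> \<xi>) f) \<le> ennreal M * ?E + ennreal (Dg * (1/2) ^ m) * ?X" for \<xi>
        unfolding \<sigma>_def M_def using \<theta> by (intro frequency_decay[OF s f c sb]) auto
      from superposition_bound[OF \<tau> \<sigma> f this] show ?thesis
        by (simp add: P_def \<kappa>_def \<sigma>_def q_def powr_powr)
    qed
    have "ennreal \<zeta> * ?X = Wn (\<lambda>x. z * f x)"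
      by (simp add: wint_enorm_cmult \<zeta>_def)
    also have "(\<lambda>x. z * f x) = (\<lambda>x. Tz z f x + (cconv (residual \<tau>) f x + cconv g P x))"
      using \<tau> f by (simp add: Tz_def cconv_residual P_def fun_eq_iff)
    also have "Wn (\<lambda>x. Tz z f x + (cconv (residual \<tau>) f x + cconv g P x))
      \<le> ennreal a * (?E + Wn (\<lambda>x. cconv (residual \<tau>) f x + cconv g P x))"
      unfolding a_def by (rule wint_enorm_add) measurable
    also have "\<dots> \<le> ennreal a * (?E + ennreal a * (Wn (cconv (residual \<tau>) f) + Wn (cconv g P)))"
      unfolding a_def by (intro mult_left_mono add_left_mono wint_enorm_add) auto
    also have "\<dots> \<le> ennreal a * (?E + ennreal a * (ennreal \<eta> * ?X + ennreal Nt * (ennreal (\<kappa> m) * (ennreal M * ?E + ennreal (Dg * (1/2) ^ m) * ?X))))"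
      by (intro mult_left_mono add_left_mono add_mono order_trans[OF wint_cconv_le tb] order_trans[OF wint_cconv_le]
           order_trans[OF g_bound] Pb) auto
    finally have main: "ennreal \<zeta> * ?X \<le> ennreal a * (?E + ennreal a * (ennreal \<eta> * ?X + ennreal Nt * (ennreal (\<kappa> m) * (ennreal M * ?E + ennreal (Dg * (1/2) ^ m) * ?X))))" .
    show "?X \<le> ennreal C * ?E"
    proof (cases ?E)
      \<comment> \<open>Here C must be positive, since 0 times infinity is 0.\<close>
      case top
      have "a + a * a * Nt * \<kappa> m * M > 0"
        using a Nt_nonneg \<kappa> M by (intro add_pos_nonneg mult_nonneg_nonneg) auto
      then have "C > 0" using \<zeta> by (simp add: C_def)
      then show ?thesis using top by (simp add: ennreal_mult_top)
    next
      case (real e)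
      obtain x where x: "?X = ennreal x" "x \<ge> 0" using fin by (cases ?X) auto
      have "\<zeta> * x \<le> a * (e + a * (\<eta> * x + Nt * (\<kappa> m * (M * e + (Dg * (1/2) ^ m) * x))))"
      proof -
        have "ennreal (\<zeta> * x) \<le> ennreal (a * (e + a * (\<eta> * x + Nt * (\<kappa> m * (M * e + (Dg * (1/2) ^ m) * x)))))"
          using main x real a \<eta> Nt_nonneg \<kappa> M Dg_nonneg \<zeta>
          by (simp add: ennreal_mult ennreal_plus)
        then show ?thesis
          using x real a \<eta> Nt_nonneg \<kappa> M Dg_nonneg by (subst (asm) ennreal_le_iff) auto
      qed
      also have "\<dots> = (a * a * \<eta>) * x + (a + a * a * Nt * \<kappa> m * M) * e + (a * a * Nt * \<kappa> m * (Dg * (1/2) ^ m)) * x"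
        by (simp add: algebra_simps)
      also have "\<dots> \<le> (\<zeta> / 4) * x + (a + a * a * Nt * \<kappa> m * M) * e + (\<zeta> / 4) * x"
        using x real a m' Nt_nonneg \<kappa> M by (intro add_mono mult_right_mono) (auto simp: \<eta>_def)
      finally have "(\<zeta> / 2) * x \<le> (a + a * a * Nt * \<kappa> m * M) * e" by simp
      then have "x \<le> C * e" using \<zeta> by (simp add: C_def field_simps)
      then show ?thesis using x real C by (simp add: ennreal_leI flip: ennreal_mult)
    qed
  qed
qed

end

section \<open>From bounded integrable functions to all of the weighted space\<close>

context weighted_kernel
begin

text \<open>Truncations of f in size and support are nice and converge in norm by dominated
  convergence. The remainder \<open>r k\<close> affects \<open>Tz\<close> only through
  multiplication by z and convolution with |g|, both bounded.\<close>

lemma stable_borel: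
  assumes z: "z \<noteq> 0" "\<And>\<xi>. z \<noteq> ghat \<xi>"
  shows "\<exists>C\<ge>0. \<forall>f \<in> borel_measurable borel. Wn f < \<top> \<longrightarrow> Wn f \<le> ennreal C * Wn (Tz z f)"
proof -
  obtain C where C: "C \<ge> 0" and st: "\<And>f. nice f \<Longrightarrow> Wn f < \<top> \<Longrightarrow> Wn f \<le> ennreal C * Wn (Tz z f)"
    using stable_nice[OF z] by blast
  define a where "a = 2 powr p"
  define L where "L = a * (norm z powr p + Nt)"
  have a: "a \<ge> 0" and L: "L \<ge> 0" using Nt_nonneg by (auto simp: a_def L_def)
  show ?thesis
  proof (intro exI[of _ "a * C * a"] conjI ballI impI)
    fix f :: "real ^ 'n \<Rightarrow> complex"
    assume f [measurable]: "f \<in> borel_measurable borel" and fin: "Wn f < \<top>"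
    let ?E = "Wn (Tz z f)"
    define S where "S k = {x. norm x \<le> real k \<and> norm (f x) \<le> real k}" for k :: nat
    have [measurable]: "S k \<in> sets borel" for k unfolding S_def by measurable
    define fk where "fk k x = indicator (S k) x * f x" for k x
    define r where "r k x = f x - fk k x" for k x
    have [measurable]: "fk k \<in> borel_measurable borel" "r k \<in> borel_measurable borel" for k
      unfolding fk_def[abs_def] r_def[abs_def] by measurable
    let ?D = "\<lambda>k. Wn (r k)"
    let ?U = "\<lambda>k. ennreal (a * C * a) * ?E + ennreal (a * (C * (a * L) + 1)) * ?D k"
    have fk_le: "norm (fk k x) \<le> norm (f x)" and r_le: "norm (r k x) \<le> norm (f x)" for k x
      by (auto simp: fk_def r_def indicator_def)
    have nice_fk: "nice (fk k)" for k
    proof -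
      have bd: "norm (fk k x) \<le> real k * indicator (cball 0 (real k)) x" for x
        by (auto simp: fk_def S_def indicator_def)
      have "integrable lborel (\<lambda>x. real k * indicator (cball 0 (real k)) (x :: real ^ 'n))"
        by (intro integrable_mult_right integrable_real_indicator) (use emeasure_lborel_cball_finite[of "0 :: real ^ 'n" "real k"] in auto)
      then have "integrable lborel (fk k)"
        by (rule Bochner_Integration.integrable_bound) (use bd in auto)
      moreover have "norm (fk k x) \<le> real k" for x
        by (rule order_trans[OF bd]) (simp add: indicator_def)
      ultimately show ?thesis by (auto simp: nice_def)
    qed
    have wfk: "Wn (fk k) < \<top>" for k
      by (rule le_less_trans[OF _ fin]) (use p fk_le in \<open>auto intro!: wint_mono ennreal_leI simp: enorm_def\<close>)
    \<comment> \<open>Divergent integrals have value 0, so \<open>cconv\<close> is additive only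
      where the integrals converge. Finiteness of the convolution of the moduli gives this almost
      everywhere.\<close>
    have ae: "AE x in lborel. nconv (enorm g) (enorm f) x < \<top>"
    proof -
      have [measurable]: "nconv (enorm g) (enorm f) \<in> borel_measurable lebesgue"
        by (simp add: measurable_completion)
      have "wint p w (nconv (enorm g) (enorm f)) \<le> ennreal Nt * Wn f"
        by (rule g_bound) simp
      also have "\<dots> < \<top>" using fin by (simp add: ennreal_mult_less_top)
      finally have "AE x in lebesgue. epowr (nconv (enorm g) (enorm f) x) p * ennreal (w x) \<noteq> \<infinity>"
        unfolding wint_def by (intro nn_integral_PInf_AE) auto
      then have "AE x in lebesgue. nconv (enorm g) (enorm f) x < \<top>"
      proof (rule eventually_mono)
        fix x assume "epowr (nconv (enorm g) (enorm f) x) p * ennreal (w x) \<noteq> \<infinity>"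
        then show "nconv (enorm g) (enorm f) x < \<top>"
          using w_pos[of x] by (cases "nconv (enorm g) (enorm f) x") (auto simp: ennreal_top_mult)
      qed
      then show ?thesis by (simp add: AE_completion_iff)
    qed
    have diff: "Wn (Tz z (fk k)) \<le> ennreal a * ?E + ennreal (a * L) * ?D k" for k
    proof -
      let ?R = "\<lambda>x. enorm (\<lambda>x. z * r k x) x + nconv (enorm g) (enorm (r k)) x"
      have "AE x in lborel. enorm (Tz z (fk k)) x \<le> enorm (Tz z f) x + ?R x"
        using ae
      proof eventually_elim
        case (elim x)
        have int: "integrable lborel (\<lambda>y. g y * f (x - y))"
          using elim by (intro integrableI_bounded) (auto simp: nconv_def enorm_def norm_mult ennreal_mult)
        have "integrable lborel (\<lambda>y. g y * fk k (x - y))" "integrable lborel (\<lambda>y. g y * r k (x - y))"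
          by (rule Bochner_Integration.integrable_bound[OF int]; use fk_le r_le in \<open>auto simp: norm_mult intro!: mult_left_mono\<close>)+
        then have "cconv g f x = cconv g (fk k) x + cconv g (r k) x"
          unfolding cconv_def by (subst Bochner_Integration.integral_add[symmetric]) (auto simp: r_def algebra_simps)
        then have "Tz z (fk k) x = Tz z f x + (cconv g (r k) x - z * r k x)"
          by (simp add: Tz_def r_def algebra_simps)
        then have "norm (Tz z (fk k) x) = norm (Tz z f x + (cconv g (r k) x - z * r k x))" by simp
        then have "norm (Tz z (fk k) x) \<le> norm (Tz z f x) + (norm (z * r k x) + norm (cconv g (r k) x))"
          using norm_triangle_ineq[of "Tz z f x" "cconv g (r k) x - z * r k x"] norm_triangle_ineq4[of "cconv g (r k) x" "z * r k x"]
          by linarith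
        then have "enorm (Tz z (fk k)) x \<le> enorm (Tz z f) x + (enorm (\<lambda>x. z * r k x) x + enorm (cconv g (r k)) x)"
          by (simp add: enorm_def ennreal_leI flip: ennreal_plus)
        also have "\<dots> \<le> enorm (Tz z f) x + ?R x"
          by (intro add_left_mono enorm_cconv_le)
        finally show ?case .
      qed
      then have "Wn (Tz z (fk k)) \<le> wint p w (\<lambda>x. enorm (Tz z f) x + ?R x)"
        using p by (intro wint_mono_AE) auto
      also have "\<dots> \<le> ennreal (2 powr p) * (?E + wint p w ?R)"
        using p by (intro wint_add_le) auto
      also have "\<dots> \<le> ennreal a * (?E + ennreal L * ?D k)"
        unfolding a_def L_def using Nt_nonneg
        by (intro mult_left_mono add_left_mono wint_add_bound g_bound) (auto simp: wint_enorm_cmult)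
      also have "\<dots> = ennreal a * ?E + ennreal (a * L) * ?D k"
        using a L by (simp add: distrib_left ennreal_mult mult.assoc)
      finally show ?thesis .
    qed
    have le: "Wn f \<le> ?U k" for k
    proof -
      have "Wn f = Wn (\<lambda>x. fk k x + r k x)" by (simp add: r_def)
      also have "\<dots> \<le> ennreal a * (Wn (fk k) + ?D k)"
        unfolding a_def by (rule wint_enorm_add) measurable
      also have "\<dots> \<le> ennreal a * (ennreal C * (ennreal a * ?E + ennreal (a * L) * ?D k) + ?D k)"
        by (intro mult_left_mono add_right_mono order_trans[OF st[OF nice_fk wfk]] diff) auto
      also have "\<dots> = ?U k"
        using a C L by (simp add: distrib_left distrib_right ennreal_mult ennreal_plus ac_simps)
      finally show ?thesis .
    qed
    have "(\<lambda>k. ?D k) \<longlonglongrightarrow> (\<integral>\<^sup>+ x. 0 \<partial>(lebesgue :: (real ^ 'n) measure))"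
      unfolding wint_def
    proof (rule nn_integral_dominated_convergence[where w = "\<lambda>x. epowr (enorm f x) p * ennreal (w x)"])
      have [measurable]: "enorm (r k) \<in> borel_measurable lebesgue" "enorm f \<in> borel_measurable lebesgue" for k
        by (simp_all add: measurable_completion)
      show "(\<lambda>x. epowr (enorm (r k) x) p * ennreal (w x)) \<in> borel_measurable lebesgue" for k
        by measurable
      show "(\<lambda>x. epowr (enorm f x) p * ennreal (w x)) \<in> borel_measurable lebesgue"
        by measurable
      show "AE x in lebesgue. epowr (enorm (r k) x) p * ennreal (w x) \<le> epowr (enorm f x) p * ennreal (w x)" for k
        using p r_le by (intro AE_I2 mult_right_mono epowr_mono) (auto simp: enorm_def ennreal_leI)
      show "AE x in lebesgue. (\<lambda>k. epowr (enorm (r k) x) p * ennreal (w x)) \<longlonglongrightarrow> 0"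
      proof (intro AE_I2 tendsto_eventually)
        fix x
        have "\<forall>\<^sub>F k in sequentially. max (norm x) (norm (f x)) \<le> real k"
          using eventually_ge_at_top[of "nat \<lceil>max (norm x) (norm (f x))\<rceil>"] by eventually_elim linarith
        then show "\<forall>\<^sub>F k in sequentially. epowr (enorm (r k) x) p * ennreal (w x) = 0"
          by eventually_elim (simp add: r_def fk_def S_def enorm_def)
      qed
    qed (use fin in \<open>auto simp: wint_def\<close>)
    then have "(\<lambda>k. ?U k)
       \<longlonglongrightarrow> ennreal (a * C * a) * ?E + ennreal (a * (C * (a * L) + 1)) * 0"
      by (intro tendsto_add tendsto_const ennreal_tendsto_cmult) auto
    then show "Wn f \<le> ennreal (a * C * a) * ?E"
      using LIMSEQ_le_const[OF _ exI[of _ 0]] le by (metis (no_types, lifting) add.right_neutral mult_zero_right)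
  qed (use a C in auto)
qed

section \<open>Approximate eigenfunctions\<close>

text \<open>The Gaussian is at most a multiple of a wider one convolved with the indicator of a box
  on which w is integrable, so the operator bound does the work of a growth estimate for w.\<close>

lemma wint_gauss_finite:
  assumes s: "s > 0"
  shows "wint p w (\<lambda>x. ennreal (gauss s x)) < \<top>"
proof -
  let ?d = "real CARD('n)"
  let ?b = "indicator (box0 1) :: real ^ 'n \<Rightarrow> ennreal"
  \<comment> \<open>From |x - y|^2 \<le> 2 |x|^2 + 2 n for y in the box, and the normalisation of
    the doubled variance.\<close>
  define c where "c = exp (- ?d / (2 * s)) / 2 powr (?d / 2)"
  have c: "c > 0" by (simp add: c_def)
  have pt: "c * gauss s x \<le> gauss (2 * s) (x - y)" if "y \<in> box0 1" for x y :: "real ^ 'n"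
  proof -
    have "norm y \<le> sqrt ?d * infnorm y" using norm_le_infnorm[of y] by simp
    also have "\<dots> \<le> sqrt ?d * 1" using that by (intro mult_left_mono) auto
    finally have "(norm y)\<^sup>2 \<le> (sqrt ?d)\<^sup>2" by (intro power_mono) auto
    then have y: "(norm y)\<^sup>2 \<le> ?d" by simp
    have "(norm (x - y))\<^sup>2 \<le> (norm x + norm y)\<^sup>2" by (intro power_mono norm_triangle_ineq4) auto
    also have "\<dots> \<le> 2 * (norm x)\<^sup>2 + 2 * (norm y)\<^sup>2"
      using sum_squares_bound[of "norm x" "norm y"] by (simp add: power2_sum)
    finally have "(norm (x - y))\<^sup>2 \<le> 2 * (norm x)\<^sup>2 + 2 * ?d" using y by linarith
    then have "(norm (x - y))\<^sup>2 / (4 * s) \<le> (2 * (norm x)\<^sup>2 + 2 * ?d) / (4 * s)"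
      using s by (intro divide_right_mono) auto
    then have "- ?d / (2 * s) + - (norm x)\<^sup>2 / (2 * s) \<le> - (norm (x - y))\<^sup>2 / (2 * (2 * s))"
      by (simp add: add_divide_distrib)
    then have "exp (- ?d / (2 * s)) * exp (- (norm x)\<^sup>2 / (2 * s)) \<le> exp (- (norm (x - y))\<^sup>2 / (2 * (2 * s)))"
      by (simp only: exp_add[symmetric] exp_le_cancel_iff)
    moreover note powr_two_pi_double[OF s, of "?d / 2"]
    ultimately show ?thesis
      using s by (simp add: gauss_def c_def divide_right_mono)
  qed
  define V where "V = (2 :: real) ^ CARD('n)"
  have V: "emeasure lborel (box0 1 :: (real ^ 'n) set) = ennreal V" "V > 0"
    using emeasure_translated_box0[of 1 "0 :: real ^ 'n"] by (simp_all add: box0_def V_def)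
  have "ennreal (c * V) * ennreal (gauss s x) \<le> nconv (\<lambda>x. ennreal (gauss (2 * s) x)) ?b x" for x :: "real ^ 'n"
  proof -
    have "ennreal (c * V) * ennreal (gauss s x) = (\<integral>\<^sup>+ y. ennreal (c * gauss s x) * ?b y \<partial>lborel)"
      using c V by (subst nn_integral_cmult_indicator) (simp_all add: ac_simps flip: ennreal_mult)
    also have "\<dots> \<le> (\<integral>\<^sup>+ y. ?b y * ennreal (gauss (2 * s) (x - y)) \<partial>lborel)"
      by (intro nn_integral_mono) (auto simp: indicator_def intro!: ennreal_leI pt)
    also have "\<dots> = nconv ?b (\<lambda>x. ennreal (gauss (2 * s) x)) x" by (simp add: nconv_def)
    also have "\<dots> = nconv (\<lambda>x. ennreal (gauss (2 * s) x)) ?b x" by (subst nconv_commute) auto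
    finally show ?thesis .
  qed
  then have "wint p w (\<lambda>x. ennreal (c * V) * ennreal (gauss s x)) \<le> wint p w (nconv (\<lambda>x. ennreal (gauss (2 * s) x)) ?b)"
    using p by (intro wint_mono) auto
  also have "\<dots> \<le> ennreal Dg * wint p w ?b" using s by (intro gauss_bound) auto
  also have "wint p w ?b = (\<integral>\<^sup>+ x. ?b x * ennreal (w x) \<partial>lebesgue)"
    unfolding wint_def by (intro nn_integral_cong) (auto simp: indicator_def epowr_def)
  also have "ennreal Dg * \<dots> < \<top>" using w_loc by (simp add: ennreal_mult_less_top)
  finally have "ennreal ((c * V) powr p) * wint p w (\<lambda>x. ennreal (gauss s (x :: real ^ 'n))) < \<top>"
    using c V by (simp add: wint_cmult epowr_ennreal)
  then show ?thesis using c V by (auto simp: ennreal_mult_less_top)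
qed

lemma wint_gauss_pos:
  assumes s: "s > 0"
  shows "wint p w (\<lambda>x. ennreal (gauss s x)) > 0"
proof (rule ccontr)
  have [measurable]: "(\<lambda>x :: real ^ 'n. ennreal (gauss s x)) \<in> borel_measurable lebesgue"
    by (simp add: measurable_completion)
  assume "\<not> 0 < wint p w (\<lambda>x. ennreal (gauss s x))"
  then have "AE x in lebesgue. epowr (ennreal (gauss s x)) p * ennreal (w x) = 0"
    unfolding wint_def by (subst (asm) not_gr_zero, subst (asm) nn_integral_0_iff_AE) auto
  then have "AE x in (lebesgue :: (real ^ 'n) measure). False"
  proof (rule eventually_mono)
    fix x assume "epowr (ennreal (gauss s x)) p * ennreal (w x) = 0"
    then show False using gauss_pos[OF s, of x] w_pos[of x] by (simp add: ennreal_eq_0_iff)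
  qed
  then have "AE x in (lborel :: (real ^ 'n) measure). False" by (simp add: AE_completion_iff)
  then have "(\<integral>\<^sup>+ x. ennreal (gauss s (x :: real ^ 'n)) \<partial>lborel) = (\<integral>\<^sup>+ x. 0 \<partial>(lborel :: (real ^ 'n) measure))"
    by (intro nn_integral_cong_AE) (elim eventually_mono, simp)
  moreover have "(\<integral>\<^sup>+ x. ennreal (gauss s (x :: real ^ 'n)) \<partial>lborel) = 1" by (rule nn_integral_gauss[OF s])
  ultimately show False by simp
qed

text \<open>The defect is controlled as a convolution operator, so the Gaussian of variance 2s is
  split into two of variance s: one forms the defect, the other is its argument. A pointwise
  comparison of the two variances returns to the norm of f and fixes b.\<close>

lemma approximate_eigenfunction:
  assumes \<epsilon>: "\<epsilon> > 0"
  shows "\<exists>f. nice f \<and> 0 < Wn f \<and> Wn f < \<top> \<and>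
     Wn (Tz (ghat \<xi>) f) \<le> ennreal \<epsilon> * Wn f"
proof -
  let ?d = "real CARD('n)"
  define b where "b = (2 powr (?d / 2)) powr p"
  have b: "b > 0" by (simp add: b_def)
  obtain s where s: "s > 0" and sb: "\<And>F. F \<in> borel_measurable borel \<Longrightarrow> wint p w (nconv (enorm (defect s \<xi>)) F) \<le> ennreal (\<epsilon> / b) * wint p w F"
    using defect_bound[of "\<epsilon> / b"] \<epsilon> b by auto
  have s2: "2 * s > 0" using s by simp
  define f where "f = cgauss (2 * s) \<xi>"
  have "Tz (ghat \<xi>) f x = - cconv (defect s \<xi>) (cgauss s \<xi>) x" for x
  proof -
    have "cconv (cgauss s \<xi>) (cgauss s \<xi>) = f"
      using cconv_cgauss[OF s s, of \<xi>] unfolding f_def mult_2 .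
    then show ?thesis
      using cconv_defect[OF s nice_cgauss[OF s], of \<xi> \<xi> x] by (simp add: Tz_def)
  qed
  then have "Wn (Tz (ghat \<xi>) f) = Wn (cconv (defect s \<xi>) (cgauss s \<xi>))"
    by (simp add: enorm_def wint_def)
  also have "\<dots> \<le> ennreal (\<epsilon> / b) * Wn (cgauss s \<xi>)"
    by (intro order_trans[OF wint_cconv_le sb]) simp
  also have "Wn (cgauss s \<xi>) \<le> wint p w (\<lambda>x. ennreal (2 powr (?d / 2)) * enorm f x)"
  proof (intro wint_mono)
    fix x :: "real ^ 'n"
    note powr_two_pi_double[OF s, of "?d / 2"]
    moreover have "exp (- (norm x)\<^sup>2 / (2 * s)) \<le> exp (- (norm x)\<^sup>2 / (2 * (2 * s)))"
      using s by (simp add: field_simps)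
    ultimately have "gauss s x \<le> 2 powr (?d / 2) * gauss (2 * s) x"
      by (simp add: gauss_def divide_right_mono)
    then show "enorm (cgauss s \<xi>) x \<le> ennreal (2 powr (?d / 2)) * enorm f x"
      using s by (simp add: f_def enorm_def norm_cgauss ennreal_leI flip: ennreal_mult)
  qed (use p in auto)
  also have "\<dots> = ennreal b * Wn f"
    by (subst wint_cmult) (auto simp: f_def b_def epowr_ennreal)
  finally have "Wn (Tz (ghat \<xi>) f) \<le> ennreal \<epsilon> * Wn f"
    using b \<epsilon> by (simp add: mult_left_mono ennreal_mult_mult)
  moreover have "nice f" unfolding f_def by (rule nice_cgauss[OF s2])
  moreover have "enorm f = (\<lambda>x. ennreal (gauss (2 * s) x))" unfolding f_def by (rule enorm_cgauss[OF s2])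
  ultimately show ?thesis using wint_gauss_pos[OF s2] wint_gauss_finite[OF s2] by auto
qed

text \<open>At a far frequency ghat is small, so an approximate eigenfunction for that value serves
  for 0. The two errors and the factor 2^p of the triangle inequality explain \<theta>.\<close>

lemma approximate_kernel:
  assumes \<epsilon>: "\<epsilon> > 0"
  shows "\<exists>f. nice f \<and> 0 < Wn f \<and> Wn f < \<top> \<and>
     Wn (Tz 0 f) \<le> ennreal \<epsilon> * Wn f"
proof -
  define \<theta> where "\<theta> = \<epsilon> / (2 * 2 powr p)"
  have \<theta>: "\<theta> > 0" using \<epsilon> by (simp add: \<theta>_def)
  obtain R where R: "R > 0" "\<And>\<xi>. norm \<xi> \<ge> R \<Longrightarrow> norm (ghat \<xi>) \<le> \<theta> powr (1 / p)"
    using ghat_tendsto_0[of "\<theta> powr (1 / p)"] \<theta> by auto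
  obtain \<xi> :: "real ^ 'n" where \<xi>: "norm \<xi> = R" using vector_choose_size[of R] R by (auto simp: less_imp_le)
  have "norm (ghat \<xi>) powr p \<le> (\<theta> powr (1 / p)) powr p" using R(2)[of \<xi>] \<xi> p by (intro powr_mono2) auto
  then have gh: "norm (ghat \<xi>) powr p \<le> \<theta>" using p \<theta> by (simp add: powr_powr)
  obtain f where f: "nice f" "0 < Wn f" "Wn f < \<top>"
     "Wn (Tz (ghat \<xi>) f) \<le> ennreal \<theta> * Wn f"
    using approximate_eigenfunction[OF \<theta>] by blast
  have [measurable]: "f \<in> borel_measurable borel" using f(1) by (rule nice_measurable)
  have "Tz 0 f = (\<lambda>x. Tz (ghat \<xi>) f x + (- ghat \<xi>) * f x)"
    by (simp add: Tz_def fun_eq_iff)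
  then have "Wn (Tz 0 f) \<le> ennreal (2 powr p) * (Wn (Tz (ghat \<xi>) f) + Wn (\<lambda>x. (- ghat \<xi>) * f x))"
    by (simp only:) (rule wint_enorm_add; measurable)
  also have "\<dots> \<le> ennreal (2 powr p) * (ennreal \<theta> * Wn f + ennreal \<theta> * Wn f)"
  proof (intro mult_left_mono add_mono f(4))
    have "Wn (\<lambda>x. (- ghat \<xi>) * f x) = ennreal (norm (- ghat \<xi>) powr p) * Wn f"
      by (rule wint_enorm_cmult) measurable
    also have "\<dots> \<le> ennreal \<theta> * Wn f"
      using gh by (intro mult_right_mono ennreal_leI) auto
    finally show "Wn (\<lambda>x. (- ghat \<xi>) * f x) \<le> ennreal \<theta> * Wn f" .
  qed auto
  also have "\<dots> = ennreal \<epsilon> * Wn f"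
    using \<theta> by (simp add: \<theta>_def ennreal_mult_mult flip: distrib_right ennreal_plus)
  finally show ?thesis using f by blast
qed

end

section \<open>The stability spectrum\<close>

lemma wnorm_eq: "wnorm p w f = epowr (wint p w (enorm f)) (1 / p)"
  by (simp add: wnorm_def wint_def enorm_def epowr_ennreal ennreal_mult')

lemma wint_cong_AE: "AE x in lborel. F x = G x \<Longrightarrow> wint p w F = wint p w G"
  unfolding wint_def by (rule nn_integral_cong_AE, drule AE_completion, erule eventually_mono) simp

text \<open>The value 0 on the exceptional set gives |f'| \<le> |f| everywhere, so pointwise
  majorants of f remain majorants of f'.\<close>

lemma borel_version:
  fixes f :: "real ^ 'n::finite \<Rightarrow> complex"
  assumes "f \<in> borel_measurable lebesgue"
  obtains f' N where "f' \<in> borel_measurable borel" "N \<in> null_sets lborel"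
    "\<And>x. x \<notin> N \<Longrightarrow> f' x = f x" "\<And>x. x \<in> N \<Longrightarrow> f' x = 0"
proof -
  have "(\<lambda>x. Re (f x)) \<in> borel_measurable lebesgue" "(\<lambda>x. Im (f x)) \<in> borel_measurable lebesgue"
    using assms by simp_all
  then obtain a b where [measurable]: "a \<in> borel_measurable lborel" "b \<in> borel_measurable lborel"
    and ab: "AE x in lborel. Re (f x) = a x" "AE x in lborel. Im (f x) = b x"
    using completion_ex_borel_measurable_real by blast
  have "AE x in lborel. f x = Complex (a x) (b x)"
    using ab by eventually_elim (simp add: complex_eq_iff)
  then obtain N where "{x \<in> space lborel. \<not> f x = Complex (a x) (b x)} \<subseteq> N" "emeasure lborel N = 0" "N \<in> sets lborel"
    by (rule AE_E)
  then have N: "N \<in> null_sets lborel" "\<And>x. x \<notin> N \<Longrightarrow> f x = Complex (a x) (b x)" by auto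
  have [measurable]: "N \<in> sets borel" using N(1) by (simp add: null_sets_def)
  show thesis
  proof
    have [measurable]: "a \<in> borel_measurable borel" "b \<in> borel_measurable borel"
      by (simp_all flip: measurable_lborel1)
    show "(\<lambda>x. if x \<in> N then 0 else of_real (a x) + \<i> * of_real (b x)) \<in> borel_measurable borel"
      by measurable
  qed (use N in \<open>auto simp: Complex_eq\<close>)
qed

text \<open>Completeness: the part of a preimage inside a null set is measurable.\<close>

lemma completion_AE_measurable:
  fixes f :: "real ^ ('n::finite) \<Rightarrow> complex"
  assumes ae: "AE y in lborel. f y = h y" and h: "h \<in> borel_measurable lborel"
  shows "f \<in> borel_measurable lebesgue"
proof (rule measurableI)
  fix A :: "complex set" assume [measurable]: "A \<in> sets borel"
  obtain N where "{y \<in> space lborel. \<not> f y = h y} \<subseteq> N" "emeasure lborel N = 0" "N \<in> sets lborel"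
    using ae by (rule AE_E)
  then have N: "N \<in> null_sets lborel" "\<And>y. y \<notin> N \<Longrightarrow> f y = h y" by auto
  have "h -` A \<in> sets borel" "N \<in> sets borel"
    using measurable_sets[OF h, of A] N(1) by (auto simp: null_sets_def)
  then have 1: "h -` A - N \<in> sets lebesgue" by auto
  have 2: "f -` A \<inter> N \<in> sets lebesgue"
    by (rule null_setsD2[OF null_sets_completion_subset[OF _ null_sets_completionI[OF N(1)]]]) auto
  have "f -` A = (h -` A - N) \<union> (f -` A \<inter> N)" using N(2) by auto
  then have "f -` A \<in> sets lebesgue" using sets.Un[OF 1 2] by (rule ssubst)
  then show "f -` A \<inter> space lebesgue \<in> sets lebesgue" by simp
qed simp

text \<open>An equality at every x, although f and g are changed on null sets: null sets stay null
  under y -> x - y, so the integrands agree almost everywhere.\<close>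

lemma conv_op_eq_cconv:
  fixes f g f' g' :: "real ^ 'n::finite \<Rightarrow> complex"
  assumes [measurable]: "g' \<in> borel_measurable borel" "f' \<in> borel_measurable borel"
    and f: "AE x in lborel. f x = f' x" and g: "AE x in lborel. g x = g' x"
  shows "conv_op g f x = cconv g' f' x"
proof -
  have ae: "AE y in lborel. g (x - y) * f y = g' (x - y) * f' y"
    using f AE_lborel_reflect[OF g, of x] by eventually_elim simp
  have m: "(\<lambda>y. g' (x - y) * f' y) \<in> borel_measurable lborel" by measurable
  have m': "(\<lambda>y. g (x - y) * f y) \<in> borel_measurable lebesgue"
    using ae m by (rule completion_AE_measurable)
  have "conv_op g f x = (LINT y|lebesgue. g' (x - y) * f' y)"
    unfolding conv_op_def using m' AE_completion[OF ae]
    by (intro integral_cong_AE) (auto intro: measurable_completion[OF m])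
  also have "\<dots> = (LINT y|lborel. g' (x - y) * f' y)" by (rule integral_completion[OF m])
  also have "\<dots> = cconv g' f' x"
    using integral_reflect[of "\<lambda>a. g' a * f' (x - a)" x] by (simp add: cconv_def)
  finally show ?thesis .
qed

lemma stable_iff:
  assumes p: "p \<ge> 1"
  shows "stable p w S \<longleftrightarrow> (\<exists>c>0. \<forall>f\<in>Lpw p w. ennreal c * wint p w (enorm f) \<le> wint p w (enorm (S f)))"
proof
  assume "stable p w S"
  then obtain c where c: "c > 0" and st: "\<And>f. f \<in> Lpw p w \<Longrightarrow> ennreal c * wnorm p w f \<le> wnorm p w (S f)"
    by (auto simp: stable_def)
  show "\<exists>c>0. \<forall>f\<in>Lpw p w. ennreal c * wint p w (enorm f) \<le> wint p w (enorm (S f))"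
  proof (intro exI[of _ "c powr p"] conjI ballI)
    fix f assume "f \<in> Lpw p w"
    from st[OF this] have "epowr (ennreal c * wnorm p w f) p \<le> epowr (wnorm p w (S f)) p"
      using p by (intro epowr_mono) auto
    then show "ennreal (c powr p) * wint p w (enorm f) \<le> wint p w (enorm (S f))"
      using p c by (simp add: wnorm_eq epowr_mult epowr_epowr epowr_ennreal)
  qed (use c in simp)
next
  assume "\<exists>c>0. \<forall>f\<in>Lpw p w. ennreal c * wint p w (enorm f) \<le> wint p w (enorm (S f))"
  then obtain c where c: "c > 0" and st: "\<And>f. f \<in> Lpw p w \<Longrightarrow> ennreal c * wint p w (enorm f) \<le> wint p w (enorm (S f))"
    by auto
  show "stable p w S"
    unfolding stable_def
  proof (intro exI[of _ "c powr (1 / p)"] conjI ballI)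
    fix f assume "f \<in> Lpw p w"
    from st[OF this] have "epowr (ennreal c * wint p w (enorm f)) (1 / p) \<le> wnorm p w (S f)"
      unfolding wnorm_eq using p by (intro epowr_mono) auto
    then show "ennreal (c powr (1 / p)) * wnorm p w f \<le> wnorm p w (S f)"
      using c by (simp add: wnorm_eq epowr_mult epowr_ennreal)
  qed (use c in simp)
qed

lemma Lpw_iff: "f \<in> Lpw p w \<longleftrightarrow> f \<in> borel_measurable lebesgue \<and> wint p w (enorm f) < \<top>"
  by (simp add: Lpw_def wnorm_eq)

lemma radial_decr_rad_sup: "radial_decr (rad_sup k)"
  unfolding radial_decr_def rad_sup_def by (auto intro!: SUP_subset_mono)

text \<open>The pair (x, 0) is admissible in the supremum; for a convolution kernel it recovers the
  value g x at every point.\<close>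

lemma rad_sup_ge: "k x 0 \<le> rad_sup k x"
  unfolding rad_sup_def by (rule SUP_upper2[of "(x, 0)"]) auto

lemma L1_norm_eq: "L1_norm h = integral\<^sup>N lborel h"
  by (simp add: L1_norm_def nn_integral_completion)

text \<open>The finite supremum S bounds the oscillation norm by S \<delta>^\<alpha>. In the
  threshold, S + 1 covers S = 0.\<close>

lemma kernel_osc_small:
  assumes fin: "kernel_size \<alpha> K < \<infinity>" and \<alpha>: "\<alpha> > 0" and \<epsilon>: "\<epsilon> > 0"
  shows "\<exists>\<delta>0>0. \<forall>\<delta>. 0 < \<delta> \<and> \<delta> \<le> \<delta>0 \<longrightarrow> L1_norm (rad_sup (kernel_osc \<delta> K)) \<le> ennreal \<epsilon>"
proof -
  define A where "A = (SUP \<delta> \<in> {0<..1}. ennreal (\<delta> powr (- \<alpha>)) * L1_norm (rad_sup (kernel_osc \<delta> K)))"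
  have "A < \<top>"
    using fin by (auto simp: kernel_size_def A_def)
  then obtain S where S: "A = ennreal S" "S \<ge> 0" by (cases A) auto
  have le: "L1_norm (rad_sup (kernel_osc \<delta> K)) \<le> ennreal (S * \<delta> powr \<alpha>)" if \<delta>: "0 < \<delta>" "\<delta> \<le> 1" for \<delta>
  proof -
    have "ennreal (\<delta> powr (- \<alpha>)) * L1_norm (rad_sup (kernel_osc \<delta> K)) \<le> ennreal S"
      unfolding S(1)[symmetric] A_def using \<delta> by (intro SUP_upper) auto
    then have "ennreal (\<delta> powr \<alpha>) * (ennreal (\<delta> powr (- \<alpha>)) * L1_norm (rad_sup (kernel_osc \<delta> K))) \<le> ennreal (\<delta> powr \<alpha>) * ennreal S"
      by (intro mult_left_mono) auto
    also have "ennreal (\<delta> powr \<alpha>) * (ennreal (\<delta> powr (- \<alpha>)) * L1_norm (rad_sup (kernel_osc \<delta> K))) = L1_norm (rad_sup (kernel_osc \<delta> K))"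
      using \<delta> by (subst ennreal_mult_mult) (auto simp flip: powr_add)
    finally show ?thesis using S by (simp add: mult.commute flip: ennreal_mult)
  qed
  define \<delta>0 where "\<delta>0 = min 1 ((\<epsilon> / (S + 1)) powr (1 / \<alpha>))"
  show ?thesis
  proof (intro exI[of _ \<delta>0] conjI allI impI)
    show "\<delta>0 > 0" using \<epsilon> S by (simp add: \<delta>0_def)
    fix \<delta> assume \<delta>: "0 < \<delta> \<and> \<delta> \<le> \<delta>0"
    have "\<delta> powr \<alpha> \<le> ((\<epsilon> / (S + 1)) powr (1 / \<alpha>)) powr \<alpha>"
      using \<delta> \<alpha> by (intro powr_mono2) (auto simp: \<delta>0_def)
    also have "\<dots> = \<epsilon> / (S + 1)" using \<alpha> \<epsilon> S by (simp add: powr_powr)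
    finally have "S * \<delta> powr \<alpha> \<le> S * (\<epsilon> / (S + 1))" using S by (intro mult_left_mono) auto
    also have "\<dots> \<le> \<epsilon>" using S \<epsilon> by (simp add: field_simps)
    finally have "ennreal (S * \<delta> powr \<alpha>) \<le> ennreal \<epsilon>" by (rule ennreal_leI)
    moreover have "L1_norm (rad_sup (kernel_osc \<delta> K)) \<le> ennreal (S * \<delta> powr \<alpha>)"
      using \<delta> by (intro le) (auto simp: \<delta>0_def)
    ultimately show "L1_norm (rad_sup (kernel_osc \<delta> K)) \<le> ennreal \<epsilon>" by (rule order_trans[rotated])
  qed
qed

theorem mainTheorem2:
  fixes g :: "real ^ ('n::finite) \<Rightarrow> complex"
    and w :: "real ^ 'n \<Rightarrow> real"
    and \<alpha> p :: real
  assumes "integrable lebesgue g"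
    and "0 < \<alpha>" and "\<alpha> \<le> 1"
    and "kernel_size \<alpha> (\<lambda>x y. g (x - y)) < \<infinity>"
    and "1 \<le> p"
    and "Ap_weight p w"
  shows "stability_spectrum p w (conv_op g) = {fourier g \<xi> | \<xi>. True} \<union> {0}"
proof -
  let ?K = "\<lambda>x y. g (x - y)"
  have p: "p \<ge> 1" by fact
  have gm: "g \<in> borel_measurable lebesgue" using assms(1) by simp
  \<comment> \<open>The locale works with a Borel kernel. The majorant stays defined from g itself,
    because a change on a null set could alter the pointwise supremum
    \<open>rad_sup\<close>.\<close>
  obtain g' N where g' [measurable]: "g' \<in> borel_measurable borel" and N: "N \<in> null_sets lborel"
    and gN: "\<And>x. x \<notin> N \<Longrightarrow> g' x = g x" "\<And>x. x \<in> N \<Longrightarrow> g' x = 0"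
    using borel_version[OF gm] by blast
  have aeN: "AE x in lborel. x \<notin> N" by (rule AE_not_in[OF N])
  have gg': "AE x in lborel. g x = g' x" using aeN by eventually_elim (simp add: gN)
  define H where "H = rad_sup (kernel_abs ?K)"
  have w: "weight w" using assms(6) by (simp add: Ap_weight_def)
  obtain K where K: "K \<ge> 0" and Kb: "\<And>H F. F \<in> borel_measurable borel \<Longrightarrow> radial_decr H \<Longrightarrow> integral\<^sup>N lborel H < \<top> \<Longrightarrow>
    wint p w (nconv H F) \<le> ennreal K * epowr (integral\<^sup>N lborel H) p * wint p w F"
    using wint_nconv_le[OF assms(6) p] by blast
  have g'le: "norm (g' x) \<le> norm (g x)" for x using gN by (cases "x \<in> N") auto
  interpret weighted_kernel g' H p K w
  proof
    have "integrable lebesgue g'"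
      by (rule Bochner_Integration.integrable_bound[OF assms(1)]) (auto intro: measurable_completion simp: g'le)
    then show "integrable lborel g'" by (simp add: integrable_completion)
    show "radial_decr H" unfolding H_def by (rule radial_decr_rad_sup)
    show "integral\<^sup>N lborel H < \<top>"
      using assms(4) unfolding H_def kernel_size_def by (auto simp: L1_norm_eq)
    show "enorm g' x \<le> H x" for x
      using rad_sup_ge[of "kernel_abs ?K" x] order_trans[OF ennreal_leI[OF g'le[of x]]]
      by (simp add: H_def enorm_def kernel_abs_def)
    show "\<exists>\<delta>0>0. \<forall>\<delta>. 0 < \<delta> \<and> \<delta> \<le> \<delta>0 \<longrightarrow> osc_le g' \<delta> \<epsilon>"
      if \<epsilon>: "\<epsilon> > 0" for \<epsilon>
    proof -
      obtain \<delta>0 where \<delta>0: "\<delta>0 > 0" and os: "\<And>\<delta>. 0 < \<delta> \<Longrightarrow> \<delta> \<le> \<delta>0 \<Longrightarrow> L1_norm (rad_sup (kernel_osc \<delta> ?K)) \<le> ennreal \<epsilon>"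
        using kernel_osc_small[OF assms(4,2) \<epsilon>] by blast
      show ?thesis
      proof (intro exI[of _ \<delta>0] conjI allI impI \<delta>0)
        fix \<delta> assume \<delta>: "0 < \<delta> \<and> \<delta> \<le> \<delta>0"
        let ?\<Omega> = "rad_sup (kernel_osc \<delta> ?K)"
        have "ennreal (norm (g' x - g' (x - v))) \<le> ?\<Omega> x"
          if "x \<notin> N" "x - v \<notin> N" "4 * \<delta> \<le> infnorm x" "infnorm v \<le> \<delta>" for x v
        proof -
          \<comment> \<open>The pair (x, v) is an admissible perturbation of (x, 0), and the kernel
            has the values g (x - v) and g x there.\<close>
          have "ennreal (norm (g' x - g' (x - v))) = ennreal (norm (?K x v - ?K x 0))"
            using that by (simp add: gN norm_minus_commute)
          also have "\<dots> \<le> kernel_osc \<delta> ?K x 0"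
            unfolding kernel_osc_def using that \<delta>
            by (auto simp: infnorm_0 intro!: SUP_upper2[of "(x, v)"])
          also have "\<dots> \<le> ?\<Omega> x" by (rule rad_sup_ge)
          finally show ?thesis .
        qed
        then show "osc_le g' \<delta> \<epsilon>"
          unfolding osc_le_def using os[of \<delta>] \<delta> aeN radial_decr_rad_sup
          by (intro exI[of _ ?\<Omega>] exI[of _ N]) (auto simp: L1_norm_eq)
      qed
    qed
    show "p \<ge> 1" by fact
    show "w \<in> borel_measurable lebesgue" by (rule weight_measurable[OF w])
    show "w x > 0" for x using w by (simp add: weight_def)
    show "(\<integral>\<^sup>+ x. indicator (box0 1) x * ennreal (w x) \<partial>lebesgue) < \<top>"
    proof -
      have "box0 1 = cbox (0 - (\<chi> i. 1)) (0 + (\<chi> i. 1) :: real ^ 'n)"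
        using translated_box0_eq[of "0 :: real ^ 'n" 1] by (simp add: box0_def)
      then have "set_integrable lebesgue (box0 1) w" using w by (simp add: weight_def)
      then have "(\<integral>\<^sup>+ x. ennreal (norm (indicator (box0 1) x *\<^sub>R w x)) \<partial>lebesgue) < \<top>"
        by (simp add: set_integrable_def integrable_iff_bounded)
      moreover have "(\<integral>\<^sup>+ x. indicator (box0 1) x * ennreal (w x) \<partial>lebesgue) = (\<integral>\<^sup>+ x. ennreal (norm (indicator (box0 1) x *\<^sub>R w x)) \<partial>lebesgue)"
        using w by (intro nn_integral_cong) (auto simp: indicator_def weight_def less_imp_le)
      ultimately show ?thesis by simp
    qed
    show "K \<ge> 0" by fact
    show "wint p w (nconv H' F) \<le> ennreal K * epowr (integral\<^sup>N lborel H') p * wint p w F"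
      if "F \<in> borel_measurable borel" "radial_decr H'" "integral\<^sup>N lborel H' < \<top>" for H' F
      by (rule Kb[OF that])
  qed
  have fourier: "fourier g \<xi> = ghat \<xi>" for \<xi>
  proof -
    have m: "(\<lambda>x. g' x * exp (- (\<i> * of_real (x \<bullet> \<xi>)))) \<in> borel_measurable lborel" by measurable
    have ae: "AE x in lborel. g x * exp (- (\<i> * of_real (x \<bullet> \<xi>))) = g' x * exp (- (\<i> * of_real (x \<bullet> \<xi>)))"
      using gg' by eventually_elim simp
    have "fourier g \<xi> = (LINT x|lebesgue. g' x * exp (- (\<i> * of_real (x \<bullet> \<xi>))))"
      unfolding fourier_def using completion_AE_measurable[OF ae m] AE_completion[OF ae]
      by (intro integral_cong_AE) (auto intro: measurable_completion[OF m])
    then show ?thesis by (simp only: integral_completion[OF m] ghat_def)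
  qed
  have S_eq: "Wn (\<lambda>x. z * f x - conv_op g f x) = Wn (Tz z f')"
    if [measurable]: "f' \<in> borel_measurable borel" and ff': "AE x in lborel. f x = f' x" for z f f'
  proof (rule wint_cong_AE)
    show "AE x in lborel. enorm (\<lambda>x. z * f x - conv_op g f x) x = enorm (Tz z f') x"
      using ff' by eventually_elim (simp add: enorm_def Tz_def conv_op_eq_cconv[OF g' that(1) ff' gg'])
  qed
  have not_stable: "z \<in> stability_spectrum p w (conv_op g)"
    if apx: "\<And>\<epsilon>. \<epsilon> > 0 \<Longrightarrow> \<exists>f. nice f \<and> 0 < Wn f \<and> Wn f < \<top> \<and> Wn (Tz z f) \<le> ennreal \<epsilon> * Wn f" for z
  proof (rule ccontr)
    assume "z \<notin> stability_spectrum p w (conv_op g)"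
    then obtain c where c: "c > 0" and st: "\<And>f. f \<in> Lpw p w \<Longrightarrow> ennreal c * Wn f \<le> Wn (\<lambda>x. z * f x - conv_op g f x)"
      by (auto simp: stability_spectrum_def stable_iff[OF p])
    \<comment> \<open>Half of the stability constant gives a contradiction because the norm of f is
      positive and finite.\<close>
    obtain f where f: "nice f" "0 < Wn f" "Wn f < \<top>" "Wn (Tz z f) \<le> ennreal (c / 2) * Wn f"
      using apx[of "c / 2"] c by auto
    have [measurable]: "f \<in> borel_measurable borel" using f(1) by (rule nice_measurable)
    have "f \<in> Lpw p w" using f(3) by (simp add: Lpw_iff measurable_completion)
    then have "ennreal c * Wn f \<le> ennreal (c / 2) * Wn f"
      using st[of f] S_eq[of f f z] f(4) by simp
    then show False
      using f(2,3) c by (cases "Wn f") (auto simp flip: ennreal_mult)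
  qed
  have stab: "z \<notin> stability_spectrum p w (conv_op g)" if z: "z \<noteq> 0" "\<And>\<xi>. z \<noteq> ghat \<xi>" for z
  proof -
    obtain C where C: "C \<ge> 0" and st: "\<And>f. f \<in> borel_measurable borel \<Longrightarrow> Wn f < \<top> \<Longrightarrow> Wn f \<le> ennreal C * Wn (Tz z f)"
      using stable_borel[OF z] by blast
    \<comment> \<open>C may be 0, while a stability constant must be positive.\<close>
    have "ennreal (1 / (C + 1)) * Wn f \<le> Wn (\<lambda>x. z * f x - conv_op g f x)" if f: "f \<in> Lpw p w" for f
    proof -
      obtain f' M where f' [measurable]: "f' \<in> borel_measurable borel" and M: "M \<in> null_sets lborel" and fM: "\<And>x. x \<notin> M \<Longrightarrow> f' x = f x"
        using borel_version[of f] f unfolding Lpw_iff by metis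
      have ff': "AE x in lborel. f x = f' x" using AE_not_in[OF M] by eventually_elim (simp add: fM)
      have e: "Wn f = Wn f'"
        by (rule wint_cong_AE) (use ff' in eventually_elim, simp add: enorm_def)
      have "Wn f' \<le> ennreal C * Wn (Tz z f')"
        using f by (intro st f') (simp add: Lpw_iff flip: e)
      also have "\<dots> \<le> ennreal (C + 1) * Wn (Tz z f')"
        by (intro mult_right_mono ennreal_leI) auto
      finally have "ennreal (1 / (C + 1)) * Wn f' \<le> ennreal (1 / (C + 1)) * (ennreal (C + 1) * Wn (Tz z f'))"
        by (intro mult_left_mono) auto
      also have "\<dots> = Wn (Tz z f')"
        using C by (subst ennreal_mult_mult) auto
      finally show ?thesis by (simp only: e S_eq[OF f' ff'])
    qed
    then show ?thesis
      using C by (auto simp: stability_spectrum_def stable_iff[OF p] intro!: exI[of _ "1 / (C + 1)"])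
  qed
  have "ghat \<xi> \<in> stability_spectrum p w (conv_op g)" for \<xi>
    by (intro not_stable approximate_eigenfunction)
  moreover have "0 \<in> stability_spectrum p w (conv_op g)"
    by (intro not_stable approximate_kernel)
  ultimately show ?thesis
    using stab unfolding fourier by blast
qed

end
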